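(* Suppose in addition that $\kappa:\mathbb{R}\to[0,\infty)$ is twice continuously differentiable. Let $\bar\ell\in H^1_0(0,T;\mathbb{R}^n)$ be locally optimal for (P) with associated state $\bar q=S(\bar\ell)\in H^1_0(0,T;\mathbb{R}^n)$. Then there exist an adjoint state $\xi\in L^\infty(0,T;\mathbb{R}^n)$ and a unique multiplier $\lambda\in W^{-1,\infty}(0,T;\mathbb{R}^n)$ such that, with $\bar z:=-\alpha\bar q+\bar\ell-\kappa(\mathcal{H}(\bar q))$, the following system is satisfied: \begin{align*} &\int_0^T\langle \xi(t),\dot v(t)\rangle_{\mathbb{R}^n}\,dt+\alpha\langle\lambda,v\rangle_{W^{1,1}_0(0,T;\mathbb{R}^n)}+\langle\lambda,(\kappa\circ\mathcal{H})'(\bar q)v\rangle_{W^{1,1}_0(0,T;\mathbb{R}^n)}\\ &\qquad=\int_0^T\langle j'(\bar q)(t),v(t)\rangle_{\mathbb{R}^n}\,dt+\langle\bar q(T)-q_d,v(T)\rangle_{\mathbb{R}^n}\quad\forall\,v\in W^{1,1}_0(0,T;\mathbb{R}^n),\\ &\dot{\bar q}^i\,\xi^i=0\quad\text{a.e. in }(0,T),\quad i=1,\dots,n,\\ &\langle\lambda^i,\bar z^i v\rangle_{W^{1,1}_0(0,T)}=0\quad\forall\,v\in W^{1,1}_0(0,T),\quad i=1,\dots,n,\\ &\langle\lambda,v\rangle_{W^{1,1}_0(0,T;\mathbb{R}^n)}+(\bar\ell,v)_{H^1(0,T;\mathbb{R}^n)}=0\quad\forall\,v\in H^1_0(0,T;\mathbb{R}^n).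 \end{align*}
   Context: Fix $T>0$, $n\in\mathbb{N}$, $\alpha>0$. For $p\in[1,\infty]$, $W^{1,p}_0(0,T;\mathbb{R}^n):=\{y\in W^{1,p}(0,T;\mathbb{R}^n):y(0)=0\}$ (only the initial value vanishes), $H^1_0:=W^{1,2}_0$, and $W^{-1,\infty}(0,T;\mathbb{R}^n)$ is the dual space of $W^{1,1}_0(0,T;\mathbb{R}^n)$. $(\cdot,\cdot)_{H^1(0,T;\mathbb{R}^n)}$ is the usual $H^1$ scalar product. Superscript $i$ denotes the $i$-th component; for $\lambda\in W^{-1,\infty}(0,T;\mathbb{R}^n)$, $\langle\lambda^i,v\rangle_{W^{1,1}_0(0,T)}:=\langle\lambda,v e_i\rangle_{W^{1,1}_0(0,T;\mathbb{R}^n)}$ with $e_i$ the $i$-th unit vector. Scalar functions act on vectors componentwise. Standing assumptions. The history operator is $\mathcal{H}:L^1(0,T;\mathbb{R}^n)\to W^{1,1}(0,T;\mathbb{R}^n)$, $\mathcal{H}(y)(t):=\int_0^t y(s)\,ds+y_0$, with fixed $y_0\in\mathbb{R}^n$. The function $\kappa:\mathbb{R}\to[0,\infty)$ is Lipschitz continuous, differentiable, and $\kappa'\in W^{1,2}(\mathbb{R})$. The derivative of $\kappa\circ\mathcal{H}$ is $[(\kappa\circ\mathcal{H})'(q)v](t)=\kappa'(\mathcal{H}(q)(t))\int_0^t v(s)\,ds$ (componentwise). The functional $j:L^2(0,T;\mathbb{R}^n)\to\mathbb{R}$ is continuously differentiable; $j'(q)$ is identified with an element of $L^2(0,T;\mathbb{R}^n)$.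 The desired state $q_d\in\mathbb{R}^n$ has nonnegative components. State equation. Let $\mathcal{C}:=\{\eta\in\mathbb{R}^n:\eta_i\ge0,\ i=1,\dots,n\}$ and $\mathcal{R}(\zeta,\eta):=\langle\kappa(\zeta),\eta\rangle_{\mathbb{R}^n}$ if $\eta\in\mathcal{C}$, $\mathcal{R}(\zeta,\eta):=\infty$ otherwise. For each $\ell\in H^1_0(0,T;\mathbb{R}^n)$ there is a unique $q=:S(\ell)\in H^1_0(0,T;\mathbb{R}^n)$ with $-\alpha q(t)+\ell(t)\in\partial_{2}\mathcal{R}(\mathcal{H}(q)(t),\dot q(t))$ for a.e. $t\in(0,T)$, $q(0)=0$, where $\partial_2$ is the convex subdifferential with respect to the second argument; i.e. $\dot q(t)\in\mathcal{C}$ and $\langle-\alpha q(t)+\ell(t),\eta-\dot q(t)\rangle_{\mathbb{R}^n}\le\mathcal{R}(\mathcal{H}(q)(t),\eta)-\mathcal{R}(\mathcal{H}(q)(t),\dot q(t))$ for all $\eta\in\mathbb{R}^n$ and a.e. $t$. (The unique solvability is known and may be assumed.) Optimal control problem (P): minimize $\mathcal{J}(\ell):=j(S(\ell))+\frac12\|S(\ell)(T)-q_d\|_{\mathbb{R}^n}^2+\frac12\|\ell\|^2_{H^1(0,T;\mathbb{R}^n)}$ over $\ell\in H^1_0(0,T;\mathbb{R}^n)$. $\bar\ell$ is locally optimal for (P) if there is $\rho>0$ such that $\mathcal{J}(\bar\ell)\le\mathcal{J}(\ell)$ for all $\ell\in H^1_0(0,T;\mathbb{R}^n)$ with $\|\ell-\bar\ell\|_{H^1(0,T;\mathbb{R}^n)}\le\rho$.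 *)

theory Defs
  imports "HOL-Analysis.Analysis"
begin

section \<open>Lebesgue and Sobolev spaces on open subsets of the real line\<close>

text \<open>
  Functions are total on \<^typ>\<open>real\<close>; their values outside the relevant interval are irrelevant.
  Spaces are sets of functions rather than of equivalence classes, so the norms below are
  seminorms: functions that agree almost everywhere (for Sobolev functions with continuous
  representatives: on the closed interval) are identified.
\<close>

definition Lp :: "real set \<Rightarrow> real \<Rightarrow> (real \<Rightarrow> 'a::euclidean_space) set" where
  "Lp \<Omega> p = {f \<in> borel_measurable (lebesgue_on \<Omega>).
     integrable (lebesgue_on \<Omega>) (\<lambda>t. norm (f t) powr p)}"

definition Linf :: "real set \<Rightarrow> (real \<Rightarrow> 'a::euclidean_space) set" where
  "Linf \<Omega> = {f \<in> borel_measurable (lebesgue_on \<Omega>).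
     \<exists>C. AE t in lebesgue_on \<Omega>. norm (f t) \<le> C}"

definition locally_integrable :: "real set \<Rightarrow> (real \<Rightarrow> 'a::euclidean_space) \<Rightarrow> bool" where
  "locally_integrable \<Omega> f \<longleftrightarrow>
     (\<forall>K. compact K \<and> K \<subseteq> \<Omega> \<longrightarrow> integrable (lebesgue_on K) f)"

text \<open>
  Test functions are continuously differentiable with compact support in the open set \<open>\<Omega>\<close>;
  this gives the same weak derivatives as smooth test functions.
\<close>

definition test_function :: "real set \<Rightarrow> (real \<Rightarrow> real) \<Rightarrow> bool" where
  "test_function \<Omega> \<phi> \<longleftrightarrow> \<phi> C1_differentiable_on UNIV \<and>
     (\<exists>K. compact K \<and> K \<subseteq> \<Omega> \<and> (\<forall>t. t \<notin> K \<longrightarrow> \<phi> t = 0))"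

definition has_weak_deriv ::
  "real set \<Rightarrow> (real \<Rightarrow> 'a::euclidean_space) \<Rightarrow> (real \<Rightarrow> 'a) \<Rightarrow> bool" where
  "has_weak_deriv \<Omega> f g \<longleftrightarrow> locally_integrable \<Omega> f \<and> locally_integrable \<Omega> g \<and>
     (\<forall>\<phi>. test_function \<Omega> \<phi> \<longrightarrow>
        (LINT t|lebesgue_on \<Omega>. deriv \<phi> t *\<^sub>R f t) = - (LINT t|lebesgue_on \<Omega>. \<phi> t *\<^sub>R g t))"

text \<open>A representative of the weak derivative, which is unique up to null sets.\<close>

definition weak_deriv ::
  "real set \<Rightarrow> (real \<Rightarrow> 'a::euclidean_space) \<Rightarrow> (real \<Rightarrow> 'a)" where
  "weak_deriv \<Omega> f = (SOME g. has_weak_deriv \<Omega> f g)"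

definition W1p :: "real set \<Rightarrow> real \<Rightarrow> (real \<Rightarrow> 'a::euclidean_space) set" where
  "W1p \<Omega> p = {f \<in> Lp \<Omega> p. \<exists>g \<in> Lp \<Omega> p. has_weak_deriv \<Omega> f g}"

text \<open>
  The space of \<open>W\<^sup>1\<^sup>,\<^sup>p(0,T)\<close> functions vanishing at \<open>0\<close> (and not necessarily at \<open>T\<close>).
  Its elements are given by their representatives that are continuous on \<open>[0,T]\<close>,
  which gives a meaning to the values at \<open>0\<close> and \<open>T\<close>.
\<close>

definition W1p0 :: "real \<Rightarrow> real \<Rightarrow> (real \<Rightarrow> 'a::euclidean_space) set" where
  "W1p0 T p = {f \<in> W1p {0<..<T} p. continuous_on {0..T} f \<and> f 0 = 0}"

abbreviation H10 :: "real \<Rightarrow> (real \<Rightarrow> 'a::euclidean_space) set" where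
  "H10 T \<equiv> W1p0 T 2"

definition L2_inner :: "real \<Rightarrow> (real \<Rightarrow> 'a::euclidean_space) \<Rightarrow> (real \<Rightarrow> 'a) \<Rightarrow> real" where
  "L2_inner T f g = (LINT t|lebesgue_on {0<..<T}. f t \<bullet> g t)"

definition L2_norm :: "real \<Rightarrow> (real \<Rightarrow> 'a::euclidean_space) \<Rightarrow> real" where
  "L2_norm T f = sqrt (L2_inner T f f)"

definition H1_inner :: "real \<Rightarrow> (real \<Rightarrow> 'a::euclidean_space) \<Rightarrow> (real \<Rightarrow> 'a) \<Rightarrow> real" where
  "H1_inner T f g = L2_inner T f g
     + L2_inner T (weak_deriv {0<..<T} f) (weak_deriv {0<..<T} g)"

definition H1_norm :: "real \<Rightarrow> (real \<Rightarrow> 'a::euclidean_space) \<Rightarrow> real" where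
  "H1_norm T f = sqrt (H1_inner T f f)"

definition W11_norm :: "real \<Rightarrow> (real \<Rightarrow> 'a::euclidean_space) \<Rightarrow> real" where
  "W11_norm T f = (LINT t|lebesgue_on {0<..<T}. norm (f t))
     + (LINT t|lebesgue_on {0<..<T}. norm (weak_deriv {0<..<T} f t))"

text \<open>
  The dual space of \<^term>\<open>W1p0 T 1\<close>: bounded linear functionals. Boundedness with respect to the
  seminorm makes them respect equality on \<open>[0,T]\<close>. Outside of \<^term>\<open>W1p0 T 1\<close> they are
  fixed to be \<^term>\<open>undefined\<close>, so that equality in the dual space is equality of functions.
\<close>

definition W11_dual :: "real \<Rightarrow> ((real \<Rightarrow> 'a::euclidean_space) \<Rightarrow> real) set" where
  "W11_dual T = {F \<in> extensional (W1p0 T 1).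
     (\<forall>v \<in> W1p0 T 1. \<forall>w \<in> W1p0 T 1. F (\<lambda>t. v t + w t) = F v + F w) \<and>
     (\<forall>c. \<forall>v \<in> W1p0 T 1. F (\<lambda>t. c *\<^sub>R v t) = c * F v) \<and>
     (\<exists>C. \<forall>v \<in> W1p0 T 1. \<bar>F v\<bar> \<le> C * W11_norm T v)}"

definition dual_component ::
  "((real \<Rightarrow> real ^ 'n) \<Rightarrow> real) \<Rightarrow> 'n \<Rightarrow> (real \<Rightarrow> real) \<Rightarrow> real" where
  "dual_component F i v = F (\<lambda>t. v t *\<^sub>R axis i 1)"

text \<open>
  \<open>j\<close> is continuously Fr\'echet differentiable on \<open>L\<^sup>2(0,T)\<close> with derivative \<open>j'\<close>, the latter being
  identified with an element of \<open>L\<^sup>2(0,T)\<close>. Taking \<open>h\<close> with \<^prop>\<open>L2_norm T h = 0\<close> shows that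
  \<open>j\<close> respects almost-everywhere equality.
\<close>

definition C1_functional_on_L2 ::
  "real \<Rightarrow> ((real \<Rightarrow> 'a::euclidean_space) \<Rightarrow> real) \<Rightarrow> ((real \<Rightarrow> 'a) \<Rightarrow> (real \<Rightarrow> 'a)) \<Rightarrow> bool" where
  "C1_functional_on_L2 T j j' \<longleftrightarrow>
     (\<forall>f \<in> Lp {0<..<T} 2. j' f \<in> Lp {0<..<T} 2 \<and>
        (\<forall>\<epsilon>>0. \<exists>\<delta>>0. \<forall>h \<in> Lp {0<..<T} 2. L2_norm T h < \<delta> \<longrightarrow>
           \<bar>j (\<lambda>t. f t + h t) - j f - L2_inner T (j' f) h\<bar> \<le> \<epsilon> * L2_norm T h) \<and>
        (\<forall>\<epsilon>>0. \<exists>\<delta>>0. \<forall>g \<in> Lp {0<..<T} 2. L2_norm T (\<lambda>t. g t - f t) < \<delta> \<longrightarrow>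
           L2_norm T (\<lambda>t. j' g t - j' f t) < \<epsilon>))"

section \<open>The state equation and the optimal control problem\<close>

definition vec_map :: "(real \<Rightarrow> real) \<Rightarrow> real ^ 'n \<Rightarrow> real ^ 'n" where
  "vec_map f x = (\<chi> i. f (x $ i))"

definition history :: "real ^ 'n \<Rightarrow> (real \<Rightarrow> real ^ 'n) \<Rightarrow> real \<Rightarrow> real ^ 'n" where
  "history y0 y t = (LINT s|lebesgue_on {0<..<t}. y s) + y0"

text \<open>The derivative of \<open>\<kappa> \<circ> \<H>\<close> at \<open>q\<close> in direction \<open>v\<close>.\<close>

definition kappa_history_deriv ::
  "(real \<Rightarrow> real) \<Rightarrow> real ^ 'n \<Rightarrow> (real \<Rightarrow> real ^ 'n) \<Rightarrow> (real \<Rightarrow> real ^ 'n) \<Rightarrow> real \<Rightarrow> real ^ 'n" where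
  "kappa_history_deriv \<kappa> y0 q v t =
     (\<chi> i. deriv \<kappa> (history y0 q t $ i) * (LINT s|lebesgue_on {0<..<t}. v s) $ i)"

definition dissipation :: "(real \<Rightarrow> real) \<Rightarrow> real ^ 'n \<Rightarrow> real ^ 'n \<Rightarrow> ereal" where
  "dissipation \<kappa> \<zeta> \<eta> =
     (if \<forall>i. 0 \<le> \<eta> $ i then ereal (vec_map \<kappa> \<zeta> \<bullet> \<eta>) else \<infinity>)"

definition subdifferential :: "('a::real_inner \<Rightarrow> ereal) \<Rightarrow> 'a \<Rightarrow> 'a set" where
  "subdifferential f x =
     {p. \<bar>f x\<bar> \<noteq> \<infinity> \<and> (\<forall>y. f x + ereal (p \<bullet> (y - x)) \<le> f y)}"

definition solves_state_eq ::
  "real \<Rightarrow> real \<Rightarrow> (real \<Rightarrow> real) \<Rightarrow> real ^ 'n \<Rightarrow> (real \<Rightarrow> real ^ 'n) \<Rightarrow> (real \<Rightarrow> real ^ 'n) \<Rightarrow> bool" where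
  "solves_state_eq T \<alpha> \<kappa> y0 l q \<longleftrightarrow> q \<in> H10 T \<and>
     (AE t in lebesgue_on {0<..<T}.
        - \<alpha> *\<^sub>R q t + l t
          \<in> subdifferential (dissipation \<kappa> (history y0 q t)) (weak_deriv {0<..<T} q t))"

text \<open>
  The states are normalised to vanish outside of \<open>[0,T]\<close>, so that uniqueness on \<open>[0,T]\<close>
  becomes uniqueness as a function on \<^typ>\<open>real\<close>.
\<close>

definition is_state ::
  "real \<Rightarrow> real \<Rightarrow> (real \<Rightarrow> real) \<Rightarrow> real ^ 'n \<Rightarrow> (real \<Rightarrow> real ^ 'n) \<Rightarrow> (real \<Rightarrow> real ^ 'n) \<Rightarrow> bool" where
  "is_state T \<alpha> \<kappa> y0 l q \<longleftrightarrow> solves_state_eq T \<alpha> \<kappa> y0 l q \<and> (\<forall>t. t \<notin> {0..T} \<longrightarrow> q t = 0)"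

definition sol_op ::
  "real \<Rightarrow> real \<Rightarrow> (real \<Rightarrow> real) \<Rightarrow> real ^ 'n \<Rightarrow> (real \<Rightarrow> real ^ 'n) \<Rightarrow> (real \<Rightarrow> real ^ 'n)" where
  "sol_op T \<alpha> \<kappa> y0 l = (THE q. is_state T \<alpha> \<kappa> y0 l q)"

definition cost ::
  "real \<Rightarrow> real \<Rightarrow> (real \<Rightarrow> real) \<Rightarrow> real ^ 'n \<Rightarrow> ((real \<Rightarrow> real ^ 'n) \<Rightarrow> real) \<Rightarrow> real ^ 'n
    \<Rightarrow> (real \<Rightarrow> real ^ 'n) \<Rightarrow> real" where
  "cost T \<alpha> \<kappa> y0 j qd l = j (sol_op T \<alpha> \<kappa> y0 l)
     + 1/2 * (norm (sol_op T \<alpha> \<kappa> y0 l T - qd))\<^sup>2 + 1/2 * (H1_norm T l)\<^sup>2"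

definition locally_optimal ::
  "real \<Rightarrow> real \<Rightarrow> (real \<Rightarrow> real) \<Rightarrow> real ^ 'n \<Rightarrow> ((real \<Rightarrow> real ^ 'n) \<Rightarrow> real) \<Rightarrow> real ^ 'n
    \<Rightarrow> (real \<Rightarrow> real ^ 'n) \<Rightarrow> bool" where
  "locally_optimal T \<alpha> \<kappa> y0 j qd lb \<longleftrightarrow> lb \<in> H10 T \<and>
     (\<exists>\<rho>>0. \<forall>l \<in> H10 T. H1_norm T (\<lambda>t. l t - lb t) \<le> \<rho> \<longrightarrow>
        cost T \<alpha> \<kappa> y0 j qd lb \<le> cost T \<alpha> \<kappa> y0 j qd l)"

end

theory Submission
  imports Defs
begin

text \<open>
  Multiplicative perturbations of the complementarity system \<open>q' \<ge> 0\<close>, \<open>z \<le> 0\<close>, \<open>z q' = 0\<close> suffice: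
  for \<open>q' (1 + \<epsilon> m)\<close> and \<open>z (1 + \<epsilon> \<phi>)\<close> the control \<open>\<alpha> q + \<kappa>(\<H>(q)) + z\<close> is explicit and smooth in \<open>\<epsilon>\<close>,
  so the control-to-state map need not be differentiated. Write \<open>- H1_inner T lb v = \<integral> g \<bullet> v'\<close>.
  Stationarity in \<open>\<phi>\<close> says that \<open>g z\<close> is absolutely continuous with derivative \<open>g z'\<close> and vanishes at
  \<open>T\<close>; stationarity in \<open>m\<close> says \<open>\<xi> q' = 0\<close>, where \<open>\<xi>\<close> is \<open>- \<alpha> g\<close> plus a continuous function.

  The crux is that \<open>g\<close> is essentially bounded: on \<open>{q' \<noteq> 0}\<close> because \<open>\<xi> = 0\<close> there, on
  \<open>{z = 0, q' = 0}\<close> because \<open>z' = 0\<close> almost everywhere on \<open>{z = 0}\<close>, and on \<open>{z \<noteq> 0}\<close> because \<open>g\<close> is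
  constant on each component and \<open>z'\<close> has mean value zero on components with both endpoints in
  \<open>{z = 0}\<close>. Hence \<open>v \<mapsto> \<integral> g \<bullet> v'\<close> is bounded on \<open>W\<^sup>1\<^sup>,\<^sup>1\<^sub>0\<close>, and density of \<open>H\<^sup>1\<^sub>0\<close> gives uniqueness.
\<close>

section \<open>Absolutely continuous functions\<close>

text \<open>A priori \<open>g\<close> is only square integrable, because \<open>lb\<close> is only
  in \<open>H10 T\<close>; its functional then makes sense on \<open>H10 T\<close> but not on
  \<open>W1p0 T 1\<close>. Inserting \<open>l' = z' + \<alpha> q' + \<kappa>'(history) q\<close>
  gives \<open>g = - (z' + \<alpha> q') - c\<close> with \<open>c\<close> continuous, so every piece
  of information on \<open>z'\<close> and \<open>q'\<close> bounds \<open>g\<close>. Components of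
  \<open>{z \<noteq> 0}\<close> that are not enclosed by two zeros need another argument: one that
  reaches \<open>T\<close> carries \<open>g = 0\<close> because \<open>g z\<close> vanishes at
  \<open>T\<close>, and one that starts at 0 contributes a single constant. The conditions on \<phi>
  at the two ends differ for a reason. As \<open>z(0) = - \<kappa>(y0)\<close> need not be zero,
  \<phi> must vanish at 0 to keep the control in \<open>H10 T\<close>; its value at \<open>T\<close>
  is free, and this freedom forces \<open>g z\<close> to vanish there. The second derivative of
  \<kappa> enters because the control is measured in H1: \<open>\<kappa>(history)\<close> is
  differentiated both in time and in \<epsilon>. Absolutely continuous functions are treated as
  pairs of a function and an integrable density, so that derivatives are compared only almost
  everywhere.\<close>

lemma AE_interval_iff_negligible:
  "(AE t in lebesgue_on {a<..<b}. P t) \<longleftrightarrow> (\<exists>N. negligible N \<and> (\<forall>t\<in>{a..b} - N. P t))"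
  for a b :: real
proof
  assume "AE t in lebesgue_on {a<..<b}. P t"
  then have "AE t in lebesgue. t \<in> {a<..<b} \<longrightarrow> P t"
    by (subst (asm) AE_restrict_space_iff) auto
  then obtain N where N: "negligible N" "{t. \<not> (t \<in> {a<..<b} \<longrightarrow> P t)} \<subseteq> N"
    unfolding eventually_ae_filter_negligible by auto
  \<comment> \<open>The endpoints join the null set, which makes the spike lemmas of the
    Henstock-Kurzweil integral on closed intervals applicable.\<close>
  have "negligible (N \<union> {a,b})" using N(1) by simp
  moreover have "\<forall>t\<in>{a..b} - (N \<union> {a,b}). P t"
  proof
    fix t assume "t \<in> {a..b} - (N \<union> {a,b})"
    then have "t \<notin> N" "t \<in> {a<..<b}" by auto
    then show "P t" using N(2) by blast
  qed
  ultimately show "\<exists>N. negligible N \<and> (\<forall>t\<in>{a..b} - N. P t)" by blast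
next
  assume "\<exists>N. negligible N \<and> (\<forall>t\<in>{a..b} - N. P t)"
  then obtain N where N: "negligible N" "\<forall>t\<in>{a..b} - N. P t" by blast
  have "{t. \<not> (t \<in> {a<..<b} \<longrightarrow> P t)} \<subseteq> N" using N(2) by auto
  then have "AE t in lebesgue. t \<in> {a<..<b} \<longrightarrow> P t"
    unfolding eventually_ae_filter_negligible using N(1) by blast
  then show "AE t in lebesgue_on {a<..<b}. P t"
    by (subst AE_restrict_space_iff) auto
qed

lemma AE_subinterval:
  fixes a b c d :: real
  assumes "AE t in lebesgue_on {a<..<b}. P t" "a \<le> c" "d \<le> b"
  shows "AE t in lebesgue_on {c<..<d}. P t"
  using assms unfolding AE_interval_iff_negligible by fastforce

lemma AE_intervalI:
  fixes a b :: real
  assumes "\<And>t. a < t \<Longrightarrow> t < b \<Longrightarrow> P t"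
  shows "AE t in lebesgue_on {a<..<b}. P t"
  using assms by (intro AE_I2) auto

lemma integral_cong_AE_interval:
  fixes f g :: "real \<Rightarrow> 'a::euclidean_space"
  assumes "AE t in lebesgue_on {a<..<b}. f t = g t"
  shows "integral {a..b} f = integral {a..b} g"
proof -
  obtain N where "negligible N" "\<forall>t\<in>{a..b} - N. f t = g t"
    using assms unfolding AE_interval_iff_negligible by blast
  then show ?thesis by (intro integral_spike[of N]) auto
qed

lemma absolutely_integrable_cong_AE_interval:
  fixes f g :: "real \<Rightarrow> 'a::euclidean_space"
  assumes "f absolutely_integrable_on {a..b}" "AE t in lebesgue_on {a<..<b}. f t = g t"
  shows "g absolutely_integrable_on {a..b}"
proof -
  obtain N where "negligible N" "\<forall>t\<in>{a..b} - N. f t = g t"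
    using assms(2) unfolding AE_interval_iff_negligible by blast
  then show ?thesis by (intro absolutely_integrable_spike[OF assms(1), of N]) auto
qed

lemma integrable_lebesgue_on_interval_iff:
  fixes f :: "real \<Rightarrow> 'a::euclidean_space"
  shows "integrable (lebesgue_on {a<..<b}) f \<longleftrightarrow> f absolutely_integrable_on {a..b}"
  unfolding absolutely_integrable_on_Icc_iff_Ioo by (simp add: set_integrable_def integrable_restrict_space)

lemma LINT_interval_eq_integral:
  fixes f :: "real \<Rightarrow> 'a::euclidean_space"
  assumes "f absolutely_integrable_on {a..b}"
  shows "(LINT t|lebesgue_on {a<..<b}. f t) = integral {a..b} f"
  using assms lebesgue_integral_eq_integral[of "{a<..<b}" f]
  by (simp flip: integrable_lebesgue_on_interval_iff add: integral_open_interval_real)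

lemma absolutely_integrable_continuous_mult:
  fixes f g :: "real \<Rightarrow> real"
  assumes "continuous_on {a..b} f" "g absolutely_integrable_on {a..b}"
  shows "(\<lambda>t. f t * g t) absolutely_integrable_on {a..b}"
proof (rule absolutely_integrable_bounded_measurable_product_real[OF _ _ _ assms(2)])
  show "f \<in> borel_measurable (lebesgue_on {a..b})"
    by (rule continuous_imp_measurable_on_sets_lebesgue[OF assms(1)]) simp
  show "bounded (f ` {a..b})"
    by (rule compact_imp_bounded[OF compact_continuous_image[OF assms(1)]]) simp
qed simp

lemma AE_eq_zero_if_integral_norm_zero:
  fixes f :: "real \<Rightarrow> 'a::euclidean_space"
  assumes "f absolutely_integrable_on {a..b}" "integral {a..b} (\<lambda>t. norm (f t)) = 0"
  shows "AE t in lebesgue_on {a<..<b}. f t = 0"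
proof -
  have "integrable (lebesgue_on {a<..<b}) (\<lambda>t. norm (f t))"
    using assms(1) by (simp add: integrable_lebesgue_on_interval_iff absolutely_integrable_norm[unfolded o_def])
  moreover from this have "(LINT t|lebesgue_on {a<..<b}. norm (f t)) = 0"
    using assms(2) by (subst LINT_interval_eq_integral) (auto simp: integrable_lebesgue_on_interval_iff)
  ultimately show ?thesis
    by (subst (asm) integral_nonneg_eq_0_iff_AE) auto
qed

text \<open>Henstock's lemma makes the sum of \<open>norm (measure k * d x - integral k d)\<close>
  small over fine partitions. All integrals over cells vanish, so these are Riemann sums of
  \<open>norm d\<close>, whose integral is therefore 0.\<close>

lemma AE_eq_zero_if_primitive_zero:
  fixes d :: "real \<Rightarrow> 'a::euclidean_space"
  assumes d: "d absolutely_integrable_on {a..b}"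
    and z: "\<And>s t. a \<le> s \<Longrightarrow> s \<le> t \<Longrightarrow> t \<le> b \<Longrightarrow> integral {s..t} d = 0"
  shows "AE t in lebesgue_on {a<..<b}. d t = 0"
proof (cases "a \<le> b")
  case True
  have di: "d integrable_on cbox a b"
    using d set_lebesgue_integral_eq_integral(1) by fastforce
  have "((\<lambda>t. norm (d t)) has_integral 0) (cbox a b)"
    unfolding has_integral
  proof (intro allI impI)
    fix e :: real assume "e > 0"
    obtain \<gamma> where g: "gauge \<gamma>"
      and H: "\<And>p. p tagged_partial_division_of cbox a b \<Longrightarrow> \<gamma> fine p \<Longrightarrow>
         (\<Sum>(x,k)\<in>p. norm (measure lborel k *\<^sub>R d x - integral k d)) < e"
      using Henstock_lemma[OF di \<open>e > 0\<close>] by blast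
    show "\<exists>\<gamma>. gauge \<gamma> \<and> (\<forall>\<D>. \<D> tagged_division_of cbox a b \<and> \<gamma> fine \<D> \<longrightarrow>
            norm ((\<Sum>(x, k)\<in>\<D>. measure lborel k *\<^sub>R norm (d x)) - 0) < e)"
    proof (intro exI[of _ \<gamma>] conjI g allI impI)
      fix p assume p: "p tagged_division_of cbox a b \<and> \<gamma> fine p"
      have "(\<Sum>(x,k)\<in>p. norm (measure lborel k *\<^sub>R d x - integral k d)) < e"
        using p H tagged_division_of_def by blast
      also have "(\<Sum>(x,k)\<in>p. norm (measure lborel k *\<^sub>R d x - integral k d)) = (\<Sum>(x, k)\<in>p. measure lborel k *\<^sub>R norm (d x))"
      proof (intro sum.cong refl, clarify)
        fix x k assume xk: "(x,k) \<in> p"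
        then obtain s t where st: "k = cbox s t" "k \<subseteq> cbox a b" "x \<in> k"
          using tagged_division_ofD(2-4)[OF conjunct1[OF p]] by meson
        then have "integral k d = 0" using z[of s t] by auto
        then show "norm (measure lborel k *\<^sub>R d x - integral k d) = measure lborel k *\<^sub>R norm (d x)" by simp
      qed
      finally have *: "(\<Sum>(x, k)\<in>p. measure lborel k *\<^sub>R norm (d x)) < e" .
      moreover have "0 \<le> (\<Sum>(x, k)\<in>p. measure lborel k *\<^sub>R norm (d x))"
        by (intro sum_nonneg) auto
      ultimately show "norm ((\<Sum>(x, k)\<in>p. measure lborel k *\<^sub>R norm (d x)) - 0) < e" by simp
    qed
  qed
  then have "integral {a..b} (\<lambda>t. norm (d t)) = 0" by (simp add: integral_unique)
  then show ?thesis using AE_eq_zero_if_integral_norm_zero d by blast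
next
  case False
  then show ?thesis by (intro AE_I2) auto
qed

section \<open>Calculus of absolutely continuous functions\<close>

text \<open>The density is carried along explicitly and matters only up to null sets;
  differentiability of \<open>f\<close> at individual points is not asserted.\<close>

definition ac_on :: "real \<Rightarrow> real \<Rightarrow> (real \<Rightarrow> 'a::euclidean_space) \<Rightarrow> (real \<Rightarrow> 'a) \<Rightarrow> bool" where
  "ac_on a b f f' \<longleftrightarrow> f' absolutely_integrable_on {a..b} \<and>
     (\<forall>t\<in>{a..b}. f t = f a + integral {a..t} f')"

lemma ac_on_absolutely_integrable: "ac_on a b f f' \<Longrightarrow> f' absolutely_integrable_on {a..b}"
  unfolding ac_on_def by blast

lemma ac_on_integrable: "ac_on a b f f' \<Longrightarrow> f' integrable_on {a..b}"
  using ac_on_absolutely_integrable set_lebesgue_integral_eq_integral(1) by blast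

lemma ac_on_eq: "ac_on a b f f' \<Longrightarrow> t \<in> {a..b} \<Longrightarrow> f t = f a + integral {a..t} f'"
  unfolding ac_on_def by blast

lemma ac_on_diff:
  assumes "ac_on a b f f'" "a \<le> s" "s \<le> t" "t \<le> b"
  shows "f t - f s = integral {s..t} f'"
proof -
  have "f' integrable_on {a..t}"
    using integrable_on_subinterval[OF ac_on_integrable[OF assms(1)], of a t] assms by auto
  then have *: "integral {a..s} f' + integral {s..t} f' = integral {a..t} f'"
    using assms by (intro Henstock_Kurzweil_Integration.integral_combine) auto
  have "f t - f s = integral {a..t} f' - integral {a..s} f'"
    using ac_on_eq[OF assms(1), of t] ac_on_eq[OF assms(1), of s] assms by simp
  then show ?thesis unfolding *[symmetric] by simp
qed

lemma ac_on_subinterval: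
  assumes "ac_on a b f f'" "a \<le> c" "d \<le> b"
  shows "ac_on c d f f'"
  unfolding ac_on_def
proof (intro conjI ballI)
  show "f' absolutely_integrable_on {c..d}"
    using absolutely_integrable_on_subinterval[OF ac_on_absolutely_integrable[OF assms(1)], of c d] assms by simp
  show "f t = f c + integral {c..t} f'" if "t \<in> {c..d}" for t
    using ac_on_diff[OF assms(1), of c t] assms that by (simp add: algebra_simps)
qed

lemma ac_on_continuous:
  assumes "ac_on a b f f'"
  shows "continuous_on {a..b} f"
proof -
  have "continuous_on {a..b} (\<lambda>t. f a + integral {a..t} f')"
    by (intro continuous_intros indefinite_integral_continuous_1 ac_on_integrable[OF assms])
  then show ?thesis
    by (rule continuous_on_eq) (simp flip: ac_on_eq[OF assms])
qed

lemma ac_on_cong: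
  assumes "ac_on a b f f'" "\<And>t. t \<in> {a..b} \<Longrightarrow> g t = f t"
    and ae: "AE t in lebesgue_on {a<..<b}. f' t = g' t"
  shows "ac_on a b g g'"
  unfolding ac_on_def
proof (intro conjI ballI)
  show "g' absolutely_integrable_on {a..b}"
    using absolutely_integrable_cong_AE_interval[OF ac_on_absolutely_integrable[OF assms(1)] ae] .
  fix t assume t: "t \<in> {a..b}"
  have "integral {a..t} f' = integral {a..t} g'"
    using t by (intro integral_cong_AE_interval AE_subinterval[OF ae]) auto
  then show "g t = g a + integral {a..t} g'"
    using ac_on_eq[OF assms(1) t] assms(2)[OF t] assms(2)[of a] t by simp
qed

lemma ac_on_integral:
  assumes "g absolutely_integrable_on {a..b}"
  shows "ac_on a b (\<lambda>t. integral {a..t} g) g"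
  using assms by (auto simp: ac_on_def)

lemma ac_on_const: "ac_on a b (\<lambda>t. c) (\<lambda>t. 0)"
  by (simp add: ac_on_def)

lemma ac_on_add:
  assumes "ac_on a b f f'" "ac_on a b g g'"
  shows "ac_on a b (\<lambda>t. f t + g t) (\<lambda>t. f' t + g' t)"
  unfolding ac_on_def
proof (intro conjI ballI)
  show "(\<lambda>t. f' t + g' t) absolutely_integrable_on {a..b}"
    by (rule set_integral_add(1)[OF ac_on_absolutely_integrable[OF assms(1)] ac_on_absolutely_integrable[OF assms(2)]])
  fix t assume t: "t \<in> {a..b}"
  have "integral {a..t} (\<lambda>t. f' t + g' t) = integral {a..t} f' + integral {a..t} g'"
    by (rule Henstock_Kurzweil_Integration.integral_add)
      (use t integrable_on_subinterval[OF ac_on_integrable[OF assms(1)], of a t]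
        integrable_on_subinterval[OF ac_on_integrable[OF assms(2)], of a t] in auto)
  then show "f t + g t = f a + g a + integral {a..t} (\<lambda>t. f' t + g' t)"
    using ac_on_eq[OF assms(1) t] ac_on_eq[OF assms(2) t] by simp
qed

lemma ac_on_linear:
  assumes f: "ac_on a b f f'" and L: "bounded_linear L"
  shows "ac_on a b (\<lambda>t. L (f t)) (\<lambda>t. L (f' t))"
  unfolding ac_on_def
proof (intro conjI ballI)
  show "(\<lambda>t. L (f' t)) absolutely_integrable_on {a..b}"
    using absolutely_integrable_linear[OF ac_on_absolutely_integrable[OF f] L] by (simp add: o_def)
  fix t assume t: "t \<in> {a..b}"
  have "integral {a..t} (L \<circ> f') = L (integral {a..t} f')"
    by (rule integral_linear[OF integrable_on_subinterval[OF ac_on_integrable[OF f]] L]) (use t in auto)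
  then show "L (f t) = L (f a) + integral {a..t} (\<lambda>t. L (f' t))"
    using ac_on_eq[OF f t] linear_simps(1)[OF L] by (simp add: o_def)
qed

lemma ac_on_cmult:
  fixes f :: "real \<Rightarrow> real"
  shows "ac_on a b f f' \<Longrightarrow> ac_on a b (\<lambda>t. c * f t) (\<lambda>t. c * f' t)"
  by (rule ac_on_linear[OF _ bounded_linear_mult_right])

lemma ac_on_minus:
  assumes "ac_on a b f f'" "ac_on a b g g'"
  shows "ac_on a b (\<lambda>t. f t - g t) (\<lambda>t. f' t - g' t)"
  using ac_on_add[OF assms(1) ac_on_linear[OF assms(2) bounded_linear_minus[OF bounded_linear_ident]]] by simp

text \<open>The difference of two densities is a density of the zero function, so its integral over
  every subinterval vanishes.\<close>

lemma ac_on_deriv_unique: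
  assumes "ac_on a b f f'" "ac_on a b f g'"
  shows "AE t in lebesgue_on {a<..<b}. f' t = g' t"
proof -
  have *: "ac_on a b (\<lambda>t. 0) (\<lambda>t. f' t - g' t)" using ac_on_minus[OF assms] by simp
  have "AE t in lebesgue_on {a<..<b}. f' t - g' t = 0"
    using AE_eq_zero_if_primitive_zero[OF ac_on_absolutely_integrable[OF *]] ac_on_diff[OF *] by simp
  then show ?thesis by simp
qed

lemma ac_on_deriv_zero:
  assumes "ac_on a b f f'" "\<And>t. t \<in> {a..b} \<Longrightarrow> f t = c"
  shows "AE t in lebesgue_on {a<..<b}. f' t = 0"
proof -
  have "ac_on a b f (\<lambda>t. 0)"
    by (rule ac_on_cong[OF ac_on_const[of a b c]]) (use assms in auto)
  then show ?thesis using ac_on_deriv_unique[OF assms(1)] by blast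
qed

lemma ac_on_C1:
  fixes f :: "real \<Rightarrow> 'a::euclidean_space"
  assumes "\<And>t. t \<in> {a..b} \<Longrightarrow> (f has_vector_derivative f' t) (at t within {a..b})"
    and "continuous_on {a..b} f'"
  shows "ac_on a b f f'"
  unfolding ac_on_def
proof (intro conjI ballI)
  show "f' absolutely_integrable_on {a..b}"
    by (rule absolutely_integrable_continuous_real[OF assms(2)])
  fix t assume t: "t \<in> {a..b}"
  have "(f' has_integral (f t - f a)) {a..t}"
    using t by (intro fundamental_theorem_of_calculus)
      (auto intro: has_vector_derivative_within_subset[OF assms(1)])
  then show "f t = f a + integral {a..t} f'" by (simp add: integral_unique)
qed

text \<open>By the intermediate value theorem the values of \<open>f\<close> cover the segment
  between \<open>f s\<close> and \<open>f t\<close>. Hence the segment lies in \<open>X\<close>, and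
  the intermediate point supplied by the mean value theorem for \<open>F\<close> is itself a value
  of \<open>f\<close>. Differentiability within \<open>X\<close> admits functions such as
  \<open>inverse\<close> away from 0.\<close>

lemma MVT_composition:
  fixes f F F' :: "real \<Rightarrow> real"
  assumes "s \<le> t" and cf: "continuous_on {s..t} f"
    and X: "\<And>x. x \<in> {s..t} \<Longrightarrow> f x \<in> X"
    and F: "\<And>x. x \<in> X \<Longrightarrow> (F has_real_derivative F' x) (at x within X)"
  shows "\<exists>\<xi>\<in>{s..t}. F (f t) - F (f s) = F' (f \<xi>) * (f t - f s)"
proof -
  have iv: "\<exists>\<xi>\<in>{s..t}. f \<xi> = y" if "y \<in> closed_segment (f s) (f t)" for y
  proof (cases "f s \<le> f t")
    case True
    then show ?thesis using IVT'[of f s y t] that assms(1) cf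
      by (auto simp: closed_segment_eq_real_ivl)
  next
    case False
    then show ?thesis using IVT2'[of f t y s] that assms(1) cf
      by (auto simp: closed_segment_eq_real_ivl)
  qed
  then have sub: "closed_segment (f s) (f t) \<subseteq> X" using X by blast
  have der: "(F has_derivative (*) (F' y)) (at y within closed_segment (f s) (f t))"
    if "y \<in> closed_segment (f s) (f t)" for y
    using DERIV_subset[OF F sub] sub that by (auto simp: has_field_derivative_def)
  consider "f s < f t" | "f t < f s" | "f s = f t" by linarith
  then obtain y where "y \<in> closed_segment (f s) (f t)" "F (f t) - F (f s) = F' y * (f t - f s)"
  proof cases
    case 1
    then obtain y where "y \<in> {f s<..<f t}" "F (f t) - F (f s) = F' y * (f t - f s)"
      using mvt_simple[of "f s" "f t" F "\<lambda>y. (*) (F' y)"] der by (auto simp: closed_segment_eq_real_ivl)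
    then show thesis using that[of y] 1 by (auto simp: closed_segment_eq_real_ivl)
  next
    case 2
    then obtain y where "y \<in> {f t<..<f s}" "F (f s) - F (f t) = F' y * (f s - f t)"
      using mvt_simple[of "f t" "f s" F "\<lambda>y. (*) (F' y)"] der by (auto simp: closed_segment_eq_real_ivl)
    then show thesis using that[of y] 2 by (auto simp: closed_segment_eq_real_ivl algebra_simps)
  next
    case 3
    then show thesis using that[of "f s"] by auto
  qed
  then show ?thesis using iv[of y] by auto
qed

text \<open>On an interval where \<open>F' (f t)\<close> oscillates by at most \<eta>, the defect
  \<open>D\<close> between \<open>F (f t)\<close> and the claimed primitive changes by at most
  \<eta> times the integral of \<open>\<bar>f'\<bar>\<close>. Summing over a fine grid and letting
  \<eta> tend to 0 shows that \<open>D\<close> is constant.\<close>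

lemma ac_on_chain:
  fixes f f' F F' :: "real \<Rightarrow> real"
  assumes f: "ac_on a b f f'"
    and X: "\<And>t. t \<in> {a..b} \<Longrightarrow> f t \<in> X"
    and F: "\<And>x. x \<in> X \<Longrightarrow> (F has_real_derivative F' x) (at x within X)"
    and F': "continuous_on X F'"
  shows "ac_on a b (\<lambda>t. F (f t)) (\<lambda>t. F' (f t) * f' t)"
proof -
  define h where "h t = F' (f t)" for t
  define p where "p t = h t * f' t" for t
  have ch: "continuous_on {a..b} h"
    unfolding h_def using continuous_on_compose2[OF F' ac_on_continuous[OF f]] X by blast
  have pa: "p absolutely_integrable_on {a..b}"
    unfolding p_def using absolutely_integrable_continuous_mult[OF ch ac_on_absolutely_integrable[OF f]] .
  define N where "N t = integral {a..t} (\<lambda>x. \<bar>f' x\<bar>)" for t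
  have na: "(\<lambda>x. \<bar>f' x\<bar>) absolutely_integrable_on {a..b}"
    using ac_on_absolutely_integrable[OF f] by (rule set_integrable_abs)
  have acp: "ac_on a b (\<lambda>t. integral {a..t} p) p" and acn: "ac_on a b N (\<lambda>x. \<bar>f' x\<bar>)"
    unfolding N_def using ac_on_integral pa na by blast+
  define D where "D t = F (f t) - integral {a..t} p" for t
  have local: "\<bar>D t - D s\<bar> \<le> \<eta> * (N t - N s)"
    if st: "a \<le> s" "s \<le> t" "t \<le> b" and osc: "\<And>x y. x \<in> {s..t} \<Longrightarrow> y \<in> {s..t} \<Longrightarrow> \<bar>h x - h y\<bar> \<le> \<eta>"
    for s t \<eta>
  proof -
    have int: "g integrable_on {s..t}" if "g absolutely_integrable_on {a..b}" for g :: "real \<Rightarrow> real"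
      using that st integrable_on_subinterval[of g "{a..b}" s t] set_lebesgue_integral_eq_integral(1) by auto
    obtain \<xi> where xi: "\<xi> \<in> {s..t}" "F (f t) - F (f s) = h \<xi> * (f t - f s)"
    proof -
      have "continuous_on {s..t} f" by (rule continuous_on_subset[OF ac_on_continuous[OF f]]) (use st in auto)
      moreover have "f x \<in> X" if "x \<in> {s..t}" for x using X that st by auto
      ultimately show thesis using MVT_composition[of s t f X F F'] st F that unfolding h_def by blast
    qed
    have i1: "(\<lambda>x. h \<xi> * f' x) integrable_on {s..t}"
      using integrable_cmul[OF int[OF ac_on_absolutely_integrable[OF f]], of "h \<xi>"] by simp
    have "D t - D s = h \<xi> * integral {s..t} f' - integral {s..t} p"
      using xi ac_on_diff[OF f st] ac_on_diff[OF acp st] unfolding D_def by simp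
    also have "\<dots> = integral {s..t} (\<lambda>x. h \<xi> * f' x - p x)"
      using int[OF pa] i1 by (simp add: Henstock_Kurzweil_Integration.integral_diff)
    finally have "D t - D s = integral {s..t} (\<lambda>x. h \<xi> * f' x - p x)" .
    moreover have "norm (integral {s..t} (\<lambda>x. h \<xi> * f' x - p x)) \<le> integral {s..t} (\<lambda>x. \<eta> * \<bar>f' x\<bar>)"
    proof (rule integral_norm_bound_integral)
      show "(\<lambda>x. h \<xi> * f' x - p x) integrable_on {s..t}" "(\<lambda>x. \<eta> * \<bar>f' x\<bar>) integrable_on {s..t}"
        using int[OF pa] i1 integrable_cmul[OF int[OF na], of \<eta>]
        by (auto intro: Henstock_Kurzweil_Integration.integrable_diff)
      show "norm (h \<xi> * f' x - p x) \<le> \<eta> * \<bar>f' x\<bar>" if "x \<in> {s..t}" for x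
        using osc[OF xi(1) that] unfolding p_def
        by (simp flip: left_diff_distrib add: abs_mult mult_right_mono)
    qed
    ultimately show ?thesis using ac_on_diff[OF acn st] by simp
  qed
  \<comment> \<open>The bound \<open>local\<close> telescopes over an equidistant grid, because its
    right-hand side is itself an increment of \<open>N\<close>.\<close>
  have glob: "\<bar>D t - D a\<bar> \<le> \<eta> * N t" if t: "t \<in> {a..b}" and "\<eta> > 0" for t \<eta>
  proof (cases "t = a")
    case True then show ?thesis by (simp add: N_def)
  next
    case False
    then have "a < t" using t by simp
    have "uniformly_continuous_on {a..b} h"
      by (rule compact_uniformly_continuous[OF ch]) simp
    then obtain \<delta> where "\<delta> > 0" and
      \<delta>: "\<And>x y. x \<in> {a..b} \<Longrightarrow> y \<in> {a..b} \<Longrightarrow> \<bar>x - y\<bar> < \<delta> \<Longrightarrow> \<bar>h x - h y\<bar> < \<eta>"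
      unfolding uniformly_continuous_on_def dist_real_def using \<open>\<eta> > 0\<close> by metis
    \<comment> \<open>The number of pieces is chosen so that the mesh stays below the modulus of
      uniform continuity of \<open>h\<close>.\<close>
    obtain n :: nat where n: "(t - a) / \<delta> < real n" using reals_Archimedean2 by blast
    have "0 < (t - a) / \<delta>" using \<open>a < t\<close> \<open>\<delta> > 0\<close> by simp
    with n have npos: "0 < real n" by linarith
    define r where "r = (t - a) / real n"
    have r: "0 < r" "r < \<delta>" "real n * r = t - a"
      using n npos \<open>a < t\<close> \<open>\<delta> > 0\<close> unfolding r_def by (auto simp: field_simps)
    have "\<bar>D (a + real k * r) - D a\<bar> \<le> \<eta> * N (a + real k * r)" if "k \<le> n" for k
      using that
    proof (induction k)
      case 0 then show ?case by (simp add: N_def)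
    next
      case (Suc k)
      have b: "a + real (Suc k) * r \<le> b"
        using mult_right_mono[of "real (Suc k)" "real n" r] Suc.prems r t by auto
      have "\<bar>D (a + real (Suc k) * r) - D (a + real k * r)\<bar> \<le> \<eta> * (N (a + real (Suc k) * r) - N (a + real k * r))"
      proof (rule local)
        show le: "a \<le> a + real k * r" and "a + real k * r \<le> a + real (Suc k) * r"
          using r(1) by (auto simp: algebra_simps)
        have mem: "x \<in> {a..b}" if "x \<in> {a + real k * r..a + real (Suc k) * r}" for x
          using that b le by (meson atLeastAtMost_iff order_trans)
        show "\<bar>h x - h y\<bar> \<le> \<eta>" if "x \<in> {a + real k * r..a + real (Suc k) * r}"
          "y \<in> {a + real k * r..a + real (Suc k) * r}" for x y
          using that r(2) by (intro less_imp_le \<delta> mem) (auto simp: algebra_simps)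
      qed (rule b)
      then show ?case using Suc.IH Suc.prems by (simp add: algebra_simps)
    qed
    from this[of n] show ?thesis using r(3) by simp
  qed
  have Dc: "D t = D a" if "t \<in> {a..b}" for t
  proof (rule ccontr)
    assume ne: "D t \<noteq> D a"
    have N0: "0 \<le> N t" unfolding N_def by (rule Henstock_Kurzweil_Integration.integral_nonneg)
      (use that na in \<open>auto intro: integrable_on_subinterval[of _ "{a..b}"] set_lebesgue_integral_eq_integral(1)\<close>)
    \<comment> \<open>This \<eta> makes \<open>\<eta> * N t\<close> strictly smaller than
      \<open>\<bar>D t - D a\<bar>\<close>; the summand 1 keeps the denominator positive.\<close>
    define \<eta> where "\<eta> = \<bar>D t - D a\<bar> / (2 * (N t + 1))"
    have "\<eta> > 0" using ne N0 unfolding \<eta>_def by auto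
    from glob[OF that this] have "\<bar>D t - D a\<bar> \<le> \<eta> * N t" .
    also have "\<dots> < \<eta> * (2 * (N t + 1))" using N0 \<open>\<eta> > 0\<close> by (intro mult_strict_left_mono) auto
    also have "\<dots> = \<bar>D t - D a\<bar>" unfolding \<eta>_def using N0 by simp
    finally show False by simp
  qed
  show ?thesis
    unfolding ac_on_def
  proof (intro conjI ballI)
    show "(\<lambda>t. F' (f t) * f' t) absolutely_integrable_on {a..b}" using pa unfolding p_def h_def .
    fix t assume "t \<in> {a..b}"
    from Dc[OF this] have "F (f t) = F (f a) + integral {a..t} p" unfolding D_def by simp
    then show "F (f t) = F (f a) + integral {a..t} (\<lambda>t. F' (f t) * f' t)"
      unfolding p_def h_def .
  qed
qed

text \<open>Polarization reduces the product to squares, and squares are covered by the chain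
  rule.\<close>

lemma ac_on_mult:
  fixes f g :: "real \<Rightarrow> real"
  assumes f: "ac_on a b f f'" and g: "ac_on a b g g'"
  shows "ac_on a b (\<lambda>t. f t * g t) (\<lambda>t. f' t * g t + f t * g' t)"
proof -
  have sq: "ac_on a b (\<lambda>t. (h t)\<^sup>2) (\<lambda>t. (2 * h t) * h' t)" if "ac_on a b h h'" for h h' :: "real \<Rightarrow> real"
    by (rule ac_on_chain[OF that, of UNIV "\<lambda>x. x\<^sup>2"]) (auto intro!: derivative_eq_intros continuous_intros)
  have "ac_on a b (\<lambda>t. 1/2 * ((f t + g t)\<^sup>2 - (f t)\<^sup>2 - (g t)\<^sup>2))
     (\<lambda>t. 1/2 * ((2 * (f t + g t)) * (f' t + g' t) - (2 * f t) * f' t - (2 * g t) * g' t))"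
    by (intro ac_on_cmult ac_on_minus sq ac_on_add f g)
  then show ?thesis
    by (rule ac_on_cong) (auto simp: power2_eq_square algebra_simps)
qed

lemma integration_by_parts_ac:
  fixes f g :: "real \<Rightarrow> real"
  assumes f: "ac_on a b f f'" and g: "ac_on a b g g'" and "a \<le> b"
  shows "integral {a..b} (\<lambda>t. f' t * g t) + integral {a..b} (\<lambda>t. f t * g' t) = f b * g b - f a * g a"
proof -
  have "(\<lambda>t. f' t * g t) integrable_on {a..b}" "(\<lambda>t. f t * g' t) integrable_on {a..b}"
    using absolutely_integrable_continuous_mult[OF ac_on_continuous[OF g] ac_on_absolutely_integrable[OF f]]
      absolutely_integrable_continuous_mult[OF ac_on_continuous[OF f] ac_on_absolutely_integrable[OF g]]
      set_lebesgue_integral_eq_integral(1) by (auto simp: mult.commute)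
  then have "integral {a..b} (\<lambda>t. f' t * g t) + integral {a..b} (\<lambda>t. f t * g' t)
    = integral {a..b} (\<lambda>t. f' t * g t + f t * g' t)"
    by (simp add: Henstock_Kurzweil_Integration.integral_add)
  then show ?thesis using ac_on_diff[OF ac_on_mult[OF f g], of a b] assms(3) by simp
qed

lemma tendsto_inverse_one_plus_square:
  fixes c :: real
  assumes "c \<noteq> 0"
  shows "(\<lambda>n. inverse (1 + (real n * c)\<^sup>2)) \<longlonglongrightarrow> 0"
proof (rule tendsto_inverse_0_at_top)
  have "filterlim (\<lambda>n. c\<^sup>2 * (real n)\<^sup>2) at_top sequentially"
    using assms by (intro filterlim_tendsto_pos_mult_at_top[OF tendsto_const] filterlim_pow_at_top filterlim_real_sequentially) auto
  then have "filterlim (\<lambda>n. 1 + c\<^sup>2 * (real n)\<^sup>2) at_top sequentially"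
    by (rule filterlim_tendsto_add_at_top[OF tendsto_const])
  then show "LIM n sequentially. 1 + (real n * c)\<^sup>2 :> at_top"
    by (simp add: power_mult_distrib mult.commute)
qed

text \<open>The functions \<open>arctan (n x) / n\<close> tend to 0, while their derivatives
  \<open>1 / (1 + (n x)^2)\<close> tend to the indicator of \<open>x = 0\<close>. Composing with
  \<open>z\<close> and passing to the limit by dominated convergence, the integral of
  \<open>z'\<close> over the zeros in any subinterval is 0.\<close>

lemma ac_on_deriv_zero_on_zero_set:
  fixes z z' :: "real \<Rightarrow> real"
  assumes z: "ac_on a b z z'"
  shows "AE t in lebesgue_on {a<..<b}. z t = 0 \<longrightarrow> z' t = 0"
proof -
  define g where "g t = (if z t = 0 then z' t else 0)" for t
  define F where "F n x = inverse (real n) * arctan (real n * x)" for n x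
  define p where "p n t = inverse (1 + (real n * z t)\<^sup>2) * z' t" for n t
  \<comment> \<open>The sequence starts at index 1: for index 0 the convention
    \<open>inverse 0 = 0\<close> makes \<open>F\<close> vanish although \<open>p\<close> does
    not.\<close>
  have acF: "ac_on a b (\<lambda>t. F (Suc n) (z t)) (p (Suc n))" for n
    unfolding p_def F_def
    by (rule ac_on_chain[OF z, of UNIV])
       (auto intro!: derivative_eq_intros continuous_intros simp: field_simps add_nonneg_eq_0_iff)
  have bnd: "norm (p (Suc n) t) \<le> \<bar>z' t\<bar>" for n t
  proof -
    have "\<bar>inverse (1 + (real (Suc n) * z t)\<^sup>2)\<bar> \<le> 1"
      by (simp add: inverse_le_1_iff abs_le_iff)
    from mult_right_mono[OF this, of "\<bar>z' t\<bar>"] show ?thesis unfolding p_def by (simp add: abs_mult)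
  qed
  have lim: "(\<lambda>n. p (Suc n) t) \<longlonglongrightarrow> g t" for t
  proof (cases "z t = 0")
    case True
    then show ?thesis by (simp add: p_def g_def)
  next
    case False
    from tendsto_mult[OF tendsto_inverse_one_plus_square[OF this] tendsto_const[of "z' t"]]
    have "(\<lambda>n. p n t) \<longlonglongrightarrow> 0" by (simp add: p_def)
    from LIMSEQ_Suc[OF this] show ?thesis using False by (simp add: g_def)
  qed
  have limF: "(\<lambda>n. F (Suc n) x) \<longlonglongrightarrow> 0" for x
  proof (rule Lim_null_comparison)
    show "\<forall>\<^sub>F n in sequentially. norm (F (Suc n) x) \<le> (pi/2) * inverse (real (Suc n))"
    proof (intro always_eventually allI)
      fix n
      have "\<bar>arctan (real (Suc n) * x)\<bar> \<le> pi/2"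
        using arctan_bounded[of "real (Suc n) * x"] by linarith
      from mult_left_mono[OF this, of "inverse (real (Suc n))"]
      show "norm (F (Suc n) x) \<le> (pi/2) * inverse (real (Suc n))"
        unfolding F_def by (simp add: abs_mult mult.commute)
    qed
    show "(\<lambda>n. (pi/2) * inverse (real (Suc n))) \<longlonglongrightarrow> 0"
      using tendsto_mult[OF tendsto_const LIMSEQ_inverse_real_of_nat, of "pi/2"] by simp
  qed
  have "AE t in lebesgue_on {a<..<b}. g t = 0"
  proof (rule AE_eq_zero_if_primitive_zero)
    have 1: "p (Suc n) integrable_on {a..b}" for n
      by (rule ac_on_integrable[OF acF])
    have 2: "(\<lambda>t. \<bar>z' t\<bar>) integrable_on {a..b}"
      using set_integrable_abs[OF ac_on_absolutely_integrable[OF z]] set_lebesgue_integral_eq_integral(1) by blast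
    show "g absolutely_integrable_on {a..b}"
    proof (rule absolutely_integrable_integrable_bound[OF _ _ 2])
      show "g integrable_on {a..b}"
        by (rule dominated_convergence(1)[OF 1 2 bnd lim])
    qed (auto simp: g_def)
    fix s t assume st: "a \<le> s" "s \<le> t" "t \<le> b"
    have 1: "p (Suc n) integrable_on {s..t}" for n
      by (rule integrable_on_subinterval[OF 1]) (use st in auto)
    have 2: "(\<lambda>t. \<bar>z' t\<bar>) integrable_on {s..t}"
      by (rule integrable_on_subinterval[OF 2]) (use st in auto)
    have "(\<lambda>n. integral {s..t} (p (Suc n))) \<longlonglongrightarrow> integral {s..t} g"
      by (rule dominated_convergence(2)[OF 1 2 bnd lim])
    moreover have "integral {s..t} (p (Suc n)) = F (Suc n) (z t) - F (Suc n) (z s)" for n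
      using ac_on_diff[OF acF st] by simp
    moreover have "(\<lambda>n. F (Suc n) (z t) - F (Suc n) (z s)) \<longlonglongrightarrow> 0 - 0"
      by (intro tendsto_diff limF)
    ultimately show "integral {s..t} g = 0"
      using LIMSEQ_unique by (metis (no_types, lifting) diff_zero ext)
  qed
  then show ?thesis by (auto simp: g_def)
qed

section \<open>The fundamental lemma of the calculus of variations\<close>

text \<open>Moving the starting point to the left of both \<open>c\<close> and \<open>t\<close> does
  not change the primitive, since \<psi> vanishes below \<open>c\<close>, and makes \<open>t\<close>
  an interior point; this gives a two-sided derivative even at and below \<open>c\<close>.\<close>

lemma C1_primitive_of_supported:
  fixes \<psi> :: "real \<Rightarrow> real"
  assumes cont: "continuous_on UNIV \<psi>" and zero: "\<And>t. t < c \<Longrightarrow> \<psi> t = 0"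
  shows "((\<lambda>u. integral {c..u} \<psi>) has_real_derivative \<psi> t) (at t)"
proof -
  define A where "A = min c t - 1"
  have int: "\<psi> integrable_on {x..y}" for x y
    by (intro integrable_continuous_interval continuous_on_subset[OF cont]) auto
  have z: "integral {A..x} \<psi> = 0" if "x \<le> c" for x
  proof -
    have "integral {A..x} \<psi> = integral {A..x} (\<lambda>t. 0)"
      using that zero by (intro integral_spike[of "{c}"]) auto
    then show ?thesis by simp
  qed
  have eq: "integral {A..u} \<psi> = integral {c..u} \<psi>" for u
  proof (cases "c \<le> u")
    case True
    then have "integral {A..c} \<psi> + integral {c..u} \<psi> = integral {A..u} \<psi>"
      by (intro Henstock_Kurzweil_Integration.integral_combine int) (auto simp: A_def)
    then show ?thesis using z by simp
  qed (use z in auto)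
  have "((\<lambda>u. integral {A..u} \<psi>) has_real_derivative \<psi> t) (at t within {A..t+1})"
    by (intro integral_has_real_derivative continuous_on_subset[OF cont]) (auto simp: A_def)
  moreover have "at t within {A..t+1} = at t"
    by (rule at_within_Icc_at) (auto simp: A_def)
  ultimately show ?thesis by (simp add: eq)
qed

text \<open>With \<open>m\<close> the mean of \<open>h\<close> for the hat weight \<open>w\<close>,
  the function \<open>w * (h - m)\<close> has integral 0, so its primitive vanishes outside the
  interval and is an admissible test function. Testing with it gives
  \<open>\<integral> w (h - m)^2 = 0\<close>.\<close>

lemma du_bois_reymond:
  fixes h :: "real \<Rightarrow> real"
  assumes "c < d" and h: "continuous_on {c..d} h"
    and orth: "\<And>\<phi> \<psi>. (\<And>t. (\<phi> has_real_derivative \<psi> t) (at t)) \<Longrightarrow> continuous_on UNIV \<psi> \<Longrightarrow>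
      (\<And>t. t \<notin> {c<..<d} \<Longrightarrow> \<phi> t = 0) \<Longrightarrow> (\<And>t. t \<notin> {c<..<d} \<Longrightarrow> \<psi> t = 0) \<Longrightarrow>
      integral {c..d} (\<lambda>t. h t * \<psi> t) = 0"
  shows "\<exists>m. \<forall>t\<in>{c..d}. h t = m"
proof -
  define w where "w t = max 0 (min (t - c) (d - t))" for t
  have cchi: "continuous_on S w" for S unfolding w_def by (intro continuous_intros)
  have intc: "g integrable_on {c..d}" if "continuous_on {c..d} g" for g :: "real \<Rightarrow> real"
    using that by (rule integrable_continuous_interval)
  define C where "C = integral {c..d} w"
  have "C \<noteq> 0"
  proof
    assume "C = 0"
    then have "\<forall>t\<in>{c..d}. w t = 0"
      unfolding C_def using cchi assms(1)
      by (subst (asm) integral_eq_0_iff) (auto simp: w_def)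
    moreover have "(c + d)/2 \<in> {c..d}" "w ((c+d)/2) > 0" using assms(1) by (auto simp: w_def field_simps max_def min_def)
    ultimately show False by fastforce
  qed
  define m where "m = integral {c..d} (\<lambda>t. w t * h t) / C"
  \<comment> \<open>Clamping the argument extends \<open>h\<close> continuously to the whole line,
    as \<psi> has to be continuous everywhere.\<close>
  define ht where "ht t = h (max c (min d t))" for t
  define \<psi> where "\<psi> t = w t * (ht t - m)" for t
  have ht: "continuous_on UNIV ht" unfolding ht_def
    by (rule continuous_on_compose2[OF h]) (use assms(1) in \<open>auto intro!: continuous_intros\<close>)
  have cpsi: "continuous_on UNIV \<psi>" unfolding \<psi>_def by (intro continuous_intros cchi ht)
  have psi0: "\<psi> t = 0" if "t \<notin> {c<..<d}" for t using that by (auto simp: \<psi>_def w_def)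
  have psi_eq: "\<psi> t = w t * h t - m * w t" if "t \<in> {c..d}" for t
    using that by (cases "t = d") (auto simp: \<psi>_def ht_def algebra_simps min_def max_def)
  have int0: "integral {c..d} \<psi> = 0"
  proof -
    have "integral {c..d} \<psi> = integral {c..d} (\<lambda>t. w t * h t - m * w t)"
      by (rule integral_cong) (rule psi_eq)
    also have "\<dots> = integral {c..d} (\<lambda>t. w t * h t) - m * C"
      unfolding C_def by (subst Henstock_Kurzweil_Integration.integral_diff) (auto intro!: intc continuous_intros cchi h)
    finally show ?thesis using \<open>C \<noteq> 0\<close> by (simp add: m_def)
  qed
  define \<phi> where "\<phi> u = integral {c..u} \<psi>" for u
  have dphi: "(\<phi> has_real_derivative \<psi> t) (at t)" for t
    unfolding \<phi>_def by (rule C1_primitive_of_supported[OF cpsi]) (auto intro: psi0)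
  have phi0: "\<phi> t = 0" if "t \<notin> {c<..<d}" for t
  proof (cases "t \<le> c")
    case True then show ?thesis by (cases "t = c") (auto simp: \<phi>_def)
  next
    case False
    then have "d \<le> t" using that by auto
    have ig: "\<psi> integrable_on {c..t}" by (intro integrable_continuous_interval continuous_on_subset[OF cpsi]) auto
    have "integral {c..d} \<psi> + integral {d..t} \<psi> = integral {c..t} \<psi>"
      using assms(1) \<open>d \<le> t\<close> by (intro Henstock_Kurzweil_Integration.integral_combine ig) auto
    moreover have "integral {d..t} \<psi> = integral {d..t} (\<lambda>t. 0)"
      by (rule integral_cong) (auto intro: psi0)
    ultimately show ?thesis using int0 by (simp add: \<phi>_def)
  qed
  have "integral {c..d} (\<lambda>t. h t * \<psi> t) = 0"
    by (rule orth[OF dphi cpsi phi0 psi0])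
  moreover have "integral {c..d} (\<lambda>t. w t * (h t - m)\<^sup>2) = integral {c..d} (\<lambda>t. h t * \<psi> t - m * \<psi> t)"
    by (rule integral_cong) (auto simp: psi_eq power2_eq_square algebra_simps)
  moreover have "\<dots> = integral {c..d} (\<lambda>t. h t * \<psi> t) - m * integral {c..d} \<psi>"
    by (subst Henstock_Kurzweil_Integration.integral_diff)
       (auto intro!: intc continuous_intros h continuous_on_subset[OF cpsi])
  ultimately have "integral {c..d} (\<lambda>t. w t * (h t - m)\<^sup>2) = 0" using int0 by simp
  then have all0: "\<forall>t\<in>{c..d}. w t * (h t - m)\<^sup>2 = 0"
    using assms(1) by (subst (asm) integral_eq_0_iff) (auto intro!: continuous_intros cchi h simp: w_def)
  have "h t = m" if "t \<in> {c<..<d}" for t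
  proof -
    have "w t \<noteq> 0" using that by (auto simp: w_def)
    then show ?thesis using all0 that by auto
  qed
  moreover have "closure {c<..<d} = {c..d}" using assms(1) by simp
  ultimately have "h t = m" if "t \<in> {c..d}" for t
    using continuous_constant_on_closure[of "{c<..<d}" h m t] h that by auto
  then show ?thesis by blast
qed

section \<open>Weak derivatives in one dimension\<close>

lemma LINT_restrict_support:
  fixes f :: "real \<Rightarrow> 'a::euclidean_space"
  assumes "S \<in> sets lebesgue" "K \<in> sets lebesgue" "K \<subseteq> S" "\<And>t. t \<in> S - K \<Longrightarrow> f t = 0"
  shows "(LINT t|lebesgue_on S. f t) = (LINT t|lebesgue_on K. f t)"
  using assms by (auto simp: integral_restrict_space indicator_def intro!: Bochner_Integration.integral_cong)

lemma LINT_supported_eq_integral: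
  fixes f :: "real \<Rightarrow> 'a::euclidean_space"
  assumes "{c..d} \<subseteq> {0<..<T}" "\<And>t. t \<notin> {c..d} \<Longrightarrow> f t = 0" "f absolutely_integrable_on {c..d}"
  shows "(LINT t|lebesgue_on {0<..<T}. f t) = integral {c..d} f"
proof -
  have "(LINT t|lebesgue_on {0<..<T}. f t) = (LINT t|lebesgue_on {c..d}. f t)"
    by (rule LINT_restrict_support) (use assms in auto)
  also have "\<dots> = integral {c..d} f"
    by (rule lebesgue_integral_eq_integral) (use assms(3) in \<open>auto intro: absolutely_integrable_imp_integrable\<close>)
  finally show ?thesis .
qed

lemma locally_integrable_interval:
  fixes f :: "real \<Rightarrow> 'a::euclidean_space"
  assumes "f absolutely_integrable_on {0..T}"
  shows "locally_integrable {0<..<T} f"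
  unfolding locally_integrable_def
proof safe
  fix K :: "real set" assume K: "compact K" "K \<subseteq> {0<..<T}"
  have "K \<in> sets lebesgue" using K(1) by (simp add: borel_compact)
  moreover have "K \<subseteq> {0..T}" using K(2) by auto
  ultimately have "f absolutely_integrable_on K"
    by (rule set_integrable_subset[OF assms])
  then show "integrable (lebesgue_on K) f"
    using \<open>K \<in> sets lebesgue\<close> by (rule absolutely_integrable_imp_integrable)
qed

lemma test_function_deriv:
  assumes "test_function \<Omega> \<phi>"
  shows "(\<phi> has_real_derivative deriv \<phi> t) (at t)" "continuous_on UNIV (deriv \<phi>)" "t \<notin> \<Omega> \<Longrightarrow> \<phi> t = 0"
proof -
  obtain D where D: "\<And>t. (\<phi> has_vector_derivative D t) (at t)" "continuous_on UNIV D"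
    using assms unfolding test_function_def C1_differentiable_on_def by auto
  have d: "(\<phi> has_real_derivative D t) (at t)" for t
    using D(1) by (simp add: has_real_derivative_iff_has_vector_derivative)
  then have "deriv \<phi> = D" using DERIV_imp_deriv by blast
  then show "(\<phi> has_real_derivative deriv \<phi> t) (at t)" "continuous_on UNIV (deriv \<phi>)"
    using d D(2) by auto
  show "t \<notin> \<Omega> \<Longrightarrow> \<phi> t = 0" using assms unfolding test_function_def by blast
qed

lemma test_functionI:
  assumes "\<And>t. (\<phi> has_real_derivative \<psi> t) (at t)" "continuous_on UNIV \<psi>"
    "{c..d} \<subseteq> \<Omega>" "\<And>t. t \<notin> {c..d} \<Longrightarrow> \<phi> t = 0"
  shows "test_function \<Omega> \<phi>" "deriv \<phi> = \<psi>"
proof -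
  show "deriv \<phi> = \<psi>" using assms(1) DERIV_imp_deriv by blast
  show "test_function \<Omega> \<phi>"
    unfolding test_function_def C1_differentiable_on_def
  proof (intro conjI exI)
    show "\<forall>t\<in>UNIV. (\<phi> has_vector_derivative \<psi> t) (at t)"
      using assms(1) by (simp add: has_real_derivative_iff_has_vector_derivative)
    show "\<forall>t. t \<notin> {c..d} \<longrightarrow> \<phi> t = 0" using assms(4) by blast
  qed (use assms in auto)
qed

lemma absolutely_integrable_inner:
  fixes f :: "real \<Rightarrow> 'a::euclidean_space"
  assumes "f absolutely_integrable_on S"
  shows "(\<lambda>t. f t \<bullet> b) absolutely_integrable_on S"
  using absolutely_integrable_linear[OF assms bounded_linear_inner_left[of b]] by (simp add: o_def)

lemma absolutely_integrable_continuous_scaleR: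
  fixes g :: "real \<Rightarrow> 'a::euclidean_space"
  assumes "continuous_on {a..b} f" "g absolutely_integrable_on {a..b}"
  shows "(\<lambda>t. f t *\<^sub>R g t) absolutely_integrable_on {a..b}"
proof (rule absolutely_integrable_componentwise)
  fix i :: 'a
  show "(\<lambda>t. (f t *\<^sub>R g t) \<bullet> i) absolutely_integrable_on {a..b}"
    using absolutely_integrable_continuous_mult[OF assms(1) absolutely_integrable_inner[OF assms(2)]] by simp
qed

lemma ac_on_inner: "ac_on a b f f' \<Longrightarrow> ac_on a b (\<lambda>t. f t \<bullet> e) (\<lambda>t. f' t \<bullet> e)"
  by (rule ac_on_linear[OF _ bounded_linear_inner_left])

lemma integral_inner:
  fixes f :: "real \<Rightarrow> 'a::euclidean_space"
  assumes "f integrable_on S"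
  shows "integral S (\<lambda>t. f t \<bullet> e) = integral S f \<bullet> e"
  using integral_linear[OF assms bounded_linear_inner_left[of e]] by (simp add: o_def)

lemma ac_on_of_DERIV:
  assumes "\<And>t. (\<phi> has_real_derivative \<psi> t) (at t)" "continuous_on UNIV \<psi>"
  shows "ac_on a b \<phi> \<psi>"
  using assms
  by (intro ac_on_C1) (auto simp: has_real_derivative_iff_has_vector_derivative
      intro: has_vector_derivative_at_within continuous_on_subset)

lemma ac_on_imp_has_weak_deriv:
  fixes f g :: "real \<Rightarrow> 'a::euclidean_space"
  assumes "0 < T" and f: "ac_on 0 T f g"
  shows "has_weak_deriv {0<..<T} f g"
  unfolding has_weak_deriv_def
proof (intro conjI allI impI)
  have fi: "f absolutely_integrable_on {0..T}"
    by (rule absolutely_integrable_continuous_real[OF ac_on_continuous[OF f]])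
  have gi: "g absolutely_integrable_on {0..T}" by (rule ac_on_absolutely_integrable[OF f])
  show "locally_integrable {0<..<T} f" "locally_integrable {0<..<T} g"
    using fi gi locally_integrable_interval by blast+
  fix \<phi> assume t: "test_function {0<..<T} \<phi>"
  note td = test_function_deriv[OF t]
  have p: "ac_on 0 T \<phi> (deriv \<phi>)" by (rule ac_on_of_DERIV[OF td(1,2)])
  have ends: "\<phi> 0 = 0" "\<phi> T = 0" using td(3) by auto
  have i1: "(\<lambda>t. deriv \<phi> t *\<^sub>R f t) absolutely_integrable_on {0..T}"
    by (rule absolutely_integrable_continuous_scaleR[OF continuous_on_subset[OF td(2)] fi]) simp
  have i2: "(\<lambda>t. \<phi> t *\<^sub>R g t) absolutely_integrable_on {0..T}"
    by (rule absolutely_integrable_continuous_scaleR[OF ac_on_continuous[OF p] gi])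
  have "integral {0..T} (\<lambda>t. deriv \<phi> t *\<^sub>R f t) = - integral {0..T} (\<lambda>t. \<phi> t *\<^sub>R g t)"
  proof (rule euclidean_eqI)
    fix e :: 'a
    have "integral {0..T} (\<lambda>t. deriv \<phi> t * (f t \<bullet> e)) + integral {0..T} (\<lambda>t. \<phi> t * (g t \<bullet> e)) = 0"
      using integration_by_parts_ac[OF p ac_on_inner[OF f]] \<open>0 < T\<close> ends by simp
    moreover have "integral {0..T} (\<lambda>t. deriv \<phi> t *\<^sub>R f t) \<bullet> e = integral {0..T} (\<lambda>t. deriv \<phi> t * (f t \<bullet> e))"
      using integral_inner[OF set_lebesgue_integral_eq_integral(1)[OF i1], of e] by simp
    moreover have "integral {0..T} (\<lambda>t. \<phi> t *\<^sub>R g t) \<bullet> e = integral {0..T} (\<lambda>t. \<phi> t * (g t \<bullet> e))"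
      using integral_inner[OF set_lebesgue_integral_eq_integral(1)[OF i2], of e] by simp
    ultimately show "integral {0..T} (\<lambda>t. deriv \<phi> t *\<^sub>R f t) \<bullet> e = (- integral {0..T} (\<lambda>t. \<phi> t *\<^sub>R g t)) \<bullet> e"
      by simp
  qed
  then show "(LINT t|lebesgue_on {0<..<T}. deriv \<phi> t *\<^sub>R f t) = - (LINT t|lebesgue_on {0<..<T}. \<phi> t *\<^sub>R g t)"
    using i1 i2 by (simp add: LINT_interval_eq_integral)
qed

text \<open>Stated with the distributional identity only, so that \<open>f = 0\<close> yields uniqueness of weak derivatives.\<close>

lemma ac_on_of_weak_identity:
  fixes f g :: "real \<Rightarrow> real"
  assumes cd: "c < d" and f: "continuous_on {c..d} f" and g: "g absolutely_integrable_on {c..d}"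
    and weak: "\<And>\<phi> \<psi>. (\<And>t. (\<phi> has_real_derivative \<psi> t) (at t)) \<Longrightarrow> continuous_on UNIV \<psi> \<Longrightarrow>
      (\<And>t. t \<notin> {c<..<d} \<Longrightarrow> \<phi> t = 0) \<Longrightarrow> (\<And>t. t \<notin> {c<..<d} \<Longrightarrow> \<psi> t = 0) \<Longrightarrow>
      integral {c..d} (\<lambda>t. \<psi> t * f t) = - integral {c..d} (\<lambda>t. \<phi> t * g t)"
  shows "ac_on c d f g"
proof -
  define G where "G t = integral {c..t} g" for t
  have G: "ac_on c d G g" unfolding G_def by (rule ac_on_integral[OF g])
  \<comment> \<open>Subtracting the integration by parts formula for \<open>G\<close> from the weak
    identity makes \<open>f - G\<close> orthogonal to the derivatives of all test functions.\<close>
  have "\<exists>m. \<forall>t\<in>{c..d}. f t - G t = m"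
  proof (rule du_bois_reymond[OF cd])
    show "continuous_on {c..d} (\<lambda>t. f t - G t)"
      by (intro continuous_intros f ac_on_continuous[OF G])
    fix \<phi> \<psi> :: "real \<Rightarrow> real"
    assume p: "\<And>t. (\<phi> has_real_derivative \<psi> t) (at t)" "continuous_on UNIV \<psi>"
      "\<And>t. t \<notin> {c<..<d} \<Longrightarrow> \<phi> t = 0" "\<And>t. t \<notin> {c<..<d} \<Longrightarrow> \<psi> t = 0"
    have acp: "ac_on c d \<phi> \<psi>" by (rule ac_on_of_DERIV[OF p(1,2)])
    have cpsi: "continuous_on {c..d} \<psi>" by (rule continuous_on_subset[OF p(2)]) simp
    have "integral {c..d} (\<lambda>t. \<psi> t * G t) + integral {c..d} (\<lambda>t. \<phi> t * g t) = 0"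
      using integration_by_parts_ac[OF acp G] cd p(3) by simp
    moreover have "integral {c..d} (\<lambda>t. \<psi> t * f t) = - integral {c..d} (\<lambda>t. \<phi> t * g t)"
      by (rule weak[OF p])
    moreover have "integral {c..d} (\<lambda>t. (f t - G t) * \<psi> t)
      = integral {c..d} (\<lambda>t. \<psi> t * f t) - integral {c..d} (\<lambda>t. \<psi> t * G t)"
      by (subst Henstock_Kurzweil_Integration.integral_diff[symmetric])
         (auto intro!: integrable_continuous_interval continuous_intros f cpsi ac_on_continuous[OF G] integral_cong simp: algebra_simps)
    ultimately show "integral {c..d} (\<lambda>t. (f t - G t) * \<psi> t) = 0" by simp
  qed
  then obtain m where m: "\<forall>t\<in>{c..d}. f t - G t = m" by blast
  show ?thesis
    by (rule ac_on_cong[OF ac_on_add[OF G ac_on_const[of c d m]]]) (use m in \<open>auto simp: algebra_simps\<close>)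
qed

lemma has_weak_deriv_absolutely_integrable:
  fixes f g :: "real \<Rightarrow> 'a::euclidean_space"
  assumes w: "has_weak_deriv {0<..<T} f g" and cd: "{c..d} \<subseteq> {0<..<T}"
  shows "f absolutely_integrable_on {c..d}" "g absolutely_integrable_on {c..d}"
proof -
  have loc: "h absolutely_integrable_on {c..d}" if "locally_integrable {0<..<T} h" for h :: "real \<Rightarrow> 'a"
  proof -
    have "integrable (lebesgue_on {c..d}) h"
      using that cd compact_Icc unfolding locally_integrable_def by blast
    then show ?thesis by (simp add: set_integrable_def integrable_restrict_space)
  qed
  show "f absolutely_integrable_on {c..d}" "g absolutely_integrable_on {c..d}"
    using w loc unfolding has_weak_deriv_def by auto
qed

text \<open>Because \<open>{c..d}\<close> is a compact subset of the open interval, functions that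
  vanish only outside \<open>{c<..<d}\<close> are still legal test functions. This transfers the
  distributional identity to ordinary integrals over \<open>{c..d}\<close>.\<close>

lemma has_weak_deriv_test:
  fixes f g :: "real \<Rightarrow> 'a::euclidean_space"
  assumes w: "has_weak_deriv {0<..<T} f g" and cd: "{c..d} \<subseteq> {0<..<T}"
    and p: "\<And>t. (\<phi> has_real_derivative \<psi> t) (at t)" "continuous_on UNIV \<psi>"
      "\<And>t. t \<notin> {c<..<d} \<Longrightarrow> \<phi> t = 0" "\<And>t. t \<notin> {c<..<d} \<Longrightarrow> \<psi> t = 0"
  shows "integral {c..d} (\<lambda>t. \<psi> t * (f t \<bullet> e)) = - integral {c..d} (\<lambda>t. \<phi> t * (g t \<bullet> e))"
proof -
  note fi = has_weak_deriv_absolutely_integrable(1)[OF w cd]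
  note gi = has_weak_deriv_absolutely_integrable(2)[OF w cd]
  have t: "test_function {0<..<T} \<phi>" "deriv \<phi> = \<psi>"
  proof -
    have "\<phi> t = 0" if "t \<notin> {c..d}" for t by (rule p(3)) (use that in auto)
    then show "test_function {0<..<T} \<phi>" "deriv \<phi> = \<psi>"
      by (intro test_functionI[OF p(1,2) cd]; blast)+
  qed
  have i1: "(\<lambda>t. \<psi> t *\<^sub>R f t) absolutely_integrable_on {c..d}"
    by (rule absolutely_integrable_continuous_scaleR[OF continuous_on_subset[OF p(2)] fi]) simp
  have i2: "(\<lambda>t. \<phi> t *\<^sub>R g t) absolutely_integrable_on {c..d}"
    by (rule absolutely_integrable_continuous_scaleR[OF DERIV_continuous_on gi])
       (use p(1) has_field_derivative_at_within in blast)
  have "(LINT t|lebesgue_on {0<..<T}. \<psi> t *\<^sub>R f t) = - (LINT t|lebesgue_on {0<..<T}. \<phi> t *\<^sub>R g t)"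
    using w t unfolding has_weak_deriv_def by auto
  moreover have "(LINT t|lebesgue_on {0<..<T}. \<psi> t *\<^sub>R f t) = integral {c..d} (\<lambda>t. \<psi> t *\<^sub>R f t)"
    by (rule LINT_supported_eq_integral[OF cd _ i1]) (use p(4) in auto)
  moreover have "(LINT t|lebesgue_on {0<..<T}. \<phi> t *\<^sub>R g t) = integral {c..d} (\<lambda>t. \<phi> t *\<^sub>R g t)"
    by (rule LINT_supported_eq_integral[OF cd _ i2]) (use p(3) in auto)
  ultimately have *: "integral {c..d} (\<lambda>t. \<psi> t *\<^sub>R f t) = - integral {c..d} (\<lambda>t. \<phi> t *\<^sub>R g t)" by simp
  show "integral {c..d} (\<lambda>t. \<psi> t * (f t \<bullet> e)) = - integral {c..d} (\<lambda>t. \<phi> t * (g t \<bullet> e))"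
    using arg_cong[OF *, of "\<lambda>x. x \<bullet> e"]
    by (simp flip: integral_inner[OF set_lebesgue_integral_eq_integral(1)[OF i1]]
        integral_inner[OF set_lebesgue_integral_eq_integral(1)[OF i2]])
qed

text \<open>Weak derivatives are only locally integrable, so information arrives on inner
  subintervals; countably many of them exhaust the open interval and their null sets are
  united.\<close>

lemma AE_interval_exhaust:
  fixes T :: real
  assumes "\<And>c d. 0 < c \<Longrightarrow> c < d \<Longrightarrow> d < T \<Longrightarrow> AE t in lebesgue_on {c<..<d}. P t"
  shows "AE t in lebesgue_on {0<..<T}. P t"
proof -
  define c where "c n = inverse (real (Suc n))" for n
  have c: "0 < c n" for n by (simp add: c_def)
  have "\<exists>N. negligible N \<and> (\<forall>t\<in>{c n..T - c n} - N. P t)" for n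
  proof (cases "c n < T - c n")
    case True
    with assms[of "c n" "T - c n"] c show ?thesis by (simp flip: AE_interval_iff_negligible)
  next
    case False
    then have "{c n..T - c n} \<subseteq> {c n}" by auto
    then show ?thesis by (intro exI[of _ "{c n}"]) auto
  qed
  then obtain N where N: "\<And>n. negligible (N n)" "\<And>n. \<forall>t\<in>{c n..T - c n} - N n. P t" by metis
  have neg: "negligible (\<Union>n. N n)" by (rule negligible_countable_Union) (use N(1) in auto)
  have "P t" if t: "0 < t" "t < T" "t \<notin> (\<Union>n. N n)" for t
  proof -
    have "0 < min t (T - t)" using t by simp
    then obtain n where "c n < min t (T - t)" unfolding c_def using reals_Archimedean by blast
    then have "t \<in> {c n..T - c n} - N n" using t by auto
    then show ?thesis using N(2) by blast
  qed
  then have "\<forall>t\<in>{0..T} - ((\<Union>n. N n) \<union> {0,T}). P t" by auto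
  moreover have "negligible ((\<Union>n. N n) \<union> {0,T})" using neg by simp
  ultimately show ?thesis unfolding AE_interval_iff_negligible by blast
qed

lemma AE_componentwise:
  fixes f g :: "real \<Rightarrow> 'a::euclidean_space"
  assumes "\<And>e. e \<in> Basis \<Longrightarrow> AE t in M. f t \<bullet> e = g t \<bullet> e"
  shows "AE t in M. f t = g t"
proof -
  have "AE t in M. \<forall>e\<in>Basis. f t \<bullet> e = g t \<bullet> e"
    using assms by (intro AE_finite_allI) auto
  then show ?thesis by eventually_elim (auto intro: euclidean_eqI)
qed

text \<open>On each inner subinterval the difference of the two candidates is a density of the zero
  function.\<close>

lemma has_weak_deriv_unique:
  fixes f g1 g2 :: "real \<Rightarrow> 'a::euclidean_space"
  assumes w1: "has_weak_deriv {0<..<T} f g1" and w2: "has_weak_deriv {0<..<T} f g2"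
  shows "AE t in lebesgue_on {0<..<T}. g1 t = g2 t"
proof (rule AE_componentwise)
  fix e :: 'a
  show "AE t in lebesgue_on {0<..<T}. g1 t \<bullet> e = g2 t \<bullet> e"
  proof (rule AE_interval_exhaust)
    fix c d assume cd: "0 < c" "c < d" "d < T"
    then have sub: "{c..d} \<subseteq> {0<..<T}" by auto
    have gi: "(\<lambda>t. g1 t \<bullet> e) absolutely_integrable_on {c..d}" "(\<lambda>t. g2 t \<bullet> e) absolutely_integrable_on {c..d}"
      using has_weak_deriv_absolutely_integrable(2)[OF w1 sub] has_weak_deriv_absolutely_integrable(2)[OF w2 sub]
        absolutely_integrable_inner by blast+
    have "ac_on c d (\<lambda>t. 0) (\<lambda>t. g1 t \<bullet> e - g2 t \<bullet> e)"
    proof (rule ac_on_of_weak_identity[OF cd(2)])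
      show "(\<lambda>t. g1 t \<bullet> e - g2 t \<bullet> e) absolutely_integrable_on {c..d}"
        using gi by (rule set_integral_diff(1))
      fix \<phi> \<psi> :: "real \<Rightarrow> real"
      assume p: "\<And>t. (\<phi> has_real_derivative \<psi> t) (at t)" "continuous_on UNIV \<psi>"
        "\<And>t. t \<notin> {c<..<d} \<Longrightarrow> \<phi> t = 0" "\<And>t. t \<notin> {c<..<d} \<Longrightarrow> \<psi> t = 0"
      have cphi: "continuous_on {c..d} \<phi>"
        using ac_on_continuous[OF ac_on_of_DERIV[OF p(1,2)]] .
      have "integral {c..d} (\<lambda>t. \<phi> t * (g1 t \<bullet> e)) = integral {c..d} (\<lambda>t. \<phi> t * (g2 t \<bullet> e))"
        using has_weak_deriv_test[OF w1 sub p, of e] has_weak_deriv_test[OF w2 sub p, of e] by simp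
      moreover have "integral {c..d} (\<lambda>t. \<phi> t * (g1 t \<bullet> e - g2 t \<bullet> e))
        = integral {c..d} (\<lambda>t. \<phi> t * (g1 t \<bullet> e)) - integral {c..d} (\<lambda>t. \<phi> t * (g2 t \<bullet> e))"
        unfolding right_diff_distrib
        using absolutely_integrable_continuous_mult[OF cphi gi(1)] absolutely_integrable_continuous_mult[OF cphi gi(2)]
          set_lebesgue_integral_eq_integral(1)
        by (intro Henstock_Kurzweil_Integration.integral_diff) auto
      ultimately show "integral {c..d} (\<lambda>t. \<psi> t * 0) = - integral {c..d} (\<lambda>t. \<phi> t * (g1 t \<bullet> e - g2 t \<bullet> e))"
        by simp
    qed simp
    from ac_on_deriv_zero[OF this, of 0] show "AE t in lebesgue_on {c<..<d}. g1 t \<bullet> e = g2 t \<bullet> e"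
      by simp
  qed
qed

text \<open>The weak identity makes \<open>f - G\<close> constant on the open interval.
  Integrability of \<open>g\<close> up to the endpoints makes \<open>G\<close> continuous on
  \<open>{0..T}\<close>, and continuity of both functions carries the constant to 0 and
  \<open>T\<close>.\<close>

lemma has_weak_deriv_imp_ac_on:
  fixes f g :: "real \<Rightarrow> 'a::euclidean_space"
  assumes "0 < T" and w: "has_weak_deriv {0<..<T} f g"
    and f: "continuous_on {0..T} f" and g: "g absolutely_integrable_on {0..T}"
  shows "ac_on 0 T f g"
proof -
  define G where "G t = integral {0..t} g" for t
  have G: "ac_on 0 T G g" unfolding G_def by (rule ac_on_integral[OF g])
  have "f s - G s = f t - G t" if st: "0 < s" "s < t" "t < T" for s t
  proof (rule euclidean_eqI)
    fix e :: 'a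
    have sub: "{s..t} \<subseteq> {0<..<T}" using st by auto
    have "ac_on s t (\<lambda>t. f t \<bullet> e) (\<lambda>t. g t \<bullet> e)"
    proof (rule ac_on_of_weak_identity[OF st(2)])
      show "continuous_on {s..t} (\<lambda>t. f t \<bullet> e)"
        by (intro continuous_intros continuous_on_subset[OF f]) (use st in auto)
      show "(\<lambda>t. g t \<bullet> e) absolutely_integrable_on {s..t}"
        by (rule absolutely_integrable_inner[OF has_weak_deriv_absolutely_integrable(2)[OF w sub]])
    qed (rule has_weak_deriv_test[OF w sub])
    from ac_on_diff[OF this, of s t] ac_on_diff[OF ac_on_inner[OF G], of s t e] st
    show "(f s - G s) \<bullet> e = (f t - G t) \<bullet> e" by (simp add: inner_diff_left)
  qed
  then have inner: "f t - G t = f (T/2) - G (T/2)" if "t \<in> {0<..<T}" for t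
    using that \<open>0 < T\<close> by (cases t "T/2" rule: linorder_cases) auto
  have cl: "closure {0<..<T} = {0..T}" using \<open>0 < T\<close> by simp
  have cont: "continuous_on {0..T} (\<lambda>t. f t - G t)"
    by (intro continuous_intros f ac_on_continuous[OF G])
  have c: "f t - G t = f (T/2) - G (T/2)" if "t \<in> {0..T}" for t
    by (rule continuous_constant_on_closure[of "{0<..<T}" "\<lambda>t. f t - G t"], unfold cl)
      (fact cont, fact inner, fact that)
  show ?thesis
  proof (rule ac_on_cong[OF ac_on_add[OF G ac_on_const[of 0 T "f (T/2) - G (T/2)"]]])
    show "f t = G t + (f (T/2) - G (T/2))" if "t \<in> {0..T}" for t
      using c[OF that] by (simp add: algebra_simps)
  qed simp
qed

lemma weak_deriv_AE:
  fixes f g :: "real \<Rightarrow> 'a::euclidean_space"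
  assumes "has_weak_deriv {0<..<T} f g"
  shows "AE t in lebesgue_on {0<..<T}. weak_deriv {0<..<T} f t = g t"
proof (rule has_weak_deriv_unique[OF _ assms])
  show "has_weak_deriv {0<..<T} f (weak_deriv {0<..<T} f)"
    unfolding weak_deriv_def by (rule someI[of _ g]) (rule assms)
qed

lemma continuous_on_Icc_norm_bound:
  fixes f :: "real \<Rightarrow> 'a::euclidean_space"
  assumes "continuous_on {a..b} f"
  obtains C where "\<And>t. t \<in> {a..b} \<Longrightarrow> norm (f t) \<le> C"
proof -
  have "bounded (f ` {a..b})"
    by (rule compact_imp_bounded[OF compact_continuous_image[OF assms]]) simp
  then obtain C where "\<forall>y\<in>f ` {a..b}. norm y \<le> C" unfolding bounded_iff by blast
  then show thesis by (intro that[of C]) blast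
qed

section \<open>Integrable and square integrable functions on an interval\<close>

lemma Lp_interval_iff:
  "f \<in> Lp {0<..<T} p \<longleftrightarrow> f \<in> borel_measurable (lebesgue_on {0<..<T}) \<and>
     (\<lambda>t. norm (f t) powr p) absolutely_integrable_on {0..T}"
  unfolding Lp_def by (simp add: integrable_lebesgue_on_interval_iff)

lemma absolutely_integrable_interval_measurable:
  fixes f :: "real \<Rightarrow> 'a::euclidean_space"
  shows "f absolutely_integrable_on {a..b} \<Longrightarrow> f \<in> borel_measurable (lebesgue_on {a<..<b})"
  by (rule borel_measurable_integrable) (simp add: integrable_lebesgue_on_interval_iff)

lemma absolutely_integrable_boundI:
  fixes f :: "real \<Rightarrow> 'a::euclidean_space"
  assumes "f \<in> borel_measurable (lebesgue_on {a<..<b})" "h absolutely_integrable_on {a..b}"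
    "AE t in lebesgue_on {a<..<b}. norm (f t) \<le> h t"
  shows "f absolutely_integrable_on {a..b}"
  unfolding integrable_lebesgue_on_interval_iff[symmetric]
proof (rule Bochner_Integration.integrable_bound)
  show "integrable (lebesgue_on {a<..<b}) h" using assms(2) by (simp add: integrable_lebesgue_on_interval_iff)
  show "AE t in lebesgue_on {a<..<b}. norm (f t) \<le> norm (h t)"
    using assms(3) by eventually_elim auto
qed (rule assms(1))

lemma Lp1_interval_iff:
  fixes f :: "real \<Rightarrow> 'a::euclidean_space"
  shows "f \<in> Lp {0<..<T} 1 \<longleftrightarrow> f absolutely_integrable_on {0..T}"
proof
  assume "f \<in> Lp {0<..<T} 1"
  then show "f absolutely_integrable_on {0..T}"
    unfolding Lp_interval_iff by (auto intro: absolutely_integrable_boundI)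
next
  assume "f absolutely_integrable_on {0..T}"
  then show "f \<in> Lp {0<..<T} 1"
    unfolding Lp_interval_iff
    using absolutely_integrable_norm[unfolded o_def] absolutely_integrable_interval_measurable by auto
qed

lemma Lp_imp_absolutely_integrable:
  fixes f :: "real \<Rightarrow> 'a::euclidean_space"
  assumes "f \<in> Lp {0<..<T} p" "1 \<le> p"
  shows "f absolutely_integrable_on {0..T}"
proof (rule absolutely_integrable_boundI)
  show "f \<in> borel_measurable (lebesgue_on {0<..<T})" using assms(1) by (simp add: Lp_def)
  show "(\<lambda>t. 1 + norm (f t) powr p) absolutely_integrable_on {0..T}"
    using assms(1) by (intro set_integral_add(1)) (auto simp: Lp_interval_iff intro: absolutely_integrable_continuous_real)
  show "AE t in lebesgue_on {0<..<T}. norm (f t) \<le> 1 + norm (f t) powr p"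
  proof (rule AE_I2)
    fix t
    show "norm (f t) \<le> 1 + norm (f t) powr p"
    proof (cases "norm (f t) \<le> 1")
      case False
      then have "norm (f t) powr 1 \<le> norm (f t) powr p" using assms(2) by (intro powr_mono) auto
      then show ?thesis using False by simp
    qed (simp add: add_increasing2)
  qed
qed

lemma Lp_cong_AE:
  fixes f g :: "real \<Rightarrow> 'a::euclidean_space"
  assumes f: "f \<in> Lp {0<..<T} p" and "1 \<le> p" and ae: "AE t in lebesgue_on {0<..<T}. f t = g t"
  shows "g \<in> Lp {0<..<T} p"
  unfolding Lp_interval_iff
proof
  show "g \<in> borel_measurable (lebesgue_on {0<..<T})"
    using absolutely_integrable_cong_AE_interval[OF Lp_imp_absolutely_integrable[OF f \<open>1 \<le> p\<close>] ae]
    by (rule absolutely_integrable_interval_measurable)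
  show "(\<lambda>t. norm (g t) powr p) absolutely_integrable_on {0..T}"
  proof (rule absolutely_integrable_cong_AE_interval)
    show "(\<lambda>t. norm (f t) powr p) absolutely_integrable_on {0..T}" using f by (simp add: Lp_interval_iff)
    show "AE t in lebesgue_on {0<..<T}. norm (f t) powr p = norm (g t) powr p"
      using ae by eventually_elim simp
  qed
qed

lemma Lp2_interval_iff:
  fixes f :: "real \<Rightarrow> 'a::euclidean_space"
  shows "f \<in> Lp {0<..<T} 2 \<longleftrightarrow> f \<in> borel_measurable (lebesgue_on {0<..<T}) \<and>
     (\<lambda>t. (norm (f t))\<^sup>2) absolutely_integrable_on {0..T}"
proof -
  have "norm (f t) powr 2 = (norm (f t))\<^sup>2" for t
    by (cases "f t = 0") (auto simp: powr_numeral)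
  then show ?thesis by (simp add: Lp_interval_iff)
qed

lemma Lp2_boundI:
  fixes f :: "real \<Rightarrow> 'a::euclidean_space" and h :: "real \<Rightarrow> 'b::euclidean_space"
  assumes "f \<in> borel_measurable (lebesgue_on {0<..<T})" "h \<in> Lp {0<..<T} 2"
    "\<And>t. 0 < t \<Longrightarrow> t < T \<Longrightarrow> norm (f t) \<le> C * norm (h t)"
  shows "f \<in> Lp {0<..<T} 2"
  unfolding Lp2_interval_iff
proof (rule conjI[OF assms(1)], rule absolutely_integrable_boundI)
  show "(\<lambda>t. C\<^sup>2 * (norm (h t))\<^sup>2) absolutely_integrable_on {0..T}"
    using assms(2) by (intro set_integrable_mult_right) (auto simp: Lp2_interval_iff)
  show "AE t in lebesgue_on {0<..<T}. norm ((norm (f t))\<^sup>2) \<le> C\<^sup>2 * (norm (h t))\<^sup>2"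
    by (rule AE_intervalI) (use power_mono[OF assms(3), of _ 2] in \<open>auto simp: power_mult_distrib\<close>)
  show "(\<lambda>t. (norm (f t))\<^sup>2) \<in> borel_measurable (lebesgue_on {0<..<T})"
    using assms(1) by measurable
qed

lemma Lp2_const: "(\<lambda>t. c) \<in> Lp {0<..<T} 2"
  unfolding Lp2_interval_iff by (auto intro: absolutely_integrable_continuous_real)

lemma Lp2_bounded:
  fixes f :: "real \<Rightarrow> 'a::euclidean_space"
  assumes "f \<in> borel_measurable (lebesgue_on {0<..<T})" "\<And>t. 0 < t \<Longrightarrow> t < T \<Longrightarrow> norm (f t) \<le> C"
  shows "f \<in> Lp {0<..<T} 2"
  by (rule Lp2_boundI[OF assms(1) Lp2_const[of "1::real"], of C]) (use assms(2) in auto)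

lemma Lp2_continuous:
  fixes f :: "real \<Rightarrow> 'a::euclidean_space"
  assumes "continuous_on {0..T} f"
  shows "f \<in> Lp {0<..<T} 2"
proof -
  obtain C where "\<And>t. t \<in> {0..T} \<Longrightarrow> norm (f t) \<le> C"
    using continuous_on_Icc_norm_bound[OF assms] by blast
  then show ?thesis
    by (intro Lp2_bounded[of f T C] absolutely_integrable_interval_measurable absolutely_integrable_continuous_real assms) auto
qed

lemma Lp2_inner_absolutely_integrable:
  fixes f g :: "real \<Rightarrow> 'a::euclidean_space"
  assumes "f \<in> Lp {0<..<T} 2" "g \<in> Lp {0<..<T} 2"
  shows "(\<lambda>t. f t \<bullet> g t) absolutely_integrable_on {0..T}"
proof (rule absolutely_integrable_boundI)
  show "(\<lambda>t. f t \<bullet> g t) \<in> borel_measurable (lebesgue_on {0<..<T})"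
    using assms by (auto simp: Lp2_interval_iff)
  show "(\<lambda>t. (norm (f t))\<^sup>2 + (norm (g t))\<^sup>2) absolutely_integrable_on {0..T}"
    using assms by (intro set_integral_add(1)) (auto simp: Lp2_interval_iff)
  show "AE t in lebesgue_on {0<..<T}. norm (f t \<bullet> g t) \<le> (norm (f t))\<^sup>2 + (norm (g t))\<^sup>2"
  proof (rule AE_I2)
    fix t
    have "\<bar>f t \<bullet> g t\<bar> \<le> norm (f t) * norm (g t)" by (rule Cauchy_Schwarz_ineq2)
    also have "\<dots> \<le> (norm (f t))\<^sup>2 + (norm (g t))\<^sup>2"
      using sum_squares_bound[of "norm (f t)" "norm (g t)"]
        mult_nonneg_nonneg[OF norm_ge_zero[of "f t"] norm_ge_zero[of "g t"]] by linarith
    finally show "norm (f t \<bullet> g t) \<le> (norm (f t))\<^sup>2 + (norm (g t))\<^sup>2" by simp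
  qed
qed

lemma Lp2_mult_absolutely_integrable:
  fixes f g :: "real \<Rightarrow> real"
  assumes "f \<in> Lp {0<..<T} 2" "g \<in> Lp {0<..<T} 2"
  shows "(\<lambda>t. f t * g t) absolutely_integrable_on {0..T}"
  using Lp2_inner_absolutely_integrable[OF assms] by simp

lemma Lp2_add:
  fixes f g :: "real \<Rightarrow> 'a::euclidean_space"
  assumes f: "f \<in> Lp {0<..<T} 2" and g: "g \<in> Lp {0<..<T} 2"
  shows "(\<lambda>t. f t + g t) \<in> Lp {0<..<T} 2"
  unfolding Lp2_interval_iff
proof
  show "(\<lambda>t. f t + g t) \<in> borel_measurable (lebesgue_on {0<..<T})"
    using f g by (auto simp: Lp2_interval_iff)
  have "(\<lambda>t. f t \<bullet> f t + (f t \<bullet> g t + (f t \<bullet> g t + g t \<bullet> g t))) absolutely_integrable_on {0..T}"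
    by (intro set_integral_add(1) Lp2_inner_absolutely_integrable f g)
  then show "(\<lambda>t. (norm (f t + g t))\<^sup>2) absolutely_integrable_on {0..T}"
    by (simp add: power2_norm_eq_inner inner_add inner_commute add.assoc add.left_commute)
qed

lemma Lp2_bounded_mult:
  fixes m f :: "real \<Rightarrow> real"
  assumes m: "m \<in> borel_measurable (lebesgue_on {0<..<T})" "\<And>t. 0 < t \<Longrightarrow> t < T \<Longrightarrow> \<bar>m t\<bar> \<le> C"
    and f: "f \<in> Lp {0<..<T} 2"
  shows "(\<lambda>t. m t * f t) \<in> Lp {0<..<T} 2"
proof (rule Lp2_boundI[OF _ f])
  show "(\<lambda>t. m t * f t) \<in> borel_measurable (lebesgue_on {0<..<T})"
    using m f by (auto simp: Lp2_interval_iff)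
  show "norm (m t * f t) \<le> C * norm (f t)" if "0 < t" "t < T" for t
    using m(2)[OF that] by (simp add: abs_mult mult_right_mono)
qed

lemma Lp2_continuous_mult:
  fixes m f :: "real \<Rightarrow> real"
  assumes m: "continuous_on {0..T} m" and f: "f \<in> Lp {0<..<T} 2"
  shows "(\<lambda>t. m t * f t) \<in> Lp {0<..<T} 2"
proof -
  obtain C where "\<And>t. t \<in> {0..T} \<Longrightarrow> \<bar>m t\<bar> \<le> C"
    using continuous_on_Icc_norm_bound[OF m] by (metis real_norm_def)
  then show ?thesis
    by (intro Lp2_bounded_mult[of m T C] f absolutely_integrable_interval_measurable absolutely_integrable_continuous_real m) auto
qed

lemma Lp2_linear:
  fixes f :: "real \<Rightarrow> 'a::euclidean_space" and L :: "'a \<Rightarrow> 'b::euclidean_space"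
  assumes f: "f \<in> Lp {0<..<T} 2" and L: "bounded_linear L"
  shows "(\<lambda>t. L (f t)) \<in> Lp {0<..<T} 2"
proof -
  obtain C where C: "\<And>x. norm (L x) \<le> C * norm x"
    using bounded_linear.bounded[OF L] by (metis mult.commute)
  show ?thesis
  proof (rule Lp2_boundI[OF _ f C])
    have "continuous_on UNIV L" by (rule linear_continuous_on[OF L])
    then have "L \<in> borel_measurable borel" by (rule borel_measurable_continuous_onI)
    then show "(\<lambda>t. L (f t)) \<in> borel_measurable (lebesgue_on {0<..<T})"
      using f by (auto simp: Lp2_interval_iff intro: measurable_compose)
  qed
qed

text \<open>Together with \<open>W1p0_I\<close> this replaces Sobolev functions by
  \<open>ac_on\<close> pairs. The choice hidden in \<open>weak_deriv\<close> does no harm, because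
  densities matter only up to null sets.\<close>

lemma W1p0_D:
  fixes f :: "real \<Rightarrow> 'a::euclidean_space"
  assumes "0 < T" "1 \<le> p" "f \<in> W1p0 T p"
  shows "ac_on 0 T f (weak_deriv {0<..<T} f)" "weak_deriv {0<..<T} f \<in> Lp {0<..<T} p" "f 0 = 0"
proof -
  obtain g where g: "g \<in> Lp {0<..<T} p" "has_weak_deriv {0<..<T} f g"
    and f: "continuous_on {0..T} f" "f 0 = 0"
    using assms(3) unfolding W1p0_def W1p_def by auto
  have a: "ac_on 0 T f g"
    by (rule has_weak_deriv_imp_ac_on[OF assms(1) g(2) f(1) Lp_imp_absolutely_integrable[OF g(1) assms(2)]])
  have ae: "AE t in lebesgue_on {0<..<T}. g t = weak_deriv {0<..<T} f t"
    using weak_deriv_AE[OF g(2)] by eventually_elim simp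
  show "ac_on 0 T f (weak_deriv {0<..<T} f)" by (rule ac_on_cong[OF a refl ae])
  show "weak_deriv {0<..<T} f \<in> Lp {0<..<T} p" by (rule Lp_cong_AE[OF g(1) assms(2) ae])
  show "f 0 = 0" by (rule f(2))
qed

lemma W1p0_I:
  fixes f g :: "real \<Rightarrow> 'a::euclidean_space"
  assumes "0 < T" "p \<ge> 1" "ac_on 0 T f g" "g \<in> Lp {0<..<T} p" "f 0 = 0"
  shows "f \<in> W1p0 T p"
proof -
  have c: "continuous_on {0..T} f" by (rule ac_on_continuous[OF assms(3)])
  have "f \<in> Lp {0<..<T} p"
    unfolding Lp_interval_iff
  proof
    show "f \<in> borel_measurable (lebesgue_on {0<..<T})"
      by (rule absolutely_integrable_interval_measurable[OF absolutely_integrable_continuous_real[OF c]])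
    have "continuous_on {0..T} (\<lambda>t. norm (f t) powr p)"
      by (rule continuous_on_powr'[OF continuous_on_norm[OF c] continuous_on_const]) (use assms(2) in auto)
    then show "(\<lambda>t. norm (f t) powr p) absolutely_integrable_on {0..T}"
      by (rule absolutely_integrable_continuous_real)
  qed
  then show ?thesis
    unfolding W1p0_def W1p_def using ac_on_imp_has_weak_deriv[OF assms(1,3)] assms c by auto
qed

lemma weak_deriv_ac_on:
  fixes f g :: "real \<Rightarrow> 'a::euclidean_space"
  assumes "0 < T" "ac_on 0 T f g"
  shows "AE t in lebesgue_on {0<..<T}. weak_deriv {0<..<T} f t = g t"
  by (rule weak_deriv_AE[OF ac_on_imp_has_weak_deriv[OF assms]])

section \<open>Multipliers and adjoint states\<close>

text \<open>The sign of \<open>h\<close> is an admissible \<open>m\<close> and turns the hypothesis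
  into a vanishing integral of \<open>\<bar>h\<bar>\<close>.\<close>

lemma AE_eq_zero_if_orthogonal_to_bounded:
  fixes h :: "real \<Rightarrow> real"
  assumes h: "h absolutely_integrable_on {a..b}"
    and orth: "\<And>m. m \<in> borel_measurable (lebesgue_on {a<..<b}) \<Longrightarrow> (\<And>t. \<bar>m t\<bar> \<le> 1) \<Longrightarrow>
      integral {a..b} (\<lambda>t. h t * m t) = 0"
  shows "AE t in lebesgue_on {a<..<b}. h t = 0"
proof (rule AE_eq_zero_if_integral_norm_zero[OF h])
  have m: "h \<in> borel_measurable (lebesgue_on {a<..<b})"
    by (rule absolutely_integrable_interval_measurable[OF h])
  have "integral {a..b} (\<lambda>t. h t * sgn (h t)) = 0"
  proof (rule orth)
    show "(\<lambda>t. sgn (h t)) \<in> borel_measurable (lebesgue_on {a<..<b})"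
      using m by measurable
  qed (simp add: sgn_if)
  then show "integral {a..b} (\<lambda>t. norm (h t)) = 0" by (simp add: abs_sgn)
qed

section \<open>Duality between integration from 0 and integration up to \<open>T\<close>\<close>

text \<open>On \<open>{0..T}\<close> this is the integral of \<open>b\<close> from \<open>t\<close>
  to \<open>T\<close>, that is, the adjoint of integration from 0: it moves \<open>b\<close> from
  \<open>v\<close> onto \<open>v'\<close> without boundary terms when \<open>v\<close> vanishes at
  0.\<close>

definition tail_integral :: "real \<Rightarrow> (real \<Rightarrow> real) \<Rightarrow> real \<Rightarrow> real" where
  "tail_integral T b t = integral {0..T} b - integral {0..t} b"

lemma tail_integral_ac_on:
  assumes "b absolutely_integrable_on {0..T}"
  shows "ac_on 0 T (tail_integral T b) (\<lambda>t. - b t)"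
  using ac_on_minus[OF ac_on_const[of 0 T "integral {0..T} b"] ac_on_integral[OF assms]]
  unfolding tail_integral_def by simp

lemma tail_integral_end [simp]: "tail_integral T b T = 0"
  by (simp add: tail_integral_def)

lemma tail_integral_continuous:
  "b absolutely_integrable_on {0..T} \<Longrightarrow> continuous_on {0..T} (tail_integral T b)"
  by (rule ac_on_continuous[OF tail_integral_ac_on])

lemma integral_mult_tail_integral:
  fixes v v' b :: "real \<Rightarrow> real"
  assumes "0 < T" and b: "b absolutely_integrable_on {0..T}" and v: "ac_on 0 T v v'" "v 0 = 0"
  shows "integral {0..T} (\<lambda>t. b t * v t) = integral {0..T} (\<lambda>t. tail_integral T b t * v' t)"
  using integration_by_parts_ac[OF tail_integral_ac_on[OF b] v(1)] assms(1) v(2) by simp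

lemma integral_add_absolutely_integrable:
  fixes f g :: "real \<Rightarrow> real"
  assumes "f absolutely_integrable_on S" "g absolutely_integrable_on S"
  shows "integral S (\<lambda>t. f t + g t) = integral S f + integral S g"
  using assms set_lebesgue_integral_eq_integral(1) by (intro Henstock_Kurzweil_Integration.integral_add) auto

lemma integral_diff_absolutely_integrable:
  fixes f g :: "real \<Rightarrow> real"
  assumes "f absolutely_integrable_on S" "g absolutely_integrable_on S"
  shows "integral S (\<lambda>t. f t - g t) = integral S f - integral S g"
  using assms set_lebesgue_integral_eq_integral(1) by (intro Henstock_Kurzweil_Integration.integral_diff) auto

text \<open>The explicit solution of the adjoint equation: the density against \<open>v'\<close> of
  a functional that collects \<open>J v\<close>, \<open>k * v T\<close> and the products of
  \<open>g\<close> with \<open>\<alpha> v'\<close>, \<open>k1 v\<close> and \<open>k2 V\<close>.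
  Everything except \<open>- \<alpha> * g t\<close> will be continuous in \<open>t\<close>.\<close>

definition adjoint_state ::
  "real \<Rightarrow> real \<Rightarrow> (real \<Rightarrow> real) \<Rightarrow> real \<Rightarrow> (real \<Rightarrow> real) \<Rightarrow> (real \<Rightarrow> real) \<Rightarrow> (real \<Rightarrow> real) \<Rightarrow> real \<Rightarrow> real" where
  "adjoint_state T \<alpha> J k g k1 k2 t = k + tail_integral T J t - \<alpha> * g t
     - tail_integral T (\<lambda>t. k1 t * g t + tail_integral T (\<lambda>t. k2 t * g t) t) t"

text \<open>Each term of lower order is moved onto \<open>v'\<close> by a tail integral, the term
  with \<open>k2\<close> by two of them because \<open>V\<close> is a primitive of \<open>v\<close>.
  Integrability of \<open>g * v'\<close> is an assumption since it has two sources: square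
  integrability during the variations, and boundedness of \<open>g\<close> for directions in
  \<open>W1p0 T 1\<close>.\<close>

lemma adjoint_equation:
  fixes v v' J g k1 k2 :: "real \<Rightarrow> real"
  assumes "0 < T" and v: "ac_on 0 T v v'" "v 0 = 0"
    and J: "J absolutely_integrable_on {0..T}" and g: "g absolutely_integrable_on {0..T}"
    and gv: "(\<lambda>t. g t * v' t) absolutely_integrable_on {0..T}"
    and k1: "continuous_on {0..T} k1" and k2: "continuous_on {0..T} k2"
    and V: "ac_on 0 T V v" "V 0 = 0"
  shows "(\<lambda>t. adjoint_state T \<alpha> J k g k1 k2 t * v' t) absolutely_integrable_on {0..T}" (is ?A)
    "integral {0..T} (\<lambda>t. J t * v t) + k * v T
      - integral {0..T} (\<lambda>t. g t * (\<alpha> * v' t + k2 t * V t + k1 t * v t))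
     = integral {0..T} (\<lambda>t. adjoint_state T \<alpha> J k g k1 k2 t * v' t)" (is ?B)
proof -
  define b where "b t = k1 t * g t + tail_integral T (\<lambda>t. k2 t * g t) t" for t
  have k1g: "(\<lambda>t. k1 t * g t) absolutely_integrable_on {0..T}" by (rule absolutely_integrable_continuous_mult[OF k1 g])
  have k2g: "(\<lambda>t. k2 t * g t) absolutely_integrable_on {0..T}" by (rule absolutely_integrable_continuous_mult[OF k2 g])
  have tk: "tail_integral T (\<lambda>t. k2 t * g t) absolutely_integrable_on {0..T}"
    by (rule absolutely_integrable_continuous_real[OF tail_integral_continuous[OF k2g]])
  have bi: "b absolutely_integrable_on {0..T}"
    unfolding b_def by (rule set_integral_add(1)[OF k1g tk])
  note cv = ac_on_continuous[OF v(1)] and cV = ac_on_continuous[OF V(1)]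
  have v'i: "v' absolutely_integrable_on {0..T}" by (rule ac_on_absolutely_integrable[OF v(1)])
  have m: "(\<lambda>t. f t * h t) absolutely_integrable_on {0..T}"
    if "continuous_on {0..T} f" "h absolutely_integrable_on {0..T}" for f h :: "real \<Rightarrow> real"
    using that by (rule absolutely_integrable_continuous_mult)
  have m': "(\<lambda>t. h t * f t) absolutely_integrable_on {0..T}"
    if "continuous_on {0..T} f" "h absolutely_integrable_on {0..T}" for f h :: "real \<Rightarrow> real"
    using m[OF that] by (simp add: mult.commute)
  have i1: "(\<lambda>t. k * v' t) absolutely_integrable_on {0..T}"
    by (rule m[OF continuous_on_const v'i])
  have i2: "(\<lambda>t. tail_integral T J t * v' t) absolutely_integrable_on {0..T}"
    by (rule m[OF tail_integral_continuous[OF J] v'i])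
  have i3: "(\<lambda>t. \<alpha> * (g t * v' t)) absolutely_integrable_on {0..T}"
    by (rule m[OF continuous_on_const gv])
  have i4: "(\<lambda>t. tail_integral T b t * v' t) absolutely_integrable_on {0..T}"
    by (rule m[OF tail_integral_continuous[OF bi] v'i])
  have eq: "adjoint_state T \<alpha> J k g k1 k2 t * v' t
    = ((k * v' t + tail_integral T J t * v' t) - \<alpha> * (g t * v' t)) - tail_integral T b t * v' t" for t
    unfolding adjoint_state_def b_def by (simp add: algebra_simps)
  show ?A unfolding eq by (intro set_integral_diff(1) set_integral_add(1) i1 i2 i3 i4)
  have "integral {0..T} (\<lambda>t. adjoint_state T \<alpha> J k g k1 k2 t * v' t)
    = integral {0..T} (\<lambda>t. k * v' t) + integral {0..T} (\<lambda>t. tail_integral T J t * v' t)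
      - integral {0..T} (\<lambda>t. \<alpha> * (g t * v' t)) - integral {0..T} (\<lambda>t. tail_integral T b t * v' t)"
    unfolding eq
    by (subst integral_diff_absolutely_integrable integral_add_absolutely_integrable, (intro set_integral_diff(1) set_integral_add(1) i1 i2 i3 i4)+)+ simp
  also have "integral {0..T} (\<lambda>t. k * v' t) = k * v T"
    using ac_on_diff[OF v(1), of 0 T] v(2) \<open>0 < T\<close> by simp
  also have "integral {0..T} (\<lambda>t. tail_integral T J t * v' t) = integral {0..T} (\<lambda>t. J t * v t)"
    by (rule integral_mult_tail_integral[OF \<open>0 < T\<close> J v, symmetric])
  also have "integral {0..T} (\<lambda>t. tail_integral T b t * v' t) = integral {0..T} (\<lambda>t. b t * v t)"
    by (rule integral_mult_tail_integral[OF \<open>0 < T\<close> bi v, symmetric])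
  also have "\<dots> = integral {0..T} (\<lambda>t. k1 t * g t * v t) + integral {0..T} (\<lambda>t. tail_integral T (\<lambda>t. k2 t * g t) t * v t)"
    unfolding b_def distrib_right by (rule integral_add_absolutely_integrable[OF m'[OF cv k1g] m'[OF cv tk]])
  also have "integral {0..T} (\<lambda>t. tail_integral T (\<lambda>t. k2 t * g t) t * v t) = integral {0..T} (\<lambda>t. k2 t * g t * V t)"
    by (rule integral_mult_tail_integral[OF \<open>0 < T\<close> k2g V, symmetric])
  finally have 1: "integral {0..T} (\<lambda>t. adjoint_state T \<alpha> J k g k1 k2 t * v' t)
    = k * v T + integral {0..T} (\<lambda>t. J t * v t) - integral {0..T} (\<lambda>t. \<alpha> * (g t * v' t))
     - (integral {0..T} (\<lambda>t. k1 t * g t * v t) + integral {0..T} (\<lambda>t. k2 t * g t * V t))" .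
  have "integral {0..T} (\<lambda>t. g t * (\<alpha> * v' t + k2 t * V t + k1 t * v t))
    = integral {0..T} (\<lambda>t. \<alpha> * (g t * v' t) + (k1 t * g t * v t + k2 t * g t * V t))"
    by (intro integral_cong) (simp add: algebra_simps)
  also have "\<dots> = integral {0..T} (\<lambda>t. \<alpha> * (g t * v' t)) + (integral {0..T} (\<lambda>t. k1 t * g t * v t) + integral {0..T} (\<lambda>t. k2 t * g t * V t))"
    using i3 m'[OF cv k1g] m'[OF cV k2g] by (simp add: integral_add_absolutely_integrable set_integral_add(1))
  finally show ?B using 1 by simp
qed

text \<open>Integration by parts moves \<open>g z'\<close> from the primitive of \<open>n\<close>
  onto \<open>n\<close>, leaving \<open>g z\<close> plus a tail integral orthogonal to all bounded
  \<open>n\<close>. No constant of integration remains because the primitive of \<open>n\<close> is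
  free at \<open>T\<close>.\<close>

lemma multiplier_complementarity:
  fixes z z' g :: "real \<Rightarrow> real"
  assumes "0 < T" and z: "ac_on 0 T z z'" and g: "g absolutely_integrable_on {0..T}"
    and gz': "(\<lambda>t. g t * z' t) absolutely_integrable_on {0..T}"
    and stat: "\<And>n. n \<in> borel_measurable (lebesgue_on {0<..<T}) \<Longrightarrow> (\<And>t. \<bar>n t\<bar> \<le> 1) \<Longrightarrow>
      integral {0..T} (\<lambda>t. g t * (z' t * integral {0..t} n + z t * n t)) = 0"
  shows "AE t in lebesgue_on {0<..<T}. g t * z t = - tail_integral T (\<lambda>t. g t * z' t) t"
proof -
  define p where "p t = g t * z' t" for t
  have p: "p absolutely_integrable_on {0..T}" unfolding p_def by (rule gz')
  have gz: "(\<lambda>t. g t * z t) absolutely_integrable_on {0..T}"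
    using absolutely_integrable_continuous_mult[OF ac_on_continuous[OF z] g] by (simp add: mult.commute)
  have tp: "tail_integral T p absolutely_integrable_on {0..T}"
    by (rule absolutely_integrable_continuous_real[OF tail_integral_continuous[OF p]])
  have "AE t in lebesgue_on {0<..<T}. g t * z t + tail_integral T p t = 0"
  proof (rule AE_eq_zero_if_orthogonal_to_bounded)
    show "(\<lambda>t. g t * z t + tail_integral T p t) absolutely_integrable_on {0..T}"
      by (rule set_integral_add(1)[OF gz tp])
    fix n :: "real \<Rightarrow> real"
    assume n: "n \<in> borel_measurable (lebesgue_on {0<..<T})" "\<And>t. \<bar>n t\<bar> \<le> 1"
    have ni: "n absolutely_integrable_on {0..T}"
      by (rule Lp_imp_absolutely_integrable[OF Lp2_bounded[OF n(1), of 1]]) (use n(2) in auto)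
    define N where "N t = integral {0..t} n" for t
    have N: "ac_on 0 T N n" "N 0 = 0" unfolding N_def by (auto intro: ac_on_integral[OF ni])
    have "(\<lambda>t. n t * (g t * z t)) absolutely_integrable_on {0..T}"
    proof (rule absolutely_integrable_boundI[OF _ gz[THEN set_integrable_abs]])
      show "(\<lambda>t. n t * (g t * z t)) \<in> borel_measurable (lebesgue_on {0<..<T})"
        using n(1) absolutely_integrable_interval_measurable[OF gz] by measurable
      show "AE t in lebesgue_on {0<..<T}. norm (n t * (g t * z t)) \<le> \<bar>g t * z t\<bar>"
      proof (rule AE_I2)
        fix t
        have "\<bar>n t\<bar> * \<bar>g t * z t\<bar> \<le> 1 * \<bar>g t * z t\<bar>" by (intro mult_right_mono n) simp
        then show "norm (n t * (g t * z t)) \<le> \<bar>g t * z t\<bar>" by (simp add: abs_mult)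
      qed
    qed
    then have i1: "(\<lambda>t. g t * z t * n t) absolutely_integrable_on {0..T}" by (simp add: mult.commute)
    have i2: "(\<lambda>t. p t * N t) absolutely_integrable_on {0..T}"
      using absolutely_integrable_continuous_mult[OF ac_on_continuous[OF N(1)] p] by (simp add: mult.commute)
    have i3: "(\<lambda>t. tail_integral T p t * n t) absolutely_integrable_on {0..T}"
      by (rule absolutely_integrable_continuous_mult[OF tail_integral_continuous[OF p] ni])
    have "integral {0..T} (\<lambda>t. (g t * z t + tail_integral T p t) * n t)
      = integral {0..T} (\<lambda>t. g t * z t * n t) + integral {0..T} (\<lambda>t. tail_integral T p t * n t)"
      unfolding distrib_right by (rule integral_add_absolutely_integrable[OF i1 i3])
    also have "integral {0..T} (\<lambda>t. tail_integral T p t * n t) = integral {0..T} (\<lambda>t. p t * N t)"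
      by (rule integral_mult_tail_integral[OF \<open>0 < T\<close> p N, symmetric])
    also have "integral {0..T} (\<lambda>t. g t * z t * n t) + \<dots> = integral {0..T} (\<lambda>t. g t * z t * n t + p t * N t)"
      by (rule integral_add_absolutely_integrable[OF i1 i2, symmetric])
    also have "\<dots> = integral {0..T} (\<lambda>t. g t * (z' t * integral {0..t} n + z t * n t))"
      by (rule integral_cong) (simp add: p_def N_def algebra_simps)
    also have "\<dots> = 0" by (rule stat[OF n])
    finally show "integral {0..T} (\<lambda>t. (g t * z t + tail_integral T p t) * n t) = 0" .
  qed
  then show ?thesis unfolding p_def by eventually_elim simp
qed

text \<open>
  Where \<open>z\<close> does not vanish the multiplier \<open>g\<close> is the locally constant function \<open>G / z\<close>. Its value on a
  component of \<open>{z \<noteq> 0}\<close> with both endpoints in \<open>{z = 0}\<close> is controlled by integrating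
  \<open>z' = - g - c\<close> over that component.
\<close>

lemma multiplier_bounded:
  fixes z z' g G c q' :: "real \<Rightarrow> real"
  assumes "0 < T" and z: "ac_on 0 T z z'"
    and G: "ac_on 0 T G (\<lambda>t. g t * z' t)" "G T = 0"
    and gzG: "AE t in lebesgue_on {0<..<T}. g t * z t = G t"
    and split: "AE t in lebesgue_on {0<..<T}. g t = - (z' t + \<alpha> * q' t) - c t"
    and c: "continuous_on {0..T} c"
    and compl: "AE t in lebesgue_on {0<..<T}. z t * q' t = 0"
    and act: "AE t in lebesgue_on {0<..<T}. q' t \<noteq> 0 \<longrightarrow> \<bar>g t\<bar> \<le> X"
  shows "\<exists>C. AE t in lebesgue_on {0<..<T}. \<bar>g t\<bar> \<le> C"
proof -
  have cz: "continuous_on {0..T} z" by (rule ac_on_continuous[OF z])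
  obtain B where B: "\<And>t. t \<in> {0..T} \<Longrightarrow> \<bar>c t\<bar> \<le> B"
    using continuous_on_Icc_norm_bound[OF c] by (metis real_norm_def)
  \<comment> \<open>\<open>K\<close> represents \<open>g\<close> where \<open>z\<close> does not
    vanish. By the quotient rule its density is \<open>(g z' z - G z') / z^2\<close>, which is 0
    because \<open>g z = G\<close>.\<close>
  define K where "K t = G t * inverse (z t)" for t
  have const: "K s = K t" if st: "0 \<le> s" "s \<le> t" "t \<le> T" and nz: "\<And>x. x \<in> {s..t} \<Longrightarrow> z x \<noteq> 0" for s t
  proof -
    have zs: "ac_on s t z z'" and Gs: "ac_on s t G (\<lambda>t. g t * z' t)"
      using ac_on_subinterval z G(1) st by blast+
    have "ac_on s t (\<lambda>t. inverse (z t)) (\<lambda>t. - (inverse (z t) * inverse (z t)) * z' t)"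
    proof (rule ac_on_chain[OF zs, of "{x. x \<noteq> 0}"])
      show "(inverse has_real_derivative - (inverse x * inverse x)) (at x within {x. x \<noteq> 0})"
        if "x \<in> {x. x \<noteq> 0}" for x :: real
        using that by (auto intro!: derivative_eq_intros simp: power2_eq_square)
      show "continuous_on {x. x \<noteq> 0} (\<lambda>x::real. - (inverse x * inverse x))"
        by (intro continuous_intros) auto
    qed (use nz in auto)
    from ac_on_mult[OF Gs this]
    have acK: "ac_on s t K (\<lambda>t. g t * z' t * inverse (z t) + G t * (- (inverse (z t) * inverse (z t)) * z' t))"
      unfolding K_def .
    have "AE t in lebesgue_on {s<..<t}. g t * z' t * inverse (z t) + G t * (- (inverse (z t) * inverse (z t)) * z' t) = 0"
    proof -
      have "AE t in lebesgue_on {s<..<t}. g t * z t = G t" by (rule AE_subinterval[OF gzG]) (use st in auto)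
      moreover have "AE x in lebesgue_on {s<..<t}. z x \<noteq> 0" by (rule AE_intervalI) (use nz in auto)
      ultimately show ?thesis
      proof eventually_elim
        case (elim x)
        then show ?case by (simp flip: elim(1) add: field_simps)
      qed
    qed
    from ac_on_diff[OF ac_on_cong[OF acK refl this], of s t] st show ?thesis by simp
  qed
  have Kb: "\<bar>K t\<bar> \<le> max \<bar>K 0\<bar> B" if t: "0 < t" "t < T" and nz: "z t \<noteq> 0" for t
  proof -
    \<comment> \<open>Either the component of \<open>{z \<noteq> 0}\<close> around \<open>t\<close>
      reaches \<open>T\<close>, where \<open>G\<close> vanishes, or it reaches 0 and takes the value
      \<open>K 0\<close>, or it is enclosed by two zeros of \<open>z\<close>.\<close>
    consider "\<forall>x\<in>{t..T}. z x \<noteq> 0" | "\<forall>x\<in>{0..t}. z x \<noteq> 0"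
      | "{x \<in> {0..t}. z x = 0} \<noteq> {}" "{x \<in> {t..T}. z x = 0} \<noteq> {}" by blast
    then show ?thesis
    proof cases
      case 1
      then have "K t = K T" using const[of t T] t by auto
      also have "\<dots> = 0" by (simp only: K_def G(2) mult_zero_left)
      finally show ?thesis by (simp add: le_max_iff_disj)
    next
      case 2
      then have "K 0 = K t" using const[of 0 t] t by auto
      then show ?thesis by simp
    next
      case 3
      have "closed {x \<in> {0..t}. z x = 0}" "closed {x \<in> {t..T}. z x = 0}"
        using continuous_closed_preimage_constant[OF continuous_on_subset[OF cz], of "{0..t}" 0]
          continuous_closed_preimage_constant[OF continuous_on_subset[OF cz], of "{t..T}" 0] t by auto
      moreover have "{x \<in> {0..t}. z x = 0} \<subseteq> {0..t}" "{x \<in> {t..T}. z x = 0} \<subseteq> {t..T}" by auto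
      ultimately have comp: "compact {x \<in> {0..t}. z x = 0}" "compact {x \<in> {t..T}. z x = 0}"
        using compact_Int_closed[OF compact_Icc] by (metis Int_absorb1)+
      \<comment> \<open>\<open>r\<close> and \<open>d\<close> are the zeros nearest to
        \<open>t\<close> on either side, so \<open>{r<..<d}\<close> is the component containing
        \<open>t\<close>.\<close>
      obtain r where r: "r \<in> {0..t}" "z r = 0" "\<And>x. x \<in> {0..t} \<Longrightarrow> z x = 0 \<Longrightarrow> x \<le> r"
        using compact_attains_sup[OF comp(1) 3(1)] by blast
      obtain d where d: "d \<in> {t..T}" "z d = 0" "\<And>x. x \<in> {t..T} \<Longrightarrow> z x = 0 \<Longrightarrow> d \<le> x"
        using compact_attains_inf[OF comp(2) 3(2)] by blast
      have rd: "r < t" "t < d" using r(1,2) d(1,2) nz by (auto simp: less_le)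
      have nz': "z x \<noteq> 0" if "r < x" "x < d" for x
        using r(3)[of x] d(3)[of x] that r(1) d(1) by (cases "x \<le> t") auto
      have Kt: "K x = K t" if "r < x" "x < d" for x
      proof (cases "x \<le> t")
        case True
        then show ?thesis by (intro const nz') (use that rd r(1) d(1) in auto)
      next
        case False
        then show ?thesis by (intro const[symmetric] nz') (use that rd r(1) d(1) in auto)
      qed
      \<comment> \<open>Complementarity gives \<open>q' = 0\<close> on this component and
        \<open>g\<close> is the constant \<open>K t\<close>, so the splitting of \<open>g\<close>
        determines \<open>z'\<close>. Integrated between two zeros of \<open>z\<close>, it says that
        \<open>K t\<close> is minus the mean value of \<open>c\<close>.\<close>
      have "AE x in lebesgue_on {r<..<d}. z' x = - K t - c x"
      proof -
        have sub: "AE x in lebesgue_on {r<..<d}. P x" if "AE x in lebesgue_on {0<..<T}. P x" for P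
          by (rule AE_subinterval[OF that]) (use r(1) d(1) in auto)
        have "AE x in lebesgue_on {r<..<d}. r < x \<and> x < d" by (rule AE_intervalI) auto
        with sub[OF gzG] sub[OF split] sub[OF compl] show ?thesis
        proof eventually_elim
          case (elim x)
          then have nzx: "z x \<noteq> 0" using nz' by blast
          then have "q' x = 0" using elim(3) by simp
          moreover have "g x = K x" using elim(1) nzx by (simp add: K_def flip: elim(1))
          ultimately show ?case using elim(2) Kt[of x] elim(4) by simp
        qed
      qed
      then have "integral {r..d} z' = integral {r..d} (\<lambda>x. - K t - c x)"
        by (rule integral_cong_AE_interval)
      moreover have "integral {r..d} z' = 0"
        using ac_on_diff[OF z, of r d] r(1,2) d(1,2) rd by simp
      moreover have ci: "c integrable_on {r..d}"
        by (intro integrable_continuous_interval continuous_on_subset[OF c]) (use r(1) d(1) in auto)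
      then have "integral {r..d} (\<lambda>x. - K t - c x) = - K t * (d - r) - integral {r..d} c"
        using rd by (subst Henstock_Kurzweil_Integration.integral_diff) (auto simp: mult.commute)
      ultimately have "K t * (d - r) = - integral {r..d} c" by simp
      moreover have "norm (integral {r..d} c) \<le> B * (d - r)"
      proof -
        have "norm (integral {r..d} c) \<le> integral {r..d} (\<lambda>x. B)"
          by (rule integral_norm_bound_integral[OF ci]) (use B r(1) d(1) in auto)
        then show ?thesis using rd by (simp add: mult.commute)
      qed
      ultimately have "\<bar>K t\<bar> * (d - r) \<le> B * (d - r)"
        using abs_mult[of "K t" "d - r"] rd by simp
      then have "\<bar>K t\<bar> \<le> B" using rd by simp
      then show ?thesis by simp
    qed
  qed
  have "AE t in lebesgue_on {0<..<T}. \<bar>g t\<bar> \<le> max (max \<bar>K 0\<bar> B) X"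
  proof -
    have "AE t in lebesgue_on {0<..<T}. 0 < t \<and> t < T" by (rule AE_intervalI) auto
    with gzG split act ac_on_deriv_zero_on_zero_set[OF z] show ?thesis
    proof eventually_elim
      case (elim t)
      consider "z t \<noteq> 0" | "z t = 0" "q' t = 0" | "q' t \<noteq> 0" by blast
      then show ?case
      proof cases
        case 1
        then have "g t = K t" by (simp add: K_def flip: elim(1))
        then show ?thesis using Kb[OF _ _ 1] elim(5) by auto
      next
        \<comment> \<open>Almost everywhere on this set \<open>z'\<close> vanishes along with
          \<open>z\<close>, so of the splitting only the continuous part \<open>c\<close>
          survives.\<close>
        case 2
        then have "g t = - c t" using elim by simp
        then show ?thesis using B[of t] elim(5) by auto
      next
        case 3
        then show ?thesis using elim(3) by auto
      qed
    qed
  qed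
  then show ?thesis by blast
qed

section \<open>Uniform linearizations\<close>

lemma DERIV_at_zero_iff:
  fixes f :: "real \<Rightarrow> real"
  shows "(f has_real_derivative D) (at 0) \<longleftrightarrow>
    (\<forall>\<eta>>0. \<exists>\<delta>>0. \<forall>\<epsilon>. \<bar>\<epsilon>\<bar> < \<delta> \<longrightarrow> \<bar>f \<epsilon> - f 0 - D * \<epsilon>\<bar> \<le> \<eta> * \<bar>\<epsilon>\<bar>)"
  unfolding has_field_derivative_def has_derivative_at_alt by (simp add: bounded_linear_mult_right)

text \<open>The map from \<open>(t, \<epsilon>)\<close> to \<open>g (H t + \<epsilon> * V t)\<close>
  is uniformly continuous on the compact rectangle with \<epsilon> between -1 and 1; this is where
  uniformity in \<open>t\<close> comes from.\<close>

lemma uniform_increment: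
  fixes g H V :: "real \<Rightarrow> real"
  assumes g: "continuous_on UNIV g" and H: "continuous_on {a..b} H" and V: "continuous_on {a..b} V" and "0 < \<eta>"
  shows "\<exists>\<delta>>0. \<forall>\<epsilon> t. \<bar>\<epsilon>\<bar> < \<delta> \<longrightarrow> t \<in> {a..b} \<longrightarrow> \<bar>g (H t + \<epsilon> * V t) - g (H t)\<bar> \<le> \<eta>"
proof -
  have "continuous_on ({a..b} \<times> {-1..1}) (\<lambda>p. g (H (fst p) + snd p * V (fst p)))"
    by (rule continuous_on_compose2[OF g])
      (auto intro!: continuous_intros continuous_on_compose2[OF H] continuous_on_compose2[OF V])
  then have "uniformly_continuous_on ({a..b} \<times> {-1..1}) (\<lambda>p. g (H (fst p) + snd p * V (fst p)))"
    by (rule compact_uniformly_continuous) (intro compact_Times compact_Icc)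
  then obtain \<delta> where "\<delta> > 0" and \<delta>: "\<And>p p'. p \<in> {a..b} \<times> {-1..1} \<Longrightarrow> p' \<in> {a..b} \<times> {-1..1} \<Longrightarrow> dist p' p < \<delta> \<Longrightarrow>
      dist (g (H (fst p') + snd p' * V (fst p'))) (g (H (fst p) + snd p * V (fst p))) < \<eta>"
    unfolding uniformly_continuous_on_def using \<open>0 < \<eta>\<close> by meson
  have "\<bar>g (H t + \<epsilon> * V t) - g (H t)\<bar> \<le> \<eta>" if "\<bar>\<epsilon>\<bar> < min \<delta> 1" "t \<in> {a..b}" for \<epsilon> t
  proof -
    have "- 1 \<le> \<epsilon>" "\<epsilon> \<le> 1" using that by auto
    then show ?thesis using \<delta>[of "(t, 0)" "(t, \<epsilon>)"] that by (auto simp: dist_Pair_Pair dist_real_def)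
  qed
  then show ?thesis using \<open>\<delta> > 0\<close> by (intro exI[of _ "min \<delta> 1"]) auto
qed

text \<open>The mean value theorem in an auxiliary parameter \<open>s\<close> between 0 and 1 writes
  the remainder as an increment of \<open>f'\<close> times \<open>\<epsilon> * V t\<close>, and that
  increment is uniformly small.\<close>

lemma uniform_linearization:
  fixes f f' H V :: "real \<Rightarrow> real"
  assumes f: "\<And>x. (f has_real_derivative f' x) (at x)" and f': "continuous_on UNIV f'"
    and H: "continuous_on {a..b} H" and V: "continuous_on {a..b} V" and "0 < \<eta>"
  shows "\<exists>\<delta>>0. \<forall>\<epsilon> t. \<bar>\<epsilon>\<bar> < \<delta> \<longrightarrow> t \<in> {a..b} \<longrightarrow>
    \<bar>f (H t + \<epsilon> * V t) - f (H t) - \<epsilon> * (f' (H t) * V t)\<bar> \<le> \<eta> * \<bar>\<epsilon>\<bar>"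
proof -
  obtain B where B: "\<And>t. t \<in> {a..b} \<Longrightarrow> \<bar>V t\<bar> \<le> B"
    using continuous_on_Icc_norm_bound[OF V] by (metis real_norm_def)
  \<comment> \<open>The denominator pays for the bound \<open>B\<close> on \<open>V\<close>; adding
    1 keeps it positive.\<close>
  define \<eta>' where "\<eta>' = \<eta> / (1 + \<bar>B\<bar>)"
  have "0 < \<eta>'" using \<open>0 < \<eta>\<close> by (simp add: \<eta>'_def)
  then obtain \<delta> where "\<delta> > 0" and
    \<delta>: "\<And>\<epsilon> t. \<bar>\<epsilon>\<bar> < \<delta> \<Longrightarrow> t \<in> {a..b} \<Longrightarrow> \<bar>f' (H t + \<epsilon> * V t) - f' (H t)\<bar> \<le> \<eta>'"
    using uniform_increment[OF f' H V] by blast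
  have "\<bar>f (H t + \<epsilon> * V t) - f (H t) - \<epsilon> * (f' (H t) * V t)\<bar> \<le> \<eta> * \<bar>\<epsilon>\<bar>"
    if e: "\<bar>\<epsilon>\<bar> < \<delta>" and t: "t \<in> {a..b}" for \<epsilon> t
  proof -
    define h where "h s = f (H t + s * (\<epsilon> * V t)) - s * (\<epsilon> * (f' (H t) * V t))" for s
    have "\<exists>s. 0 < s \<and> s < 1 \<and> h 1 - h 0 = (1 - 0) * (f' (H t + s * (\<epsilon> * V t)) * (\<epsilon> * V t) - \<epsilon> * (f' (H t) * V t))"
      by (rule MVT2) (auto simp: h_def intro!: derivative_eq_intros DERIV_chain2[OF f])
    then obtain s where s: "0 < s" "s < 1"
      "h 1 - h 0 = f' (H t + s * (\<epsilon> * V t)) * (\<epsilon> * V t) - \<epsilon> * (f' (H t) * V t)" by auto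
    have "f (H t + \<epsilon> * V t) - f (H t) - \<epsilon> * (f' (H t) * V t) = h 1 - h 0" by (simp add: h_def)
    also have "\<dots> = (f' (H t + (s * \<epsilon>) * V t) - f' (H t)) * (\<epsilon> * V t)" using s(3) by (simp add: algebra_simps)
    finally have eq: "\<bar>f (H t + \<epsilon> * V t) - f (H t) - \<epsilon> * (f' (H t) * V t)\<bar>
        = \<bar>f' (H t + (s * \<epsilon>) * V t) - f' (H t)\<bar> * (\<bar>\<epsilon>\<bar> * \<bar>V t\<bar>)" by (simp add: abs_mult)
    have "\<bar>s * \<epsilon>\<bar> \<le> 1 * \<bar>\<epsilon>\<bar>" unfolding abs_mult using s by (intro mult_right_mono) auto
    then have "\<bar>f' (H t + (s * \<epsilon>) * V t) - f' (H t)\<bar> \<le> \<eta>'" using \<delta> e t by auto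
    then have "\<bar>f' (H t + (s * \<epsilon>) * V t) - f' (H t)\<bar> * (\<bar>\<epsilon>\<bar> * \<bar>V t\<bar>) \<le> \<eta>' * (\<bar>\<epsilon>\<bar> * (1 + \<bar>B\<bar>))"
      using B[OF t] \<open>0 < \<eta>'\<close> by (intro mult_mono) auto
    also have "\<dots> = \<eta> * \<bar>\<epsilon>\<bar>" by (simp add: \<eta>'_def)
    finally show ?thesis unfolding eq .
  qed
  then show ?thesis using \<open>\<delta> > 0\<close> by blast
qed

text \<open>The product has the shape of the time derivative of
  \<open>\<kappa> (H t + \<epsilon> * W t)\<close>, with \<open>f\<close> in the role of
  \<open>\<kappa>'\<close> and \<open>f'\<close> in that of \<open>\<kappa>''\<close>. The remainder
  is the linearization error of \<open>f\<close> times \<open>q\<close>, plus \<epsilon> times an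
  increment of \<open>f\<close> times \<open>v\<close>.\<close>

lemma uniform_linearization_product:
  fixes f f' H V q v :: "real \<Rightarrow> real"
  assumes f: "\<And>x. (f has_real_derivative f' x) (at x)" and f': "continuous_on UNIV f'"
    and H: "continuous_on {a..b} H" and V: "continuous_on {a..b} V"
    and q: "continuous_on {a..b} q" and v: "continuous_on {a..b} v" and "0 < \<eta>"
  shows "\<exists>\<delta>>0. \<forall>\<epsilon> t. \<bar>\<epsilon>\<bar> < \<delta> \<longrightarrow> t \<in> {a..b} \<longrightarrow>
    \<bar>f (H t + \<epsilon> * V t) * (q t + \<epsilon> * v t) - f (H t) * q t - \<epsilon> * (f' (H t) * q t * V t + f (H t) * v t)\<bar> \<le> \<eta> * \<bar>\<epsilon>\<bar>"
proof -
  obtain B where B: "\<And>t. t \<in> {a..b} \<Longrightarrow> \<bar>q t\<bar> \<le> B"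
    using continuous_on_Icc_norm_bound[OF q] by (metis real_norm_def)
  obtain C where C: "\<And>t. t \<in> {a..b} \<Longrightarrow> \<bar>v t\<bar> \<le> C"
    using continuous_on_Icc_norm_bound[OF v] by (metis real_norm_def)
  define e1 where "e1 = \<eta> / (2 * (1 + \<bar>B\<bar>))"
  define e2 where "e2 = \<eta> / (2 * (1 + \<bar>C\<bar>))"
  have e: "0 < e1" "0 < e2" using \<open>0 < \<eta>\<close> by (simp_all add: e1_def e2_def)
  obtain d1 where "d1 > 0" and d1: "\<And>\<epsilon> t. \<bar>\<epsilon>\<bar> < d1 \<Longrightarrow> t \<in> {a..b} \<Longrightarrow>
    \<bar>f (H t + \<epsilon> * V t) - f (H t) - \<epsilon> * (f' (H t) * V t)\<bar> \<le> e1 * \<bar>\<epsilon>\<bar>"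
    using uniform_linearization[OF f f' H V e(1)] by blast
  have cf: "continuous_on UNIV f" by (rule DERIV_continuous_on[OF has_field_derivative_at_within[OF f]])
  obtain d2 where "d2 > 0" and d2: "\<And>\<epsilon> t. \<bar>\<epsilon>\<bar> < d2 \<Longrightarrow> t \<in> {a..b} \<Longrightarrow> \<bar>f (H t + \<epsilon> * V t) - f (H t)\<bar> \<le> e2"
    using uniform_increment[OF cf H V e(2)] by blast
  have "\<bar>f (H t + \<epsilon> * V t) * (q t + \<epsilon> * v t) - f (H t) * q t - \<epsilon> * (f' (H t) * q t * V t + f (H t) * v t)\<bar> \<le> \<eta> * \<bar>\<epsilon>\<bar>"
    if ep: "\<bar>\<epsilon>\<bar> < min d1 d2" and t: "t \<in> {a..b}" for \<epsilon> t
  proof -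
    let ?x = "f (H t + \<epsilon> * V t) - f (H t) - \<epsilon> * (f' (H t) * V t)"
    let ?y = "f (H t + \<epsilon> * V t) - f (H t)"
    have "\<bar>?x * q t\<bar> \<le> (e1 * \<bar>\<epsilon>\<bar>) * (1 + \<bar>B\<bar>)"
      unfolding abs_mult using d1[of \<epsilon> t] ep t B[OF t] e by (intro mult_mono) auto
    also have "\<dots> = \<eta> / 2 * \<bar>\<epsilon>\<bar>" by (simp add: e1_def field_simps)
    finally have 1: "\<bar>?x * q t\<bar> \<le> \<eta> / 2 * \<bar>\<epsilon>\<bar>" .
    have "\<bar>?y * v t\<bar> \<le> e2 * (1 + \<bar>C\<bar>)"
      unfolding abs_mult using d2[of \<epsilon> t] ep t C[OF t] e by (intro mult_mono) auto
    also have "\<dots> = \<eta> / 2" by (simp add: e2_def field_simps)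
    finally have "\<bar>\<epsilon> * (?y * v t)\<bar> \<le> \<bar>\<epsilon>\<bar> * (\<eta> / 2)"
      unfolding abs_mult[of \<epsilon>] by (intro mult_left_mono) auto
    moreover have "f (H t + \<epsilon> * V t) * (q t + \<epsilon> * v t) - f (H t) * q t - \<epsilon> * (f' (H t) * q t * V t + f (H t) * v t)
      = ?x * q t + \<epsilon> * (?y * v t)" by (simp add: algebra_simps)
    ultimately show ?thesis using 1 by (simp add: mult.commute)
  qed
  then show ?thesis using \<open>d1 > 0\<close> \<open>d2 > 0\<close> by (intro exI[of _ "min d1 d2"]) auto
qed

text \<open>\<open>A \<epsilon>\<close> may depend nonlinearly on \<epsilon>. With
  \<open>\<rho> = A \<epsilon> - \<epsilon> a\<close> the remainder of the square is
  \<open>2 f \<rho> + (\<rho> + \<epsilon> a)^2\<close>; since \<rho> is small uniformly in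
  \<open>t\<close>, integrability of \<open>f\<close> and of \<open>a^2\<close> controls both
  terms.\<close>

lemma integral_square_deriv:
  fixes f a :: "real \<Rightarrow> real" and A :: "real \<Rightarrow> real \<Rightarrow> real"
  assumes "0 < T" and f: "f \<in> Lp {0<..<T} 2" and a: "a \<in> Lp {0<..<T} 2" and A: "\<And>\<epsilon>. A \<epsilon> \<in> Lp {0<..<T} 2"
    and lin: "\<And>\<eta>. 0 < \<eta> \<Longrightarrow> \<exists>\<delta>>0. \<forall>\<epsilon> t. \<bar>\<epsilon>\<bar> < \<delta> \<longrightarrow> t \<in> {0..T} \<longrightarrow> \<bar>A \<epsilon> t - \<epsilon> * a t\<bar> \<le> \<eta> * \<bar>\<epsilon>\<bar>"
  shows "((\<lambda>\<epsilon>. integral {0..T} (\<lambda>t. (f t + A \<epsilon> t)\<^sup>2)) has_real_derivative 2 * integral {0..T} (\<lambda>t. f t * a t)) (at 0)"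
  unfolding DERIV_at_zero_iff
proof (intro allI impI)
  fix \<eta> :: real assume "0 < \<eta>"
  define F where "F = integral {0..T} (\<lambda>t. \<bar>f t\<bar>)"
  define N where "N = integral {0..T} (\<lambda>t. (a t)\<^sup>2)"
  have fi: "f absolutely_integrable_on {0..T}" using Lp_imp_absolutely_integrable[OF f] by simp
  have ai: "a absolutely_integrable_on {0..T}" using Lp_imp_absolutely_integrable[OF a] by simp
  have absf: "(\<lambda>t. \<bar>f t\<bar>) absolutely_integrable_on {0..T}" by (rule set_integrable_abs[OF fi])
  have fa: "(\<lambda>t. f t * a t) absolutely_integrable_on {0..T}" by (rule Lp2_mult_absolutely_integrable[OF f a])
  have aa: "(\<lambda>t. (a t)\<^sup>2) absolutely_integrable_on {0..T}" using Lp2_mult_absolutely_integrable[OF a a] by (simp add: power2_eq_square)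
  have ff: "(\<lambda>t. (f t)\<^sup>2) absolutely_integrable_on {0..T}" using Lp2_mult_absolutely_integrable[OF f f] by (simp add: power2_eq_square)
  have sq: "(\<lambda>t. (f t + A \<epsilon> t)\<^sup>2) absolutely_integrable_on {0..T}" for \<epsilon>
    using Lp2_mult_absolutely_integrable[OF Lp2_add[OF f A] Lp2_add[OF f A]] by (simp add: power2_eq_square)
  note toint = set_lebesgue_integral_eq_integral(1)
  have F0: "0 \<le> F" unfolding F_def by (intro Henstock_Kurzweil_Integration.integral_nonneg toint[OF absf]) auto
  have N0: "0 \<le> N" unfolding N_def by (intro Henstock_Kurzweil_Integration.integral_nonneg toint[OF aa]) auto
  \<comment> \<open>The bound by 1 yields \<open>\<rho>^2 \<le> \<epsilon>^2\<close>; the other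
    bound makes \<open>2 * e * F\<close> at most \<open>\<eta> / 2\<close>. The second half of
    \<eta> is supplied by \<open>d'\<close> below.\<close>
  define e where "e = min 1 (\<eta> / (4 * (F + 1)))"
  have e: "0 < e" "e \<le> 1" "e * (4 * (F + 1)) \<le> \<eta>"
  proof -
    show "0 < e" "e \<le> 1" unfolding e_def using \<open>0 < \<eta>\<close> F0 by auto
    have "e * (4 * (F + 1)) \<le> \<eta> / (4 * (F + 1)) * (4 * (F + 1))"
      using F0 by (intro mult_right_mono) (auto simp: e_def)
    then show "e * (4 * (F + 1)) \<le> \<eta>" using F0 by simp
  qed
  obtain d where "d > 0" and d: "\<And>\<epsilon> t. \<bar>\<epsilon>\<bar> < d \<Longrightarrow> t \<in> {0..T} \<Longrightarrow> \<bar>A \<epsilon> t - \<epsilon> * a t\<bar> \<le> e * \<bar>\<epsilon>\<bar>"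
    using lin[OF e(1)] by blast
  define d' where "d' = \<eta> / (4 * (N + T + 1))"
  have "d' > 0" unfolding d'_def using \<open>0 < \<eta>\<close> N0 \<open>0 < T\<close> by auto
  show "\<exists>\<delta>>0. \<forall>\<epsilon>. \<bar>\<epsilon>\<bar> < \<delta> \<longrightarrow> \<bar>integral {0..T} (\<lambda>t. (f t + A \<epsilon> t)\<^sup>2) - integral {0..T} (\<lambda>t. (f t + A 0 t)\<^sup>2)
      - 2 * integral {0..T} (\<lambda>t. f t * a t) * \<epsilon>\<bar> \<le> \<eta> * \<bar>\<epsilon>\<bar>"
  proof (intro exI[of _ "min d d'"] conjI allI impI)
    show "0 < min d d'" using \<open>d > 0\<close> \<open>d' > 0\<close> by simp
    fix \<epsilon> :: real assume eps: "\<bar>\<epsilon>\<bar> < min d d'"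
    \<comment> \<open>The linearization estimate at \<open>\<epsilon> = 0\<close> already forces
      \<open>A 0\<close> to vanish.\<close>
    have A0: "A 0 t = 0" if "t \<in> {0..T}" for t using d[of 0 t] that \<open>d > 0\<close> by simp
    then have i0: "integral {0..T} (\<lambda>t. (f t + A 0 t)\<^sup>2) = integral {0..T} (\<lambda>t. (f t)\<^sup>2)"
      by (intro integral_cong) simp
    let ?r = "\<lambda>t. ((f t + A \<epsilon> t)\<^sup>2 - (f t)\<^sup>2) - (2 * \<epsilon>) * (f t * a t)"
    have ri: "?r absolutely_integrable_on {0..T}"
      by (intro set_integral_diff(1) sq ff set_integrable_mult_right fa)
    have "integral {0..T} ?r = (integral {0..T} (\<lambda>t. (f t + A \<epsilon> t)\<^sup>2) - integral {0..T} (\<lambda>t. (f t)\<^sup>2)) - (2 * \<epsilon>) * integral {0..T} (\<lambda>t. f t * a t)"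
      using sq ff fa by (simp add: integral_diff_absolutely_integrable set_integral_diff(1))
    then have eq: "integral {0..T} (\<lambda>t. (f t + A \<epsilon> t)\<^sup>2) - integral {0..T} (\<lambda>t. (f t + A 0 t)\<^sup>2)
      - 2 * integral {0..T} (\<lambda>t. f t * a t) * \<epsilon> = integral {0..T} ?r" using i0 by simp
    let ?b = "\<lambda>t. (2 * e * \<bar>\<epsilon>\<bar>) * \<bar>f t\<bar> + ((2 * \<epsilon>\<^sup>2) * (a t)\<^sup>2 + 2 * \<epsilon>\<^sup>2)"
    have ci: "(\<lambda>t. 2 * \<epsilon>\<^sup>2) absolutely_integrable_on {0..T}" by (rule absolutely_integrable_continuous_real) simp
    have m1: "(\<lambda>t. (2 * e * \<bar>\<epsilon>\<bar>) * \<bar>f t\<bar>) absolutely_integrable_on {0..T}" by (intro set_integrable_mult_right absf)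
    have m2: "(\<lambda>t. (2 * \<epsilon>\<^sup>2) * (a t)\<^sup>2) absolutely_integrable_on {0..T}" by (intro set_integrable_mult_right aa)
    have m3: "(\<lambda>t. (2 * \<epsilon>\<^sup>2) * (a t)\<^sup>2 + 2 * \<epsilon>\<^sup>2) absolutely_integrable_on {0..T}" by (rule set_integral_add(1)[OF m2 ci])
    have "norm (integral {0..T} ?r) \<le> integral {0..T} ?b"
    proof (rule integral_norm_bound_integral[OF toint[OF ri] toint[OF set_integral_add(1)[OF m1 m3]]])
      fix t assume t: "t \<in> {0..T}"
      define \<rho> where "\<rho> = A \<epsilon> t - \<epsilon> * a t"
      have r: "\<bar>\<rho>\<bar> \<le> e * \<bar>\<epsilon>\<bar>" unfolding \<rho>_def using d eps t by simp
      also have "\<dots> \<le> 1 * \<bar>\<epsilon>\<bar>" using e by (intro mult_right_mono) auto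
      finally have "\<rho>\<^sup>2 \<le> \<epsilon>\<^sup>2" by (simp add: abs_le_square_iff)
      have eqr: "?r t = 2 * f t * \<rho> + (\<rho> + \<epsilon> * a t)\<^sup>2"
        unfolding \<rho>_def by (simp add: power2_eq_square algebra_simps)
      have "(\<rho> + \<epsilon> * a t)\<^sup>2 \<le> 2 * \<rho>\<^sup>2 + 2 * (\<epsilon> * a t)\<^sup>2"
        using sum_squares_bound[of \<rho> "\<epsilon> * a t"] by (simp add: power2_sum)
      then have "(\<rho> + \<epsilon> * a t)\<^sup>2 \<le> (2 * \<epsilon>\<^sup>2) * (a t)\<^sup>2 + 2 * \<epsilon>\<^sup>2"
        using \<open>\<rho>\<^sup>2 \<le> \<epsilon>\<^sup>2\<close> by (simp add: power_mult_distrib)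
      moreover have "\<bar>2 * f t * \<rho>\<bar> \<le> (2 * e * \<bar>\<epsilon>\<bar>) * \<bar>f t\<bar>"
        using mult_left_mono[OF r, of "2 * \<bar>f t\<bar>"] by (simp add: abs_mult algebra_simps)
      moreover have "\<bar>(\<rho> + \<epsilon> * a t)\<^sup>2\<bar> = (\<rho> + \<epsilon> * a t)\<^sup>2" by simp
      ultimately show "norm (?r t) \<le> ?b t" unfolding eqr real_norm_def
        using abs_triangle_ineq[of "2 * f t * \<rho>" "(\<rho> + \<epsilon> * a t)\<^sup>2"] by linarith
    qed
    also have "integral {0..T} ?b = (2 * e * \<bar>\<epsilon>\<bar>) * F + ((2 * \<epsilon>\<^sup>2) * N + 2 * \<epsilon>\<^sup>2 * T)"
      unfolding integral_add_absolutely_integrable[OF m1 m3] integral_add_absolutely_integrable[OF m2 ci] F_def N_def using \<open>0 < T\<close> by simp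
    also have "\<dots> = \<bar>\<epsilon>\<bar> * (2 * e * F + 2 * \<bar>\<epsilon>\<bar> * (N + T))"
    proof -
      have sq: "\<epsilon>\<^sup>2 = \<bar>\<epsilon>\<bar> * \<bar>\<epsilon>\<bar>" by (simp add: power2_eq_square)
      show ?thesis unfolding sq by algebra
    qed
    also have "\<dots> \<le> \<bar>\<epsilon>\<bar> * \<eta>"
    proof (rule mult_left_mono)
      have "\<bar>\<epsilon>\<bar> * (4 * (N + T + 1)) \<le> d' * (4 * (N + T + 1))"
        using eps N0 \<open>0 < T\<close> by (intro mult_right_mono) auto
      also have "\<dots> = \<eta>" using N0 \<open>0 < T\<close> by (simp add: d'_def)
      finally have "\<bar>\<epsilon>\<bar> * (4 * (N + T + 1)) \<le> \<eta>" .
      then have "2 * \<bar>\<epsilon>\<bar> * (N + T) \<le> \<eta> / 2" by (simp add: algebra_simps)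
      moreover have "2 * e * F \<le> \<eta> / 2" using e by (simp add: algebra_simps)
      ultimately show "2 * e * F + 2 * \<bar>\<epsilon>\<bar> * (N + T) \<le> \<eta>" by simp
    qed simp
    finally show "\<bar>integral {0..T} (\<lambda>t. (f t + A \<epsilon> t)\<^sup>2) - integral {0..T} (\<lambda>t. (f t + A 0 t)\<^sup>2)
      - 2 * integral {0..T} (\<lambda>t. f t * a t) * \<epsilon>\<bar> \<le> \<eta> * \<bar>\<epsilon>\<bar>" unfolding eq by (simp add: mult.commute)
  qed
qed

lemma functional_deriv:
  fixes j :: "(real \<Rightarrow> 'a::euclidean_space) \<Rightarrow> real"
  assumes "C1_functional_on_L2 T j j'" and f: "f \<in> Lp {0<..<T} 2" and h: "h \<in> Lp {0<..<T} 2"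
  shows "((\<lambda>\<epsilon>. j (\<lambda>t. f t + \<epsilon> *\<^sub>R h t)) has_real_derivative L2_inner T (j' f) h) (at 0)"
  unfolding DERIV_at_zero_iff
proof (intro allI impI)
  fix \<eta> :: real assume "0 < \<eta>"
  have sc: "L2_norm T (\<lambda>t. \<epsilon> *\<^sub>R h t) = \<bar>\<epsilon>\<bar> * L2_norm T h" for \<epsilon>
    by (simp add: L2_norm_def L2_inner_def real_sqrt_mult flip: power2_eq_square mult.assoc)
  have si: "L2_inner T (j' f) (\<lambda>t. \<epsilon> *\<^sub>R h t) = L2_inner T (j' f) h * \<epsilon>" for \<epsilon>
    by (simp add: L2_inner_def)
  have n0: "0 \<le> L2_norm T h" unfolding L2_norm_def L2_inner_def by simp
  \<comment> \<open>The added 1 covers directions of norm 0.\<close>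
  define e where "e = \<eta> / (L2_norm T h + 1)"
  have "0 < e" using \<open>0 < \<eta>\<close> n0 by (simp add: e_def)
  then obtain d where "0 < d" and d: "\<And>h. h \<in> Lp {0<..<T} 2 \<Longrightarrow> L2_norm T h < d \<Longrightarrow>
      \<bar>j (\<lambda>t. f t + h t) - j f - L2_inner T (j' f) h\<bar> \<le> e * L2_norm T h"
    using assms(1) f unfolding C1_functional_on_L2_def by meson
  show "\<exists>\<delta>>0. \<forall>\<epsilon>. \<bar>\<epsilon>\<bar> < \<delta> \<longrightarrow> \<bar>j (\<lambda>t. f t + \<epsilon> *\<^sub>R h t) - j (\<lambda>t. f t + 0 *\<^sub>R h t) - L2_inner T (j' f) h * \<epsilon>\<bar> \<le> \<eta> * \<bar>\<epsilon>\<bar>"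
  proof (intro exI[of _ "d / (L2_norm T h + 1)"] conjI allI impI)
    show "0 < d / (L2_norm T h + 1)" using \<open>0 < d\<close> n0 by simp
    fix \<epsilon> :: real assume "\<bar>\<epsilon>\<bar> < d / (L2_norm T h + 1)"
    then have "\<bar>\<epsilon>\<bar> * (L2_norm T h + 1) < d" using n0 by (simp add: pos_less_divide_eq)
    then have "L2_norm T (\<lambda>t. \<epsilon> *\<^sub>R h t) < d" unfolding sc by (simp add: distrib_left)
    from d[OF _ this] have "\<bar>j (\<lambda>t. f t + \<epsilon> *\<^sub>R h t) - j f - L2_inner T (j' f) h * \<epsilon>\<bar> \<le> e * (\<bar>\<epsilon>\<bar> * L2_norm T h)"
      using Lp2_linear[OF h bounded_linear_scaleR_right] unfolding si sc by blast
    also have "\<dots> \<le> e * (\<bar>\<epsilon>\<bar> * (L2_norm T h + 1))"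
      using \<open>0 < e\<close> by (intro mult_left_mono) auto
    also have "\<dots> = \<eta> * \<bar>\<epsilon>\<bar>" using n0 by (simp add: e_def)
    finally show "\<bar>j (\<lambda>t. f t + \<epsilon> *\<^sub>R h t) - j (\<lambda>t. f t + 0 *\<^sub>R h t) - L2_inner T (j' f) h * \<epsilon>\<bar> \<le> \<eta> * \<bar>\<epsilon>\<bar>"
      by simp
  qed
qed

text \<open>As a function of \<eta>, \<open>dissipation\<close> is a linear form plus the indicator
  of the nonnegative orthant. The inclusion therefore says that \<open>p\<close> minus this form is
  in the normal cone of the orthant at \<eta>, which splits into complementarity conditions for the
  components.\<close>

lemma dissipation_subdifferential_iff:
  fixes p \<zeta> \<eta> :: "real ^ 'n"
  shows "p \<in> subdifferential (dissipation \<kappa> \<zeta>) \<eta> \<longleftrightarrow>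
    (\<forall>i. 0 \<le> \<eta> $ i \<and> p $ i - \<kappa> (\<zeta> $ i) \<le> 0 \<and> (p $ i - \<kappa> (\<zeta> $ i)) * \<eta> $ i = 0)"
proof
  define r where "r = p - vec_map \<kappa> \<zeta>"
  have ri: "r $ i = p $ i - \<kappa> (\<zeta> $ i)" for i by (simp add: r_def vec_map_def)
  assume L: "p \<in> subdifferential (dissipation \<kappa> \<zeta>) \<eta>"
  then have pos: "\<forall>i. 0 \<le> \<eta> $ i"
    unfolding subdifferential_def dissipation_def by (auto split: if_splits)
  have le: "r \<bullet> (y - \<eta>) \<le> 0" if "\<forall>i. 0 \<le> y $ i" for y
  proof -
    have "dissipation \<kappa> \<zeta> \<eta> + ereal (p \<bullet> (y - \<eta>)) \<le> dissipation \<kappa> \<zeta> y"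
      using L unfolding subdifferential_def by blast
    then show ?thesis using pos that
      by (simp add: dissipation_def r_def inner_diff_left inner_diff_right)
  qed
  show "\<forall>i. 0 \<le> \<eta> $ i \<and> p $ i - \<kappa> (\<zeta> $ i) \<le> 0 \<and> (p $ i - \<kappa> (\<zeta> $ i)) * \<eta> $ i = 0"
  proof
    fix i
    \<comment> \<open>Increasing one component of \<eta> gives the sign of
      \<open>r $ i\<close>.\<close>
    have "r \<bullet> ((\<eta> + axis i 1) - \<eta>) \<le> 0"
      by (rule le) (use pos in \<open>auto simp: axis_def\<close>)
    then have 1: "r $ i \<le> 0" by (simp add: inner_axis)
    \<comment> \<open>Setting that component to 0 gives the missing inequality for the
      product.\<close>
    have "r \<bullet> ((\<eta> - (\<eta> $ i) *\<^sub>R axis i 1) - \<eta>) \<le> 0"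
      by (rule le) (use pos in \<open>auto simp: axis_def\<close>)
    then have "0 \<le> r $ i * \<eta> $ i" by (simp add: inner_axis mult.commute)
    moreover have "r $ i * \<eta> $ i \<le> 0" using 1 pos by (simp add: mult_nonpos_nonneg)
    ultimately show "0 \<le> \<eta> $ i \<and> p $ i - \<kappa> (\<zeta> $ i) \<le> 0 \<and> (p $ i - \<kappa> (\<zeta> $ i)) * \<eta> $ i = 0"
      using pos 1 by (simp flip: ri)
  qed
next
  assume R: "\<forall>i. 0 \<le> \<eta> $ i \<and> p $ i - \<kappa> (\<zeta> $ i) \<le> 0 \<and> (p $ i - \<kappa> (\<zeta> $ i)) * \<eta> $ i = 0"
  have "dissipation \<kappa> \<zeta> \<eta> + ereal (p \<bullet> (y - \<eta>)) \<le> dissipation \<kappa> \<zeta> y" for y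
  proof (cases "\<forall>i. 0 \<le> y $ i")
    case True
    have "(p - vec_map \<kappa> \<zeta>) \<bullet> (y - \<eta>) = (\<Sum>i\<in>UNIV. (p $ i - \<kappa> (\<zeta> $ i)) * y $ i)"
      unfolding inner_vec_def using R by (intro sum.cong refl) (auto simp: vec_map_def right_diff_distrib)
    also have "\<dots> \<le> 0" using R True by (intro sum_nonpos) (simp add: mult_nonpos_nonneg)
    finally show ?thesis using R True
      by (simp add: dissipation_def inner_diff_left inner_diff_right)
  qed (use R in \<open>auto simp: dissipation_def\<close>)
  then show "p \<in> subdifferential (dissipation \<kappa> \<zeta>) \<eta>"
    using R unfolding subdifferential_def by (simp add: dissipation_def)
qed

section \<open>The optimal control problem\<close>

lemma history_eq_integral:
  assumes "continuous_on {0..T} y" "t \<in> {0..T}"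
  shows "history y0 y t = integral {0..t} y + y0"
proof -
  have "y absolutely_integrable_on {0..t}"
    by (intro absolutely_integrable_continuous_real continuous_on_subset[OF assms(1)]) (use assms(2) in auto)
  then show ?thesis unfolding history_def by (simp add: LINT_interval_eq_integral)
qed

lemma history_ac_on:
  assumes "continuous_on {0..T} y"
  shows "ac_on 0 T (history y0 y) y"
proof (rule ac_on_cong[OF ac_on_add[OF ac_on_integral[OF absolutely_integrable_continuous_real[OF assms]] ac_on_const[of 0 T y0]]])
  show "history y0 y t = integral {0..t} y + y0" if "t \<in> {0..T}" for t
    by (rule history_eq_integral[OF assms that])
qed simp

lemma ac_on_nth: "ac_on a b f f' \<Longrightarrow> ac_on a b (\<lambda>t. f t $ i) (\<lambda>t. f' t $ i)"
  by (rule ac_on_linear[OF _ bounded_linear_vec_nth])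

lemma Lp2_nth: "f \<in> Lp {0<..<T} 2 \<Longrightarrow> (\<lambda>t. f t $ i) \<in> Lp {0<..<T} 2" for f :: "real \<Rightarrow> real ^ 'n"
  by (rule Lp2_linear[OF _ bounded_linear_vec_nth])

lemma ac_on_axis: "ac_on a b f f' \<Longrightarrow> ac_on a b (\<lambda>t. f t *\<^sub>R x) (\<lambda>t. f' t *\<^sub>R x)"
  by (rule ac_on_linear[OF _ bounded_linear_scaleR_left])

lemma Lp2_axis: "f \<in> Lp {0<..<T} 2 \<Longrightarrow> (\<lambda>t. f t *\<^sub>R x) \<in> Lp {0<..<T} 2" for x :: "'a::euclidean_space"
  by (rule Lp2_linear[OF _ bounded_linear_scaleR_left])

lemma L2_inner_eq_integral:
  fixes f g f' g' :: "real \<Rightarrow> 'a::euclidean_space"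
  assumes "f \<in> Lp {0<..<T} 2" "g \<in> Lp {0<..<T} 2"
    and "AE t in lebesgue_on {0<..<T}. f' t = f t" "AE t in lebesgue_on {0<..<T}. g' t = g t"
  shows "L2_inner T f' g' = integral {0..T} (\<lambda>t. f t \<bullet> g t)"
proof -
  have i: "(\<lambda>t. f t \<bullet> g t) absolutely_integrable_on {0..T}" by (rule Lp2_inner_absolutely_integrable[OF assms(1,2)])
  have ae: "AE t in lebesgue_on {0<..<T}. f t \<bullet> g t = f' t \<bullet> g' t" using assms(3,4) by eventually_elim simp
  have "(\<lambda>t. f' t \<bullet> g' t) absolutely_integrable_on {0..T}"
    by (rule absolutely_integrable_cong_AE_interval[OF i ae])
  then show ?thesis unfolding L2_inner_def
    by (simp add: LINT_interval_eq_integral integral_cong_AE_interval[OF ae])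
qed

lemma H1_inner_eq_integral:
  fixes f g f' g' :: "real \<Rightarrow> 'a::euclidean_space"
  assumes "0 < T" and f: "ac_on 0 T f f'" "f' \<in> Lp {0<..<T} 2" and g: "ac_on 0 T g g'" "g' \<in> Lp {0<..<T} 2"
  shows "H1_inner T f g = integral {0..T} (\<lambda>t. f t \<bullet> g t) + integral {0..T} (\<lambda>t. f' t \<bullet> g' t)"
  unfolding H1_inner_def
  by (intro arg_cong2[where f = "(+)"] L2_inner_eq_integral f g weak_deriv_ac_on Lp2_continuous ac_on_continuous[OF f(1)] ac_on_continuous[OF g(1)] \<open>0 < T\<close> AE_I2 refl)

text \<open>The perturbation acts in one coordinate. Separating off the part without
  \<open>A\<close> leaves a scalar square, to which \<open>integral_square_deriv\<close>
  applies.\<close>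

lemma integral_norm_add_axis:
  fixes f :: "real \<Rightarrow> real ^ 'n"
  assumes f: "f \<in> Lp {0<..<T} 2" and A: "A \<in> Lp {0<..<T} 2"
  shows "integral {0..T} (\<lambda>t. (f t + A t *\<^sub>R axis i 1) \<bullet> (f t + A t *\<^sub>R axis i 1))
    = integral {0..T} (\<lambda>t. f t \<bullet> f t - f t $ i * f t $ i) + integral {0..T} (\<lambda>t. (f t $ i + A t)\<^sup>2)"
proof -
  note fi = Lp2_nth[OF f, of i]
  have "integral {0..T} (\<lambda>t. (f t + A t *\<^sub>R axis i 1) \<bullet> (f t + A t *\<^sub>R axis i 1))
    = integral {0..T} (\<lambda>t. (f t \<bullet> f t - f t $ i * f t $ i) + (f t $ i + A t)\<^sup>2)"
  proof (rule integral_cong)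
    fix t
    have "axis i 1 \<bullet> f t = f t $ i" "f t \<bullet> axis i 1 = f t $ i" "axis i (1::real) \<bullet> axis i 1 = (1::real)"
      by (simp_all add: inner_axis inner_axis' )
    then show "(f t + A t *\<^sub>R axis i 1) \<bullet> (f t + A t *\<^sub>R axis i 1) = (f t \<bullet> f t - f t $ i * f t $ i) + (f t $ i + A t)\<^sup>2"
      by (simp add: inner_add_left inner_add_right power2_eq_square algebra_simps)
  qed
  also have "\<dots> = integral {0..T} (\<lambda>t. f t \<bullet> f t - f t $ i * f t $ i) + integral {0..T} (\<lambda>t. (f t $ i + A t)\<^sup>2)"
  proof (rule integral_add_absolutely_integrable)
    show "(\<lambda>t. f t \<bullet> f t - f t $ i * f t $ i) absolutely_integrable_on {0..T}"
      by (intro set_integral_diff(1) Lp2_inner_absolutely_integrable[OF f f] Lp2_mult_absolutely_integrable[OF fi fi])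
    show "(\<lambda>t. (f t $ i + A t)\<^sup>2) absolutely_integrable_on {0..T}"
      unfolding power2_eq_square by (intro Lp2_mult_absolutely_integrable Lp2_add fi A)
  qed
  finally show ?thesis .
qed

lemma H1_norm_square: "(H1_norm T f)\<^sup>2 = H1_inner T f f"
proof -
  have "0 \<le> H1_inner T f f" unfolding H1_inner_def L2_inner_def by simp
  then show ?thesis by (simp add: H1_norm_def)
qed

lemma H1_norm_add_axis:
  fixes f f' :: "real \<Rightarrow> real ^ 'n"
  assumes "0 < T" and f: "ac_on 0 T f f'" "f' \<in> Lp {0<..<T} 2" and A: "ac_on 0 T A A'" "A' \<in> Lp {0<..<T} 2"
  shows "(H1_norm T (\<lambda>t. f t + A t *\<^sub>R axis i 1))\<^sup>2
    = integral {0..T} (\<lambda>t. f t \<bullet> f t - f t $ i * f t $ i) + integral {0..T} (\<lambda>t. f' t \<bullet> f' t - f' t $ i * f' t $ i)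
      + (integral {0..T} (\<lambda>t. (f t $ i + A t)\<^sup>2) + integral {0..T} (\<lambda>t. (f' t $ i + A' t)\<^sup>2))"
proof -
  have ac: "ac_on 0 T (\<lambda>t. f t + A t *\<^sub>R axis i 1) (\<lambda>t. f' t + A' t *\<^sub>R axis i 1)"
    by (intro ac_on_add f ac_on_axis A)
  have l: "(\<lambda>t. f' t + A' t *\<^sub>R axis i 1) \<in> Lp {0<..<T} 2"
    by (intro Lp2_add f Lp2_axis A)
  show ?thesis
    unfolding H1_norm_square H1_inner_eq_integral[OF \<open>0 < T\<close> ac l ac l]
      integral_norm_add_axis[OF f(2) A(2)]
      integral_norm_add_axis[OF Lp2_continuous[OF ac_on_continuous[OF f(1)]] Lp2_continuous[OF ac_on_continuous[OF A(1)]]]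
    by simp
qed

locale control_problem =
  fixes T \<alpha> :: real
    and \<kappa> :: "real \<Rightarrow> real"
    and y0 qd :: "real ^ 'n"
    and j :: "(real \<Rightarrow> real ^ 'n) \<Rightarrow> real"
    and j' :: "(real \<Rightarrow> real ^ 'n) \<Rightarrow> (real \<Rightarrow> real ^ 'n)"
    and lb qb zb :: "real \<Rightarrow> real ^ 'n"
  assumes T: "T > 0" and alpha: "\<alpha> > 0"
    and kappa_diff: "\<kappa> differentiable_on UNIV"
    and kappa_C2: "deriv \<kappa> C1_differentiable_on UNIV"
    and j_C1: "C1_functional_on_L2 T j j'"
    and unique_solvability: "\<And>l. l \<in> H10 T \<Longrightarrow> \<exists>!q. is_state T \<alpha> \<kappa> y0 l q"
    and opt: "locally_optimal T \<alpha> \<kappa> y0 j qd lb"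
    and qb: "qb = sol_op T \<alpha> \<kappa> y0 lb"
    and zb: "zb = (\<lambda>t. - \<alpha> *\<^sub>R qb t + lb t - vec_map \<kappa> (history y0 qb t))"
begin

abbreviation "q' \<equiv> weak_deriv {0<..<T} qb"
abbreviation "l' \<equiv> weak_deriv {0<..<T} lb"
abbreviation "H i t \<equiv> history y0 qb t $ i"
abbreviation "k1 \<equiv> deriv \<kappa>"
abbreviation "k2 \<equiv> deriv (deriv \<kappa>)"

definition z' :: "'n \<Rightarrow> real \<Rightarrow> real" where
  "z' i t = - \<alpha> * q' t $ i + l' t $ i - k1 (H i t) * qb t $ i"

lemma k1: "(\<kappa> has_real_derivative k1 x) (at x)"
  using kappa_diff unfolding differentiable_on_def
  by (metis DERIV_deriv_iff_real_differentiable UNIV_I)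

lemma k2: "(k1 has_real_derivative k2 x) (at x)" and k2_continuous: "continuous_on UNIV k2"
proof -
  obtain D where D: "\<And>t. (k1 has_vector_derivative D t) (at t)" "continuous_on UNIV D"
    using kappa_C2 unfolding C1_differentiable_on_def by auto
  have d: "(k1 has_real_derivative D t) (at t)" for t
    using D(1) by (simp add: has_real_derivative_iff_has_vector_derivative)
  then have "k2 = D" using DERIV_imp_deriv by blast
  then show "(k1 has_real_derivative k2 x) (at x)" "continuous_on UNIV k2"
    using d D(2) by auto
qed

lemma k1_continuous: "continuous_on UNIV k1"
  by (rule DERIV_continuous_on[OF has_field_derivative_at_within[OF k2]])

lemma lb_H10: "lb \<in> H10 T"
  using opt unfolding locally_optimal_def by blast

lemma lb_ac: "ac_on 0 T lb l'" and l'_Lp: "l' \<in> Lp {0<..<T} 2" and lb_0: "lb 0 = 0"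
  using W1p0_D[OF T _ lb_H10] by auto

lemma qb_state: "is_state T \<alpha> \<kappa> y0 lb qb"
  unfolding qb sol_op_def by (rule theI'[OF unique_solvability[OF lb_H10]])

lemma qb_ac: "ac_on 0 T qb q'" and q'_Lp: "q' \<in> Lp {0<..<T} 2" and qb_0: "qb 0 = 0"
proof -
  have "qb \<in> H10 T" using qb_state unfolding is_state_def solves_state_eq_def by blast
  from W1p0_D[OF T _ this] show "ac_on 0 T qb q'" "q' \<in> Lp {0<..<T} 2" "qb 0 = 0" by auto
qed

lemma qb_outside: "t \<notin> {0..T} \<Longrightarrow> qb t = 0"
  using qb_state unfolding is_state_def by blast

lemma H_ac: "ac_on 0 T (\<lambda>t. H i t) (\<lambda>t. qb t $ i)"
  by (rule ac_on_nth[OF history_ac_on[OF ac_on_continuous[OF qb_ac]]])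

lemmas qb_i_continuous = ac_on_continuous[OF ac_on_nth[OF qb_ac]]
lemmas H_continuous = ac_on_continuous[OF H_ac]

lemma k1_H_continuous: "continuous_on {0..T} (\<lambda>t. k1 (H i t))"
  by (rule continuous_on_compose2[OF k1_continuous H_continuous]) simp

lemma k2_H_continuous: "continuous_on {0..T} (\<lambda>t. k2 (H i t) * qb t $ i)"
  by (intro continuous_intros qb_i_continuous continuous_on_compose2[OF k2_continuous H_continuous]) simp

lemma zb_nth: "zb t $ i = - \<alpha> * qb t $ i + lb t $ i - \<kappa> (H i t)"
  by (simp add: zb vec_map_def)

lemma zb_ac: "ac_on 0 T (\<lambda>t. zb t $ i) (z' i)"
proof -
  have "ac_on 0 T (\<lambda>t. \<kappa> (H i t)) (\<lambda>t. k1 (H i t) * qb t $ i)"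
    by (rule ac_on_chain[OF H_ac, where X = UNIV]) (auto intro: k1 k1_continuous)
  then have "ac_on 0 T (\<lambda>t. (- \<alpha> * qb t $ i + lb t $ i) - \<kappa> (H i t)) (\<lambda>t. (- \<alpha> * q' t $ i + l' t $ i) - k1 (H i t) * qb t $ i)"
    by (intro ac_on_minus ac_on_add ac_on_cmult ac_on_nth qb_ac lb_ac)
  then show ?thesis unfolding zb_nth z'_def[abs_def] .
qed

lemma z'_Lp: "z' i \<in> Lp {0<..<T} 2"
proof -
  have "(\<lambda>t. (- \<alpha> * q' t $ i + l' t $ i) + (- k1 (H i t)) * qb t $ i) \<in> Lp {0<..<T} 2"
    by (intro Lp2_add Lp2_continuous_mult Lp2_nth q'_Lp l'_Lp continuous_intros k1_H_continuous
        Lp2_continuous ac_on_continuous[OF qb_ac])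
  then show ?thesis unfolding z'_def[abs_def] by simp
qed

lemma state_complementarity:
  "AE t in lebesgue_on {0<..<T}. \<forall>i. 0 \<le> q' t $ i \<and> zb t $ i \<le> 0 \<and> zb t $ i * q' t $ i = 0"
proof -
  have "AE t in lebesgue_on {0<..<T}. - \<alpha> *\<^sub>R qb t + lb t \<in> subdifferential (dissipation \<kappa> (history y0 qb t)) (q' t)"
    using qb_state unfolding is_state_def solves_state_eq_def by blast
  then show ?thesis
    unfolding dissipation_subdifferential_iff zb_nth by simp
qed

end

section \<open>First variation\<close>

text \<open>
  The complementarity system \<open>q' \<ge> 0\<close>, \<open>z \<le> 0\<close>, \<open>z q' = 0\<close> is preserved when \<open>q'\<close> and \<open>z\<close> are multiplied
  by factors close to \<open>1\<close>. With the factors \<open>1 + \<epsilon> m\<close> and \<open>1 + \<epsilon> \<phi>\<close>, \<open>\<phi> = \<integral> n\<close>, on the \<open>i\<close>-th components, the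
  control \<open>\<alpha> q + \<kappa>(\<H>(q)) + z\<close> of the perturbed pair is \<open>lb + A \<epsilon>\<close>, and its state is known explicitly.
\<close>

locale variation = control_problem T \<alpha> \<kappa> y0 qd j j' lb qb zb
  for T \<alpha> \<kappa> and y0 qd :: "real ^ 'n" and j j' lb qb zb +
  fixes i :: 'n and m n :: "real \<Rightarrow> real"
  assumes m: "m \<in> borel_measurable (lebesgue_on {0<..<T})" "\<And>t. \<bar>m t\<bar> \<le> 1"
    and n: "n \<in> borel_measurable (lebesgue_on {0<..<T})" "\<And>t. \<bar>n t\<bar> \<le> 1"
begin

definition w' where "w' t = m t * q' t $ i"
text \<open>The value 0 outside \<open>{0..T}\<close> keeps the perturbed state normalised in the
  way \<open>is_state\<close> demands.\<close>

definition w where "w t = (if t \<in> {0..T} then integral {0..t} w' else 0)"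
definition W where "W t = integral {0..t} w"
definition \<phi> where "\<phi> t = integral {0..t} n"
text \<open>\<open>a\<close> and \<open>a'\<close> are the derivatives in \<epsilon>, at
  \<open>\<epsilon> = 0\<close>, of \<open>A\<close> and \<open>A'\<close>; a prime denotes the
  derivative in time. \<open>W\<close> is the resulting first-order change of the history.\<close>

definition a where "a t = \<alpha> * w t + k1 (H i t) * W t + zb t $ i * \<phi> t"
definition a' where "a' t = \<alpha> * w' t + (k2 (H i t) * qb t $ i * W t + k1 (H i t) * w t)
  + (z' i t * \<phi> t + zb t $ i * n t)"
definition A where "A \<epsilon> t = \<epsilon> * (\<alpha> * w t + zb t $ i * \<phi> t) + (\<kappa> (H i t + \<epsilon> * W t) - \<kappa> (H i t))"
definition A' where "A' \<epsilon> t = \<epsilon> * (\<alpha> * w' t + (z' i t * \<phi> t + zb t $ i * n t))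
  + (k1 (H i t + \<epsilon> * W t) * (qb t $ i + \<epsilon> * w t) - k1 (H i t) * qb t $ i)"
definition lv where "lv \<epsilon> t = lb t + A \<epsilon> t *\<^sub>R axis i 1"
definition qv where "qv \<epsilon> t = qb t + \<epsilon> *\<^sub>R (w t *\<^sub>R axis i 1)"

lemma w'_Lp: "w' \<in> Lp {0<..<T} 2"
  unfolding w'_def[abs_def] by (rule Lp2_bounded_mult[OF m(1) m(2) Lp2_nth[OF q'_Lp]])

lemma w_ac: "ac_on 0 T w w'"
  by (rule ac_on_cong[OF ac_on_integral[OF Lp_imp_absolutely_integrable[OF w'_Lp]]]) (auto simp: w_def)

lemma w_0: "w 0 = 0" by (simp add: w_def)

lemmas w_continuous = ac_on_continuous[OF w_ac]

lemma W_ac: "ac_on 0 T W w"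
  unfolding W_def by (rule ac_on_integral[OF absolutely_integrable_continuous_real[OF w_continuous]])

lemma W_0: "W 0 = 0" by (simp add: W_def)

lemmas W_continuous = ac_on_continuous[OF W_ac]

lemma n_Lp: "n \<in> Lp {0<..<T} 2"
  by (rule Lp2_bounded[OF n(1), of 1]) (use n(2) in auto)

lemma n_absolutely_integrable: "n absolutely_integrable_on {0..T}"
  by (rule Lp_imp_absolutely_integrable[OF n_Lp]) simp

lemma phi_ac: "ac_on 0 T \<phi> n"
  unfolding \<phi>_def by (rule ac_on_integral[OF n_absolutely_integrable])

lemmas phi_continuous = ac_on_continuous[OF phi_ac]
lemmas zb_continuous = ac_on_continuous[OF zb_ac]

lemma phi_bound:
  assumes "t \<in> {0..T}"
  shows "\<bar>\<phi> t\<bar> \<le> T"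
proof -
  have "n integrable_on {0..t}"
    using integrable_on_subinterval[OF ac_on_integrable[OF phi_ac]] assms by simp
  then have "norm (integral {0..t} n) \<le> integral {0..t} (\<lambda>t. 1)"
    by (rule integral_norm_bound_integral) (use n(2) in auto)
  then show ?thesis using assms by (simp add: \<phi>_def)
qed

lemma HW_ac: "ac_on 0 T (\<lambda>t. H i t + \<epsilon> * W t) (\<lambda>t. qb t $ i + \<epsilon> * w t)"
  by (intro ac_on_add H_ac ac_on_cmult W_ac)

lemma A_ac: "ac_on 0 T (A \<epsilon>) (A' \<epsilon>)"
proof -
  have k: "ac_on 0 T (\<lambda>t. \<kappa> (h t)) (\<lambda>t. k1 (h t) * h' t)" if "ac_on 0 T h h'" for h h'
    by (rule ac_on_chain[OF that, where X = UNIV]) (auto intro: k1 k1_continuous)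
  show ?thesis
    unfolding A_def[abs_def] A'_def[abs_def]
    by (intro ac_on_add ac_on_minus ac_on_cmult ac_on_mult k HW_ac H_ac w_ac zb_ac phi_ac)
qed

lemma zphi_Lp: "(\<lambda>t. z' i t * \<phi> t + zb t $ i * n t) \<in> Lp {0<..<T} 2"
  using Lp2_add[OF Lp2_continuous_mult[OF phi_continuous z'_Lp] Lp2_continuous_mult[OF zb_continuous n_Lp]]
  by (simp add: mult.commute)

lemma A'_Lp: "A' \<epsilon> \<in> Lp {0<..<T} 2"
proof -
  have c: "continuous_on {0..T} (\<lambda>t. k1 (H i t + \<epsilon> * W t) * (qb t $ i + \<epsilon> * w t) - k1 (H i t) * qb t $ i)"
    by (intro continuous_intros k1_H_continuous qb_i_continuous w_continuous
        continuous_on_compose2[OF k1_continuous ac_on_continuous[OF HW_ac]]) simp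
  show ?thesis
    unfolding A'_def[abs_def]
    by (intro Lp2_add Lp2_continuous_mult[OF continuous_on_const] w'_Lp zphi_Lp Lp2_continuous[OF c])
qed

lemma a'_Lp: "a' \<in> Lp {0<..<T} 2"
  unfolding a'_def[abs_def]
  by (intro Lp2_add Lp2_continuous_mult[OF continuous_on_const] w'_Lp zphi_Lp Lp2_continuous)
    (intro continuous_intros k1_H_continuous w_continuous k2_H_continuous W_continuous)+

lemma a_ac: "ac_on 0 T a a'"
proof -
  have k: "ac_on 0 T (\<lambda>t. k1 (H i t)) (\<lambda>t. k2 (H i t) * qb t $ i)"
    by (rule ac_on_chain[OF H_ac, where X = UNIV]) (auto intro: k2 k2_continuous)
  have "ac_on 0 T a (\<lambda>t. \<alpha> * w' t + (k2 (H i t) * qb t $ i * W t + k1 (H i t) * w t)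
  + (z' i t * \<phi> t + zb t $ i * n t))"
    unfolding a_def[abs_def] by (intro ac_on_add ac_on_cmult ac_on_mult k w_ac W_ac zb_ac phi_ac)
  then show ?thesis unfolding a'_def[abs_def] .
qed

text \<open>Here the normalisation of \<phi> at 0 matters:
  \<open>zb 0 $ i = - \<kappa> (y0 $ i)\<close> is in general not zero.\<close>

lemma A_0: "A \<epsilon> 0 = 0" by (simp add: A_def w_0 W_0 \<phi>_def)

lemma lv_ac: "ac_on 0 T (lv \<epsilon>) (\<lambda>t. l' t + A' \<epsilon> t *\<^sub>R axis i 1)"
  unfolding lv_def[abs_def] by (intro ac_on_add lb_ac ac_on_axis A_ac)

lemma lv_H10: "lv \<epsilon> \<in> H10 T"
proof (rule W1p0_I[OF T _ lv_ac])
  show "(\<lambda>t. l' t + A' \<epsilon> t *\<^sub>R axis i 1) \<in> Lp {0<..<T} 2"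
    by (intro Lp2_add l'_Lp Lp2_axis A'_Lp)
qed (simp_all add: lv_def A_0 lb_0)

lemma qv_ac: "ac_on 0 T (qv \<epsilon>) (\<lambda>t. q' t + \<epsilon> *\<^sub>R (w' t *\<^sub>R axis i 1))"
  unfolding qv_def[abs_def] by (intro ac_on_add qb_ac ac_on_linear[OF _ bounded_linear_scaleR_right] ac_on_axis w_ac)

lemma qv_H10: "qv \<epsilon> \<in> H10 T"
proof (rule W1p0_I[OF T _ qv_ac])
  show "(\<lambda>t. q' t + \<epsilon> *\<^sub>R (w' t *\<^sub>R axis i 1)) \<in> Lp {0<..<T} 2"
    by (intro Lp2_add q'_Lp Lp2_linear[OF _ bounded_linear_scaleR_right] Lp2_axis w'_Lp)
qed (simp_all add: qv_def w_0 qb_0)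

lemma history_qv:
  assumes "t \<in> {0..T}"
  shows "history y0 (qv \<epsilon>) t = history y0 qb t + (\<epsilon> * W t) *\<^sub>R axis i 1"
proof -
  have "ac_on 0 T (\<lambda>t. history y0 qb t + \<epsilon> *\<^sub>R (W t *\<^sub>R axis i 1)) (qv \<epsilon>)"
    unfolding qv_def[abs_def]
    by (intro ac_on_add history_ac_on ac_on_continuous[OF qb_ac] ac_on_linear[OF _ bounded_linear_scaleR_right] ac_on_axis W_ac)
  from ac_on_eq[OF this assms]
  have "history y0 qb t + \<epsilon> *\<^sub>R (W t *\<^sub>R axis i 1) = history y0 qb 0 + \<epsilon> *\<^sub>R (W 0 *\<^sub>R axis i 1) + integral {0..t} (qv \<epsilon>)" .
  also have "history y0 qb 0 = y0" using history_eq_integral[OF ac_on_continuous[OF qb_ac], of 0] T by simp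
  finally show ?thesis
    using history_eq_integral[OF ac_on_continuous[OF qv_ac] assms] by (simp add: W_0)
qed

text \<open>The smallness condition bounds \<open>\<epsilon> * m t\<close> and
  \<open>\<epsilon> * \<phi> t\<close> by 1 in absolute value, so both factors are nonnegative;
  multiplying by them preserves the signs and the vanishing product.\<close>

lemma qv_state:
  assumes "\<bar>\<epsilon>\<bar> * (1 + T) \<le> 1"
  shows "is_state T \<alpha> \<kappa> y0 (lv \<epsilon>) (qv \<epsilon>)"
  unfolding is_state_def solves_state_eq_def
proof (intro conjI allI impI)
  show "qv \<epsilon> \<in> H10 T" by (rule qv_H10)
  show "qv \<epsilon> t = 0" if "t \<notin> {0..T}" for t
    using that by (simp add: qv_def qb_outside w_def del: atLeastAtMost_iff)
  have "0 \<le> \<bar>\<epsilon>\<bar> * T" using T by simp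
  then have e1: "\<bar>\<epsilon>\<bar> \<le> 1" "\<bar>\<epsilon>\<bar> * T \<le> 1"
    using assms unfolding distrib_left by linarith+
  have "AE t in lebesgue_on {0<..<T}. 0 < t \<and> t < T" by (rule AE_intervalI) auto
  with state_complementarity weak_deriv_ac_on[OF T qv_ac, of \<epsilon>]
  show "AE t in lebesgue_on {0<..<T}. - \<alpha> *\<^sub>R qv \<epsilon> t + lv \<epsilon> t
      \<in> subdifferential (dissipation \<kappa> (history y0 (qv \<epsilon>) t)) (weak_deriv {0<..<T} (qv \<epsilon>) t)"
  proof eventually_elim
    case (elim t)
    then have t: "t \<in> {0..T}" by simp
    have "\<bar>\<epsilon> * m t\<bar> \<le> 1 * 1" unfolding abs_mult using e1 m(2) by (intro mult_mono) auto
    then have fm: "0 \<le> 1 + \<epsilon> * m t" by (simp add: abs_le_iff)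
    have "\<bar>\<epsilon> * \<phi> t\<bar> \<le> \<bar>\<epsilon>\<bar> * T" unfolding abs_mult using phi_bound[OF t] by (intro mult_left_mono) auto
    then have fp: "0 \<le> 1 + \<epsilon> * \<phi> t" using e1(2) by (simp add: abs_le_iff)
    show ?case
      unfolding dissipation_subdifferential_iff
    proof
      fix k
      have q: "weak_deriv {0<..<T} (qv \<epsilon>) t $ k = (if k = i then (1 + \<epsilon> * m t) * q' t $ k else q' t $ k)"
        unfolding elim(2) w'_def by (simp add: axis_def algebra_simps)
      \<comment> \<open>By the choice of \<open>A\<close> the terms with \<alpha> and \<kappa>
        cancel, and only the rescaled component of \<open>zb\<close> remains.\<close>
      have p: "(- \<alpha> *\<^sub>R qv \<epsilon> t + lv \<epsilon> t) $ k - \<kappa> (history y0 (qv \<epsilon>) t $ k)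
          = (if k = i then (1 + \<epsilon> * \<phi> t) * zb t $ k else zb t $ k)"
        unfolding history_qv[OF t] zb_nth by (simp add: qv_def lv_def A_def axis_def zb_nth algebra_simps)
      have c: "0 \<le> q' t $ k" "zb t $ k \<le> 0" "zb t $ k * q' t $ k = 0" using elim(1) by auto
      show "0 \<le> weak_deriv {0<..<T} (qv \<epsilon>) t $ k \<and>
         (- \<alpha> *\<^sub>R qv \<epsilon> t + lv \<epsilon> t) $ k - \<kappa> (history y0 (qv \<epsilon>) t $ k) \<le> 0 \<and>
         ((- \<alpha> *\<^sub>R qv \<epsilon> t + lv \<epsilon> t) $ k - \<kappa> (history y0 (qv \<epsilon>) t $ k)) * weak_deriv {0<..<T} (qv \<epsilon>) t $ k = 0"
        unfolding p q using c fm fp by (auto simp: mult_nonneg_nonpos)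
    qed
  qed
qed

lemma sol_op_lv:
  assumes "\<bar>\<epsilon>\<bar> * (1 + T) \<le> 1"
  shows "sol_op T \<alpha> \<kappa> y0 (lv \<epsilon>) = qv \<epsilon>"
  unfolding sol_op_def by (rule the1_equality[OF unique_solvability[OF lv_H10]]) (rule qv_state[OF assms])

section \<open>Derivative of the cost along the perturbed pairs\<close>

lemma A_linearization:
  assumes "0 < \<eta>"
  shows "\<exists>\<delta>>0. \<forall>\<epsilon> t. \<bar>\<epsilon>\<bar> < \<delta> \<longrightarrow> t \<in> {0..T} \<longrightarrow> \<bar>A \<epsilon> t - \<epsilon> * a t\<bar> \<le> \<eta> * \<bar>\<epsilon>\<bar>"
proof -
  have "A \<epsilon> t - \<epsilon> * a t = \<kappa> (H i t + \<epsilon> * W t) - \<kappa> (H i t) - \<epsilon> * (k1 (H i t) * W t)" for \<epsilon> t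
    by (simp add: A_def a_def algebra_simps)
  then show ?thesis
    using uniform_linearization[OF k1 k1_continuous H_continuous W_continuous assms] by simp
qed

lemma A'_linearization:
  assumes "0 < \<eta>"
  shows "\<exists>\<delta>>0. \<forall>\<epsilon> t. \<bar>\<epsilon>\<bar> < \<delta> \<longrightarrow> t \<in> {0..T} \<longrightarrow> \<bar>A' \<epsilon> t - \<epsilon> * a' t\<bar> \<le> \<eta> * \<bar>\<epsilon>\<bar>"
proof -
  have "A' \<epsilon> t - \<epsilon> * a' t = k1 (H i t + \<epsilon> * W t) * (qb t $ i + \<epsilon> * w t) - k1 (H i t) * qb t $ i
     - \<epsilon> * (k2 (H i t) * qb t $ i * W t + k1 (H i t) * w t)" for \<epsilon> t
    by (simp add: A'_def a'_def algebra_simps)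
  then show ?thesis
    using uniform_linearization_product[OF k2 k2_continuous H_continuous W_continuous qb_i_continuous w_continuous assms] by simp
qed

text \<open>Stated for a general \<open>f\<close> because it serves twice: with
  \<open>f = lb\<close> for the control cost, and with \<open>f = 0\<close> to show that the
  perturbed controls tend to \<open>lb\<close> in H1.\<close>

lemma H1_square_deriv:
  assumes f: "ac_on 0 T f f'" "f' \<in> Lp {0<..<T} 2"
  shows "((\<lambda>\<epsilon>. (H1_norm T (\<lambda>t. f t + A \<epsilon> t *\<^sub>R axis i 1))\<^sup>2) has_real_derivative
    2 * integral {0..T} (\<lambda>t. f t $ i * a t) + 2 * integral {0..T} (\<lambda>t. f' t $ i * a' t)) (at 0)"
  unfolding H1_norm_add_axis[OF T f A_ac A'_Lp]
  by (rule derivative_eq_intros refl integral_square_deriv[OF T _ _ _ A_linearization] integral_square_deriv[OF T _ _ _ A'_linearization]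
       Lp2_nth Lp2_continuous ac_on_continuous f A_ac A'_Lp a_ac a'_Lp | simp)+

lemma cost_lv_deriv:
  "((\<lambda>\<epsilon>. j (qv \<epsilon>) + 1/2 * (norm (qv \<epsilon> T - qd))\<^sup>2 + 1/2 * (H1_norm T (lv \<epsilon>))\<^sup>2) has_real_derivative
    integral {0..T} (\<lambda>t. j' qb t $ i * w t) + (qb T - qd) $ i * w T
     + (integral {0..T} (\<lambda>t. lb t $ i * a t) + integral {0..T} (\<lambda>t. l' t $ i * a' t))) (at 0)"
proof -
  have qL: "qb \<in> Lp {0<..<T} 2" by (rule Lp2_continuous[OF ac_on_continuous[OF qb_ac]])
  have wL: "(\<lambda>t. w t *\<^sub>R axis i (1::real)) \<in> Lp {0<..<T} 2" by (rule Lp2_axis[OF Lp2_continuous[OF w_continuous]])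
  have jL: "j' qb \<in> Lp {0<..<T} 2" using j_C1 qL unfolding C1_functional_on_L2_def by blast
  have "((\<lambda>\<epsilon>. j (qv \<epsilon>)) has_real_derivative L2_inner T (j' qb) (\<lambda>t. w t *\<^sub>R axis i (1::real))) (at 0)"
    unfolding qv_def[abs_def] by (rule functional_deriv[OF j_C1 qL wL])
  also have "L2_inner T (j' qb) (\<lambda>t. w t *\<^sub>R axis i (1::real)) = integral {0..T} (\<lambda>t. j' qb t $ i * w t)"
    by (subst L2_inner_eq_integral[OF jL wL]) (auto simp: inner_axis mult.commute)
  finally have 1: "((\<lambda>\<epsilon>. j (qv \<epsilon>)) has_real_derivative integral {0..T} (\<lambda>t. j' qb t $ i * w t)) (at 0)" .
  have eq: "(norm (qv \<epsilon> T - qd))\<^sup>2 = (qb T - qd) \<bullet> (qb T - qd) + 2 * \<epsilon> * ((qb T - qd) $ i * w T) + \<epsilon>\<^sup>2 * (w T)\<^sup>2" for \<epsilon>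
  proof -
    have "qv \<epsilon> T - qd = (qb T - qd) + (\<epsilon> * w T) *\<^sub>R axis i 1" by (simp add: qv_def)
    moreover have "axis i 1 \<bullet> (qb T - qd) = (qb T - qd) $ i" "(qb T - qd) \<bullet> axis i 1 = (qb T - qd) $ i"
      "axis i (1::real) \<bullet> axis i 1 = (1::real)" by (simp_all only: inner_axis inner_axis' ) auto
    ultimately show ?thesis
      unfolding power2_norm_eq_inner by (simp only: inner_add_left inner_add_right inner_scaleR_left inner_scaleR_right)
        (simp add: power2_eq_square algebra_simps)
  qed
  have 2: "((\<lambda>\<epsilon>. (norm (qv \<epsilon> T - qd))\<^sup>2) has_real_derivative 2 * ((qb T - qd) $ i * w T)) (at 0)"
    unfolding eq by (auto intro!: derivative_eq_intros)
  have 3: "((\<lambda>\<epsilon>. (H1_norm T (lv \<epsilon>))\<^sup>2) has_real_derivative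
    2 * integral {0..T} (\<lambda>t. lb t $ i * a t) + 2 * integral {0..T} (\<lambda>t. l' t $ i * a' t)) (at 0)"
    unfolding lv_def[abs_def] by (rule H1_square_deriv[OF lb_ac l'_Lp])
  show ?thesis
    by (rule derivative_eq_intros 1 2 3 refl | simp)+
qed

text \<open>The parameter \<epsilon> may have either sign, so local optimality makes 0 an interior
  minimum of the cost along \<open>lv\<close>, and the derivative vanishes with equality.\<close>

lemma stationarity:
  "integral {0..T} (\<lambda>t. j' qb t $ i * w t) + (qb T - qd) $ i * w T
     + (integral {0..T} (\<lambda>t. lb t $ i * a t) + integral {0..T} (\<lambda>t. l' t $ i * a' t)) = 0"
proof -
  obtain \<rho> where "0 < \<rho>" and \<rho>: "\<And>l. l \<in> H10 T \<Longrightarrow> H1_norm T (\<lambda>t. l t - lb t) \<le> \<rho> \<Longrightarrow>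
        cost T \<alpha> \<kappa> y0 j qd lb \<le> cost T \<alpha> \<kappa> y0 j qd l"
    using opt unfolding locally_optimal_def by blast
  \<comment> \<open>\<open>N \<epsilon>\<close> is the squared H1 distance of
    \<open>lv \<epsilon>\<close> from \<open>lb\<close>; its differentiability at 0 provides the
    continuity that keeps \<open>lv \<epsilon>\<close> in the ball of optimality.\<close>
  define N where "N \<epsilon> = (H1_norm T (\<lambda>t. (0 :: real ^ 'n) + A \<epsilon> t *\<^sub>R axis i 1))\<^sup>2" for \<epsilon>
  have "ac_on 0 T (\<lambda>t. 0 :: real ^ 'n) (\<lambda>t. 0)" by (rule ac_on_const)
  from H1_square_deriv[OF this Lp2_const] have "isCont N 0"
    unfolding N_def by (rule DERIV_isCont)
  moreover have "N 0 = 0"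
  proof -
    have "A 0 = (\<lambda>t. 0)" by (simp add: A_def fun_eq_iff)
    then show ?thesis unfolding N_def
      using H1_inner_eq_integral[OF T ac_on_const[of 0 T 0] Lp2_const ac_on_const[of 0 T 0] Lp2_const]
      by (simp add: H1_norm_square)
  qed
  ultimately have "\<forall>\<^sub>F \<epsilon> in at 0. N \<epsilon> < \<rho>\<^sup>2"
    using \<open>0 < \<rho>\<close> by (intro order_tendstoD(2)[of N 0]) (auto simp: isCont_def)
  then obtain d where "d > 0" and d: "\<And>\<epsilon>. \<epsilon> \<noteq> 0 \<Longrightarrow> \<bar>\<epsilon>\<bar> < d \<Longrightarrow> N \<epsilon> < \<rho>\<^sup>2"
    unfolding eventually_at by (auto simp: dist_real_def)
  \<comment> \<open>The radius \<open>d\<close> keeps the control inside that ball, and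
    \<open>1 / (1 + T)\<close> ensures that its state is the explicit
    \<open>qv \<epsilon>\<close>.\<close>
  define r where "r = min d (1 / (1 + T))"
  have "0 < r" using \<open>d > 0\<close> T by (simp add: r_def)
  have small: "\<bar>\<epsilon>\<bar> * (1 + T) \<le> 1" if "\<bar>\<epsilon>\<bar> < r" for \<epsilon>
    using that T by (simp add: r_def pos_less_divide_eq)
  have cost: "cost T \<alpha> \<kappa> y0 j qd (lv \<epsilon>) = j (qv \<epsilon>) + 1/2 * (norm (qv \<epsilon> T - qd))\<^sup>2 + 1/2 * (H1_norm T (lv \<epsilon>))\<^sup>2"
    if "\<bar>\<epsilon>\<bar> < r" for \<epsilon>
    unfolding cost_def sol_op_lv[OF small[OF that]] ..
  have lv0: "lv 0 = lb" by (simp add: lv_def A_def fun_eq_iff)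
  show ?thesis
  proof (rule DERIV_local_min[OF cost_lv_deriv \<open>0 < r\<close>], intro allI impI)
    fix \<epsilon> :: real assume "\<bar>0 - \<epsilon>\<bar> < r"
    then have e: "\<bar>\<epsilon>\<bar> < r" by simp
    have "cost T \<alpha> \<kappa> y0 j qd (lv 0) \<le> cost T \<alpha> \<kappa> y0 j qd (lv \<epsilon>)"
    proof (cases "\<epsilon> = 0")
      case False
      have "N \<epsilon> < \<rho>\<^sup>2" using d[OF False] e by (simp add: r_def)
      then have "H1_norm T (\<lambda>t. lv \<epsilon> t - lb t) \<le> \<rho>"
        using \<open>0 < \<rho>\<close> unfolding N_def lv_def by (intro less_imp_le) (auto intro: power_less_imp_less_base[of _ 2])
      then show ?thesis unfolding lv0 by (rule \<rho>[OF lv_H10])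
    qed simp
    then show "j (qv 0) + 1/2 * (norm (qv 0 T - qd))\<^sup>2 + 1/2 * (H1_norm T (lv 0))\<^sup>2
      \<le> j (qv \<epsilon>) + 1/2 * (norm (qv \<epsilon> T - qd))\<^sup>2 + 1/2 * (H1_norm T (lv \<epsilon>))\<^sup>2"
      using cost[OF e] cost[of 0] \<open>0 < r\<close> by simp
  qed
qed

end

section \<open>The multiplier\<close>

lemma integral_inner_vec:
  fixes f g :: "real \<Rightarrow> real ^ 'n"
  assumes "\<And>i. (\<lambda>t. f t $ i * g t $ i) absolutely_integrable_on S"
  shows "integral S (\<lambda>t. f t \<bullet> g t) = (\<Sum>i\<in>UNIV. integral S (\<lambda>t. f t $ i * g t $ i))"
    "(\<lambda>t. f t \<bullet> g t) absolutely_integrable_on S"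
  using assms set_lebesgue_integral_eq_integral(1)
  by (auto simp: inner_vec_def intro!: Henstock_Kurzweil_Integration.integral_sum absolutely_integrable_sum)

lemma absolutely_integrable_AE_bounded_mult:
  fixes f h :: "real \<Rightarrow> real"
  assumes f: "f \<in> borel_measurable (lebesgue_on {a<..<b})" "AE t in lebesgue_on {a<..<b}. \<bar>f t\<bar> \<le> C"
    and h: "h absolutely_integrable_on {a..b}"
  shows "(\<lambda>t. f t * h t) absolutely_integrable_on {a..b}"
    "\<bar>integral {a..b} (\<lambda>t. f t * h t)\<bar> \<le> C * integral {a..b} (\<lambda>t. \<bar>h t\<bar>)"
proof -
  have ch: "(\<lambda>t. C * \<bar>h t\<bar>) absolutely_integrable_on {a..b}"
    by (intro set_integrable_mult_right set_integrable_abs h)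
  have ae: "AE t in lebesgue_on {a<..<b}. norm (f t * h t) \<le> C * \<bar>h t\<bar>"
    using f(2) by eventually_elim (simp add: abs_mult mult_right_mono)
  show i: "(\<lambda>t. f t * h t) absolutely_integrable_on {a..b}"
  proof (rule absolutely_integrable_boundI[OF _ ch ae])
    show "(\<lambda>t. f t * h t) \<in> borel_measurable (lebesgue_on {a<..<b})"
      using f(1) absolutely_integrable_interval_measurable[OF h] by measurable
  qed
  obtain N where N: "negligible N" "\<forall>t\<in>{a..b} - N. norm (f t * h t) \<le> C * \<bar>h t\<bar>"
    using ae unfolding AE_interval_iff_negligible by blast
  \<comment> \<open>Both integrands are set to 0 on the exceptional null set, so that the bound
    holds at every point as the norm estimate requires.\<close>
  let ?p = "\<lambda>t. if t \<in> N then 0 else f t * h t" and ?q = "\<lambda>t. if t \<in> N then 0 else C * \<bar>h t\<bar>"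
  have "integral {a..b} (\<lambda>t. f t * h t) = integral {a..b} ?p" "integral {a..b} (\<lambda>t. C * \<bar>h t\<bar>) = integral {a..b} ?q"
    by (rule integral_spike[OF N(1)]; simp)+
  moreover have "norm (integral {a..b} ?p) \<le> integral {a..b} ?q"
  proof (rule integral_norm_bound_integral)
    show "?p integrable_on {a..b}"
      by (rule integrable_spike[OF set_lebesgue_integral_eq_integral(1)[OF i] N(1)]) simp
    show "?q integrable_on {a..b}"
      by (rule integrable_spike[OF set_lebesgue_integral_eq_integral(1)[OF ch] N(1)]) simp
  qed (use N(2) in auto)
  ultimately show "\<bar>integral {a..b} (\<lambda>t. f t * h t)\<bar> \<le> C * integral {a..b} (\<lambda>t. \<bar>h t\<bar>)" by simp
qed

section \<open>The norm of \<open>W1p0 T 1\<close> and uniqueness in its dual\<close>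

lemma W11_norm_eq_integral:
  fixes d d' :: "real \<Rightarrow> 'a::euclidean_space"
  assumes "0 < T" and d: "ac_on 0 T d d'"
  shows "W11_norm T d = integral {0..T} (\<lambda>t. norm (d t)) + integral {0..T} (\<lambda>t. norm (d' t))"
proof -
  have n: "(\<lambda>t. norm (d' t)) absolutely_integrable_on {0..T}"
    by (rule absolutely_integrable_norm[unfolded o_def, OF ac_on_absolutely_integrable[OF d]])
  have ae: "AE t in lebesgue_on {0<..<T}. norm (d' t) = norm (weak_deriv {0<..<T} d t)"
    using weak_deriv_ac_on[OF assms] by eventually_elim simp
  have "(\<lambda>t. norm (d t)) absolutely_integrable_on {0..T}"
    by (intro absolutely_integrable_continuous_real continuous_on_norm ac_on_continuous[OF d])
  then show ?thesis
    unfolding W11_norm_def using absolutely_integrable_cong_AE_interval[OF n ae]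
    by (simp add: LINT_interval_eq_integral integral_cong_AE_interval[OF ae])
qed

text \<open>Poincare's inequality: a function vanishing at 0 is bounded pointwise by the integral of
  the norm of its derivative, and integrating over \<open>{0..T}\<close> costs a factor
  \<open>T\<close>.\<close>

lemma W11_norm_le:
  fixes d d' :: "real \<Rightarrow> 'a::euclidean_space"
  assumes "0 < T" and d: "ac_on 0 T d d'" "d 0 = 0"
  shows "W11_norm T d \<le> (1 + T) * integral {0..T} (\<lambda>t. norm (d' t))"
proof -
  have ni: "(\<lambda>t. norm (d' t)) integrable_on {0..T}"
    using absolutely_integrable_norm[unfolded o_def, OF ac_on_absolutely_integrable[OF d(1)]]
      set_lebesgue_integral_eq_integral(1) by blast
  have b: "norm (d t) \<le> integral {0..T} (\<lambda>t. norm (d' t))" if t: "t \<in> {0..T}" for t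
  proof -
    have s: "(\<lambda>t. norm (d' t)) integrable_on {0..t}" "d' integrable_on {0..t}"
      by (rule integrable_on_subinterval[OF ni], use t in simp)
        (rule integrable_on_subinterval[OF ac_on_integrable[OF d(1)]], use t in simp)
    have "norm (integral {0..t} d') \<le> integral {0..t} (\<lambda>t. norm (d' t))"
      by (rule integral_norm_bound_integral[OF s(2,1)]) simp
    also have "\<dots> \<le> integral {0..T} (\<lambda>t. norm (d' t))"
      by (rule integral_subset_le[OF _ s(1) ni]) (use t in auto)
    finally show ?thesis using ac_on_eq[OF d(1) t] d(2) by simp
  qed
  have "integral {0..T} (\<lambda>t. norm (d t)) \<le> integral {0..T} (\<lambda>t. integral {0..T} (\<lambda>t. norm (d' t)))"
    by (intro integral_le integrable_continuous_interval continuous_on_norm ac_on_continuous[OF d(1)] b) auto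
  then show ?thesis unfolding W11_norm_eq_integral[OF assms(1) d(1)]
    using assms(1) by (simp add: distrib_right mult.commute)
qed

lemma W1p0_1_I:
  fixes f f' :: "real \<Rightarrow> 'a::euclidean_space"
  assumes "0 < T" "ac_on 0 T f f'" "f 0 = 0"
  shows "f \<in> W1p0 T 1"
  using W1p0_I[OF assms(1) _ assms(2) _ assms(3), of 1] ac_on_absolutely_integrable[OF assms(2)]
  by (simp add: Lp1_interval_iff)

text \<open>\<open>F\<close> and \<open>G\<close> agree on primitives of truncations of
  \<open>v'\<close>, which lie in \<open>H10 T\<close>. The remainders tend to 0 in
  \<open>W11_norm\<close> by dominated convergence, so boundedness of both functionals gives
  equality at \<open>v\<close>. Off \<open>W1p0 T 1\<close> equality is built into the extensional
  encoding.\<close>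

lemma W11_dual_eqI:
  fixes F G :: "(real \<Rightarrow> 'a::euclidean_space) \<Rightarrow> real"
  assumes "0 < T" and F: "F \<in> W11_dual T" and G: "G \<in> W11_dual T"
    and eq: "\<And>v. v \<in> H10 T \<Longrightarrow> F v = G v"
  shows "F = G"
proof
  fix v
  show "F v = G v"
  proof (cases "v \<in> W1p0 T 1")
    case False
    then show ?thesis using F G unfolding W11_dual_def by (simp add: extensional_def)
  next
    case True
    define v' where "v' = weak_deriv {0<..<T} v"
    have v: "ac_on 0 T v v'" "v 0 = 0" unfolding v'_def using W1p0_D[OF \<open>0 < T\<close> _ True] by auto
    have v'i: "v' absolutely_integrable_on {0..T}" by (rule ac_on_absolutely_integrable[OF v(1)])
    have v'm: "v' \<in> borel_measurable (lebesgue_on {0<..<T})" by (rule absolutely_integrable_interval_measurable[OF v'i])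
    obtain C1 C2 where C1: "\<And>v. v \<in> W1p0 T 1 \<Longrightarrow> \<bar>F v\<bar> \<le> C1 * W11_norm T v"
      and C2: "\<And>v. v \<in> W1p0 T 1 \<Longrightarrow> \<bar>G v\<bar> \<le> C2 * W11_norm T v"
      using F G unfolding W11_dual_def by blast
    define C where "C = \<bar>C1\<bar> + \<bar>C2\<bar>"
    \<comment> \<open>Truncation by magnitude makes the density bounded, hence square integrable,
      and leaves it dominated by \<open>v'\<close>.\<close>
    define h where "h n t = (if norm (v' t) \<le> real n then v' t else 0)" for n t
    define r where "r n t = norm (v' t - h n t)" for n t
    have hm: "h n \<in> borel_measurable (lebesgue_on {0<..<T})" for n
      unfolding h_def[abs_def] using v'm by measurable
    have hL: "h n \<in> Lp {0<..<T} 2" for n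
      by (rule Lp2_bounded[OF hm, of _ "real n"]) (simp add: h_def)
    have hi: "h n absolutely_integrable_on {0..T}" for n
      by (rule Lp_imp_absolutely_integrable[OF hL]) simp
    have ri: "r n integrable_on {0..T}" for n
      unfolding r_def[abs_def]
      using absolutely_integrable_norm[unfolded o_def, OF set_integral_diff(1)[OF v'i hi[of n]]]
        set_lebesgue_integral_eq_integral(1) by blast
    have "(\<lambda>n. integral {0..T} (r n)) \<longlonglongrightarrow> integral {0..T} (\<lambda>t. 0)"
    proof (rule dominated_convergence(2)[OF ri])
      show "(\<lambda>t. norm (v' t)) integrable_on {0..T}"
        using absolutely_integrable_norm[unfolded o_def, OF v'i] set_lebesgue_integral_eq_integral(1) by blast
      show "norm (r n t) \<le> norm (v' t)" for n t by (simp add: r_def h_def)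
      show "(\<lambda>n. r n t) \<longlonglongrightarrow> 0" for t
      proof (rule tendsto_eventually)
        obtain n0 where "norm (v' t) \<le> real n0" using real_arch_simple by blast
        then show "\<forall>\<^sub>F n in sequentially. r n t = 0"
          unfolding eventually_sequentially by (intro exI[of _ n0]) (auto simp: r_def h_def)
      qed
    qed
    then have lim: "(\<lambda>n. C * ((1 + T) * integral {0..T} (r n))) \<longlonglongrightarrow> 0"
      using tendsto_mult_right_zero[of "\<lambda>n. integral {0..T} (r n)" sequentially "C * (1 + T)"]
      by (simp add: mult.assoc)
    have bound: "\<bar>F v - G v\<bar> \<le> C * ((1 + T) * integral {0..T} (r n))" for n
    proof -
      define u where "u t = integral {0..t} (h n)" for t
      have u: "ac_on 0 T u (h n)" "u 0 = 0" unfolding u_def by (auto intro: ac_on_integral[OF hi])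
      define d where "d t = v t - u t" for t
      have d: "ac_on 0 T d (\<lambda>t. v' t - h n t)" "d 0 = 0"
        unfolding d_def using ac_on_minus[OF v(1) u(1)] v(2) u(2) by auto
      have mem: "u \<in> W1p0 T 1" "d \<in> W1p0 T 1" "u \<in> H10 T"
        using W1p0_1_I[OF \<open>0 < T\<close>] u d W1p0_I[OF \<open>0 < T\<close> _ u(1) hL u(2)] by auto
      have veq: "(\<lambda>t. u t + d t) = v" by (simp add: d_def)
      have "F v = F u + F d" "G v = G u + G d"
        using F G mem(1,2) unfolding W11_dual_def veq[symmetric] by blast+
      then have "\<bar>F v - G v\<bar> \<le> \<bar>F d\<bar> + \<bar>G d\<bar>" using eq[OF mem(3)] by linarith
      moreover have "W11_norm T d \<ge> 0" unfolding W11_norm_def by simp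
      then have "C1 * W11_norm T d \<le> \<bar>C1\<bar> * W11_norm T d" "C2 * W11_norm T d \<le> \<bar>C2\<bar> * W11_norm T d"
        by (intro mult_right_mono; simp)+
      ultimately have "\<bar>F v - G v\<bar> \<le> C * W11_norm T d"
        using C1[OF mem(2)] C2[OF mem(2)] unfolding C_def distrib_right by linarith
      also have "\<dots> \<le> C * ((1 + T) * integral {0..T} (r n))"
        unfolding r_def[abs_def] by (rule mult_left_mono[OF W11_norm_le[OF \<open>0 < T\<close> d]]) (simp add: C_def)
      finally show ?thesis .
    qed
    have "\<bar>F v - G v\<bar> \<le> 0"
      by (rule LIMSEQ_le_const[OF lim]) (use bound in blast)
    then show ?thesis by simp
  qed
qed

lemma sum_axis_nth: "(\<Sum>i\<in>UNIV. x i *\<^sub>R axis i (1::real)) $ k = x k"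
  by (simp add: axis_def if_distrib sum.delta cong: if_cong)

context control_problem
begin

definition J where "J i t = j' qb t $ i"
text \<open>The tail integral is the contribution of the zeroth-order part of the H1 product: the
  integral of \<open>lb t $ i * v t\<close> equals that of the tail integral times \<open>v'\<close>
  when \<open>v\<close> vanishes at 0.\<close>

definition g where "g i t = - (l' t $ i + tail_integral T (\<lambda>t. lb t $ i) t)"
definition K2 where "K2 i t = k2 (H i t) * qb t $ i"
definition \<xi> where "\<xi> i = adjoint_state T \<alpha> (J i) ((qb T - qd) $ i) (g i) (\<lambda>t. k1 (H i t)) (K2 i)"

lemma lb_i: "(\<lambda>t. lb t $ i) absolutely_integrable_on {0..T}"
  by (rule absolutely_integrable_continuous_real[OF ac_on_continuous[OF ac_on_nth[OF lb_ac]]])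

lemma tail_lb_continuous: "continuous_on {0..T} (tail_integral T (\<lambda>t. lb t $ i))"
  by (rule tail_integral_continuous[OF lb_i])

lemma g_Lp: "g i \<in> Lp {0<..<T} 2"
proof -
  have "(\<lambda>t. (- 1) * (l' t $ i + tail_integral T (\<lambda>t. lb t $ i) t)) \<in> Lp {0<..<T} 2"
    by (intro Lp2_continuous_mult[OF continuous_on_const] Lp2_add Lp2_nth l'_Lp Lp2_continuous tail_lb_continuous)
  then show ?thesis unfolding g_def[abs_def] by simp
qed

lemma g_absolutely_integrable: "g i absolutely_integrable_on {0..T}"
  by (rule Lp_imp_absolutely_integrable[OF g_Lp]) simp

lemma j'_Lp: "j' qb \<in> Lp {0<..<T} 2"
  using j_C1 Lp2_continuous[OF ac_on_continuous[OF qb_ac]] unfolding C1_functional_on_L2_def by blast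

lemma J_absolutely_integrable: "J i absolutely_integrable_on {0..T}"
  unfolding J_def[abs_def] by (rule Lp_imp_absolutely_integrable[OF Lp2_nth[OF j'_Lp]]) simp

lemma K2_continuous: "continuous_on {0..T} (K2 i)"
  unfolding K2_def[abs_def] by (rule k2_H_continuous)

lemma H1_pairing:
  assumes a: "ac_on 0 T a a'" "a 0 = 0" "a' \<in> Lp {0<..<T} 2"
  shows "integral {0..T} (\<lambda>t. lb t $ i * a t) + integral {0..T} (\<lambda>t. l' t $ i * a' t) = - integral {0..T} (\<lambda>t. g i t * a' t)"
proof -
  have 1: "(\<lambda>t. l' t $ i * a' t) absolutely_integrable_on {0..T}"
    by (rule Lp2_mult_absolutely_integrable[OF Lp2_nth[OF l'_Lp] a(3)])
  have 2: "(\<lambda>t. tail_integral T (\<lambda>t. lb t $ i) t * a' t) absolutely_integrable_on {0..T}"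
    by (rule absolutely_integrable_continuous_mult[OF tail_lb_continuous ac_on_absolutely_integrable[OF a(1)]])
  have "integral {0..T} (\<lambda>t. g i t * a' t)
    = integral {0..T} (\<lambda>t. - (l' t $ i * a' t + tail_integral T (\<lambda>t. lb t $ i) t * a' t))"
    by (rule integral_cong) (simp add: g_def algebra_simps)
  also have "\<dots> = - (integral {0..T} (\<lambda>t. l' t $ i * a' t) + integral {0..T} (\<lambda>t. tail_integral T (\<lambda>t. lb t $ i) t * a' t))"
    by (simp only: Henstock_Kurzweil_Integration.integral_neg integral_add_absolutely_integrable[OF 1 2])
  finally show ?thesis using integral_mult_tail_integral[OF T lb_i a(1,2)] by simp
qed

text \<open>With \<open>m = 0\<close> the state is not perturbed at all, so only the control cost
  varies, and \<open>a'\<close> reduces to the derivative of \<open>z \<phi>\<close>.\<close>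

lemma z_stationarity:
  assumes n: "n \<in> borel_measurable (lebesgue_on {0<..<T})" "\<And>t. \<bar>n t\<bar> \<le> 1"
  shows "integral {0..T} (\<lambda>t. g i t * (z' i t * integral {0..t} n + zb t $ i * n t)) = 0"
proof -
  interpret V: variation T \<alpha> \<kappa> y0 qd j j' lb qb zb i "\<lambda>_. 0" n
    by unfold_locales (use n in auto)
  have w'0: "V.w' = (\<lambda>t. 0)" by (simp add: V.w'_def fun_eq_iff)
  have w0: "V.w = (\<lambda>t. 0)" by (simp add: V.w_def w'0 fun_eq_iff)
  have W0: "V.W = (\<lambda>t. 0)" by (simp add: V.W_def w0 fun_eq_iff)
  have a0: "V.a 0 = 0" by (simp add: V.a_def V.w_0 V.W_0 V.\<phi>_def)
  from V.stationarity have "integral {0..T} (\<lambda>t. g i t * V.a' t) = 0"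
    unfolding H1_pairing[OF V.a_ac a0 V.a'_Lp] by (simp add: w0)
  then show ?thesis by (simp add: V.a'_def w'0 w0 W0 V.\<phi>_def)
qed

text \<open>With \<open>n = 0\<close> the direction has density \<open>w' = m q'\<close>. The
  adjoint equation rewrites stationarity as orthogonality of \<open>\<xi> q'\<close> to the
  arbitrary bounded factor \<open>m\<close>.\<close>

lemma xi_complementarity: "AE t in lebesgue_on {0<..<T}. \<xi> i t * q' t $ i = 0"
proof (rule AE_eq_zero_if_orthogonal_to_bounded)
  \<comment> \<open>For integrability of the product \<open>\<xi> q'\<close> the adjoint equation is
    applied in the direction \<open>qb\<close> itself, whose primitive is needed as the argument
    \<open>V\<close>.\<close>
  have V: "ac_on 0 T (\<lambda>t. integral {0..t} (\<lambda>t. qb t $ i)) (\<lambda>t. qb t $ i)"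
    by (rule ac_on_integral[OF absolutely_integrable_continuous_real[OF qb_i_continuous]])
  show "(\<lambda>t. \<xi> i t * q' t $ i) absolutely_integrable_on {0..T}"
    unfolding \<xi>_def
    by (rule adjoint_equation(1)[OF T ac_on_nth[OF qb_ac] _ J_absolutely_integrable g_absolutely_integrable
          Lp2_mult_absolutely_integrable[OF g_Lp Lp2_nth[OF q'_Lp]] k1_H_continuous K2_continuous V])
      (simp_all add: qb_0)
  fix m :: "real \<Rightarrow> real"
  assume m: "m \<in> borel_measurable (lebesgue_on {0<..<T})" "\<And>t. \<bar>m t\<bar> \<le> 1"
  interpret V: variation T \<alpha> \<kappa> y0 qd j j' lb qb zb i m "\<lambda>_. 0"
    by unfold_locales (use m in auto)
  have p0: "V.\<phi> = (\<lambda>t. 0)" by (simp add: V.\<phi>_def fun_eq_iff)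
  have a0: "V.a 0 = 0" by (simp add: V.a_def V.w_0 V.W_0 p0)
  have "integral {0..T} (\<lambda>t. J i t * V.w t) + (qb T - qd) $ i * V.w T
     - integral {0..T} (\<lambda>t. g i t * (\<alpha> * V.w' t + K2 i t * V.W t + k1 (H i t) * V.w t)) = 0"
    using V.stationarity unfolding H1_pairing[OF V.a_ac a0 V.a'_Lp]
    by (simp add: J_def K2_def V.a'_def p0 add.assoc)
  moreover note adjoint_equation(2)[OF T V.w_ac V.w_0 J_absolutely_integrable[of i] g_absolutely_integrable[of i]
      Lp2_mult_absolutely_integrable[OF g_Lp V.w'_Lp] k1_H_continuous[of i] K2_continuous[of i] V.W_ac V.W_0, where \<alpha> = \<alpha> and k = "(qb T - qd) $ i"]
  ultimately have "integral {0..T} (\<lambda>t. \<xi> i t * V.w' t) = 0" unfolding \<xi>_def by simp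
  then show "integral {0..T} (\<lambda>t. \<xi> i t * q' t $ i * m t) = 0"
    by (simp add: V.w'_def mult.assoc mult.commute[of "m _"])
qed

text \<open>The absolutely continuous representative of \<open>g z\<close>, normalised to vanish at
  \<open>T\<close>.\<close>

definition G where "G i t = - tail_integral T (\<lambda>t. g i t * z' i t) t"

lemma gz'_absolutely_integrable: "(\<lambda>t. g i t * z' i t) absolutely_integrable_on {0..T}"
  by (rule Lp2_mult_absolutely_integrable[OF g_Lp z'_Lp])

lemma G_ac: "ac_on 0 T (G i) (\<lambda>t. g i t * z' i t)"
  using ac_on_linear[OF tail_integral_ac_on[OF gz'_absolutely_integrable] bounded_linear_minus[OF bounded_linear_ident]]
  unfolding G_def[abs_def] by simp

lemma G_T: "G i T = 0"
  by (simp add: G_def)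

lemma gz_eq_G: "AE t in lebesgue_on {0<..<T}. g i t * zb t $ i = G i t"
  unfolding G_def
  by (rule multiplier_complementarity[OF T zb_ac g_absolutely_integrable gz'_absolutely_integrable z_stationarity])

text \<open>The continuous part of \<xi>. Where \<xi> vanishes, \<open>\<alpha> g\<close> coincides
  with it and is therefore bounded.\<close>

definition xc where "xc i t = (qb T - qd) $ i + tail_integral T (J i) t
  - tail_integral T (\<lambda>t. k1 (H i t) * g i t + tail_integral T (\<lambda>t. K2 i t * g i t) t) t"

lemma xi_eq: "\<xi> i t = xc i t - \<alpha> * g i t"
  by (simp add: \<xi>_def adjoint_state_def xc_def)

lemma xc_continuous: "continuous_on {0..T} (xc i)"
  unfolding xc_def[abs_def]
  by (intro continuous_intros tail_integral_continuous J_absolutely_integrable set_integral_add(1)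
      absolutely_integrable_continuous_mult k1_H_continuous K2_continuous g_absolutely_integrable absolutely_integrable_continuous_real)

lemma g_bounded: "\<exists>C. AE t in lebesgue_on {0<..<T}. \<bar>g i t\<bar> \<le> C"
proof -
  obtain X where X: "\<And>t. t \<in> {0..T} \<Longrightarrow> \<bar>xc i t\<bar> \<le> X"
    using continuous_on_Icc_norm_bound[OF xc_continuous] by (metis real_norm_def)
  \<comment> \<open>Solving the formula for \<open>z'\<close> for \<open>l'\<close> and inserting it
    into \<open>g\<close> leaves exactly this continuous function besides \<open>z'\<close> and
    \<open>\<alpha> q'\<close>.\<close>
  have cc: "continuous_on {0..T} (\<lambda>t. k1 (H i t) * qb t $ i + tail_integral T (\<lambda>t. lb t $ i) t)"
    by (intro continuous_intros k1_H_continuous qb_i_continuous tail_lb_continuous)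
  show ?thesis
  proof (rule multiplier_bounded[OF T zb_ac G_ac G_T gz_eq_G _ cc])
    show "AE t in lebesgue_on {0<..<T}. g i t = - (z' i t + \<alpha> * q' t $ i)
        - (k1 (H i t) * qb t $ i + tail_integral T (\<lambda>t. lb t $ i) t)"
      by (rule AE_I2) (simp add: g_def z'_def)
    show "AE t in lebesgue_on {0<..<T}. zb t $ i * q' t $ i = 0"
      using state_complementarity by eventually_elim blast
    have "AE t in lebesgue_on {0<..<T}. 0 < t \<and> t < T" by (rule AE_intervalI) auto
    with xi_complementarity[of i] show "AE t in lebesgue_on {0<..<T}. q' t $ i \<noteq> 0 \<longrightarrow> \<bar>g i t\<bar> \<le> X / \<alpha>"
    proof eventually_elim
      case (elim t)
      show ?case
      proof
        assume "q' t $ i \<noteq> 0"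
        then have "\<alpha> * g i t = xc i t" using elim(1) by (simp add: xi_eq)
        then have "\<alpha> * \<bar>g i t\<bar> \<le> X" using X[of t] elim(2) alpha by (simp flip: abs_mult_pos' add: abs_mult)
        then show "\<bar>g i t\<bar> \<le> X / \<alpha>" using alpha by (simp add: pos_le_divide_eq mult.commute)
      qed
    qed
  qed
qed

definition Cg where "Cg i = (SOME C. AE t in lebesgue_on {0<..<T}. \<bar>g i t\<bar> \<le> C)"

lemma Cg: "AE t in lebesgue_on {0<..<T}. \<bar>g i t\<bar> \<le> Cg i"
  unfolding Cg_def by (rule someI_ex[OF g_bounded])

lemma g_measurable: "g i \<in> borel_measurable (lebesgue_on {0<..<T})"
  using g_Lp by (simp add: Lp2_interval_iff)

lemmas g_mult = absolutely_integrable_AE_bounded_mult[OF g_measurable Cg]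

text \<open>The functional makes sense on all of \<open>W1p0 T 1\<close> because \<open>g\<close> is
  essentially bounded; \<open>restrict\<close> supplies the extensionality required by
  \<open>W11_dual\<close>.\<close>

definition lam :: "(real \<Rightarrow> real ^ 'n) \<Rightarrow> real" where
  "lam = restrict (\<lambda>v. \<Sum>i\<in>UNIV. integral {0..T} (\<lambda>t. g i t * weak_deriv {0<..<T} v t $ i)) (W1p0 T 1)"

text \<open>Any density of \<open>v\<close> may replace the one chosen by \<open>weak_deriv\<close>.
  This makes \<open>lam\<close> computable on products and on
  \<open>kappa_history_deriv\<close>.\<close>

lemma lam_eq:
  assumes v: "ac_on 0 T v v'" "v 0 = 0"
  shows "lam v = (\<Sum>i\<in>UNIV. integral {0..T} (\<lambda>t. g i t * v' t $ i))"
proof -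
  have "lam v = (\<Sum>i\<in>UNIV. integral {0..T} (\<lambda>t. g i t * weak_deriv {0<..<T} v t $ i))"
    unfolding lam_def using W1p0_1_I[OF T v] by simp
  also have "\<dots> = (\<Sum>i\<in>UNIV. integral {0..T} (\<lambda>t. g i t * v' t $ i))"
  proof (intro sum.cong refl integral_cong_AE_interval)
    fix i
    show "AE t in lebesgue_on {0<..<T}. g i t * weak_deriv {0<..<T} v t $ i = g i t * v' t $ i"
      using weak_deriv_ac_on[OF T v(1)] by eventually_elim simp
  qed
  finally show ?thesis .
qed

lemma W11_D:
  fixes v :: "real \<Rightarrow> 'a::euclidean_space"
  assumes "v \<in> W1p0 T 1"
  shows "ac_on 0 T v (weak_deriv {0<..<T} v)" "v 0 = 0"
  using W1p0_D[OF T _ assms] by auto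

lemma lam_dual: "lam \<in> W11_dual T"
  unfolding W11_dual_def
proof (intro CollectI conjI ballI allI exI[of _ "\<Sum>i\<in>UNIV. \<bar>Cg i\<bar>"])
  show "lam \<in> extensional (W1p0 T 1)" unfolding lam_def by simp
next
  fix v w :: "real \<Rightarrow> real ^ 'n" assume vw: "v \<in> W1p0 T 1" "w \<in> W1p0 T 1"
  note v = W11_D[OF vw(1)] and w = W11_D[OF vw(2)]
  have "lam (\<lambda>t. v t + w t) = (\<Sum>i\<in>UNIV. integral {0..T} (\<lambda>t. g i t * weak_deriv {0<..<T} v t $ i + g i t * weak_deriv {0<..<T} w t $ i))"
    by (subst lam_eq[OF ac_on_add[OF v(1) w(1)]]) (simp_all add: v w distrib_left)
  also have "\<dots> = lam v + lam w"
    unfolding lam_eq[OF v] lam_eq[OF w] sum.distrib[symmetric]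
    by (intro sum.cong refl integral_add_absolutely_integrable g_mult(1)
        ac_on_absolutely_integrable[OF ac_on_nth[OF v(1)]] ac_on_absolutely_integrable[OF ac_on_nth[OF w(1)]])
  finally show "lam (\<lambda>t. v t + w t) = lam v + lam w" .
next
  fix c :: real and v :: "real \<Rightarrow> real ^ 'n" assume "v \<in> W1p0 T 1"
  note v = W11_D[OF this]
  have "lam (\<lambda>t. c *\<^sub>R v t) = (\<Sum>i\<in>UNIV. integral {0..T} (\<lambda>t. c * (g i t * weak_deriv {0<..<T} v t $ i)))"
    by (subst lam_eq[OF ac_on_linear[OF v(1) bounded_linear_scaleR_right]]) (simp_all add: v mult.left_commute)
  then show "lam (\<lambda>t. c *\<^sub>R v t) = c * lam v"
    unfolding lam_eq[OF v] by (simp add: sum_distrib_left)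
next
  fix v :: "real \<Rightarrow> real ^ 'n" assume "v \<in> W1p0 T 1"
  note v = W11_D[OF this]
  have nv: "(\<lambda>t. norm (weak_deriv {0<..<T} v t)) integrable_on {0..T}"
    using absolutely_integrable_norm[unfolded o_def, OF ac_on_absolutely_integrable[OF v(1)]]
      set_lebesgue_integral_eq_integral(1) by blast
  have "\<bar>lam v\<bar> \<le> (\<Sum>i\<in>UNIV. \<bar>integral {0..T} (\<lambda>t. g i t * weak_deriv {0<..<T} v t $ i)\<bar>)"
    unfolding lam_eq[OF v] by (rule sum_abs)
  also have "\<dots> \<le> (\<Sum>i\<in>UNIV. \<bar>Cg i\<bar> * W11_norm T v)"
  proof (rule sum_mono)
    fix i
    have vi: "(\<lambda>t. weak_deriv {0<..<T} v t $ i) absolutely_integrable_on {0..T}"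
      by (rule ac_on_absolutely_integrable[OF ac_on_nth[OF v(1)]])
    have ai: "(\<lambda>t. \<bar>weak_deriv {0<..<T} v t $ i\<bar>) integrable_on {0..T}"
      using set_integrable_abs[OF vi] set_lebesgue_integral_eq_integral(1) by blast
    have "0 \<le> integral {0..T} (\<lambda>t. \<bar>weak_deriv {0<..<T} v t $ i\<bar>)"
      by (rule Henstock_Kurzweil_Integration.integral_nonneg[OF ai]) simp
    moreover have "integral {0..T} (\<lambda>t. \<bar>weak_deriv {0<..<T} v t $ i\<bar>) \<le> integral {0..T} (\<lambda>t. norm (weak_deriv {0<..<T} v t))"
      by (rule integral_le[OF ai nv]) (rule component_le_norm_cart)
    moreover have "0 \<le> integral {0..T} (\<lambda>t. norm (v t))"
      by (intro Henstock_Kurzweil_Integration.integral_nonneg integrable_continuous_interval continuous_on_norm ac_on_continuous[OF v(1)]) simp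
    ultimately have *: "0 \<le> integral {0..T} (\<lambda>t. \<bar>weak_deriv {0<..<T} v t $ i\<bar>)"
      "integral {0..T} (\<lambda>t. \<bar>weak_deriv {0<..<T} v t $ i\<bar>) \<le> W11_norm T v"
      unfolding W11_norm_eq_integral[OF T v(1)] by linarith+
    have "\<bar>integral {0..T} (\<lambda>t. g i t * weak_deriv {0<..<T} v t $ i)\<bar> \<le> Cg i * integral {0..T} (\<lambda>t. \<bar>weak_deriv {0<..<T} v t $ i\<bar>)"
      by (rule g_mult(2)[OF vi])
    also have "\<dots> \<le> \<bar>Cg i\<bar> * W11_norm T v"
      using * by (intro mult_mono) auto
    finally show "\<bar>integral {0..T} (\<lambda>t. g i t * weak_deriv {0<..<T} v t $ i)\<bar> \<le> \<bar>Cg i\<bar> * W11_norm T v" .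
  qed
  finally show "\<bar>lam v\<bar> \<le> (\<Sum>i\<in>UNIV. \<bar>Cg i\<bar>) * W11_norm T v" by (simp add: sum_distrib_right)
qed

lemma lam_H1:
  assumes "v \<in> H10 T"
  shows "lam v + H1_inner T lb v = 0"
proof -
  let ?v' = "weak_deriv {0<..<T} v"
  have v: "ac_on 0 T v ?v'" "?v' \<in> Lp {0<..<T} 2" "v 0 = 0" using W1p0_D[OF T _ assms] by auto
  note L = Lp2_continuous[OF ac_on_continuous]
  have "H1_inner T lb v = integral {0..T} (\<lambda>t. lb t \<bullet> v t) + integral {0..T} (\<lambda>t. l' t \<bullet> ?v' t)"
    by (rule H1_inner_eq_integral[OF T lb_ac l'_Lp v(1,2)])
  also have "\<dots> = (\<Sum>i\<in>UNIV. integral {0..T} (\<lambda>t. lb t $ i * v t $ i)) + (\<Sum>i\<in>UNIV. integral {0..T} (\<lambda>t. l' t $ i * ?v' t $ i))"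
    by (intro arg_cong2[where f = "(+)"] integral_inner_vec(1) Lp2_mult_absolutely_integrable Lp2_nth L[OF lb_ac] L[OF v(1)] l'_Lp v(2))
  also have "\<dots> = (\<Sum>i\<in>UNIV. - integral {0..T} (\<lambda>t. g i t * ?v' t $ i))"
    unfolding sum.distrib[symmetric]
    by (intro sum.cong refl H1_pairing ac_on_nth[OF v(1)] Lp2_nth[OF v(2)]) (simp add: v(3))
  finally show ?thesis unfolding lam_eq[OF v(1,3)] by (simp add: sum_negf)
qed

text \<open>After replacing \<open>g z\<close> by \<open>G\<close>, the integrand is the density of
  the product \<open>G v\<close>, which vanishes at \<open>T\<close> through \<open>G\<close> and at
  0 through \<open>v\<close>.\<close>

lemma lam_zb:
  assumes "v \<in> W1p0 T 1"
  shows "dual_component lam i (\<lambda>t. zb t $ i * v t) = 0"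
proof -
  let ?v' = "weak_deriv {0<..<T} v"
  note v = W11_D[OF assms]
  have ac: "ac_on 0 T (\<lambda>t. (zb t $ i * v t) *\<^sub>R axis i (1::real)) (\<lambda>t. (z' i t * v t + zb t $ i * ?v' t) *\<^sub>R axis i 1)"
    by (intro ac_on_axis ac_on_mult zb_ac v)
  have "dual_component lam i (\<lambda>t. zb t $ i * v t)
    = (\<Sum>k\<in>UNIV. integral {0..T} (\<lambda>t. g k t * ((z' i t * v t + zb t $ i * ?v' t) *\<^sub>R axis i 1) $ k))"
    unfolding dual_component_def by (rule lam_eq[OF ac]) (simp add: v(2))
  also have "\<dots> = (\<Sum>k\<in>UNIV. if k = i then integral {0..T} (\<lambda>t. g i t * (z' i t * v t + zb t $ i * ?v' t)) else 0)"
    by (intro sum.cong refl) (auto simp: axis_def)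
  also have "\<dots> = integral {0..T} (\<lambda>t. g i t * (z' i t * v t + zb t $ i * ?v' t))" by simp
  also have "\<dots> = integral {0..T} (\<lambda>t. g i t * z' i t * v t + G i t * ?v' t)"
  proof (rule integral_cong_AE_interval)
    show "AE t in lebesgue_on {0<..<T}. g i t * (z' i t * v t + zb t $ i * ?v' t) = g i t * z' i t * v t + G i t * ?v' t"
      using gz_eq_G[of i] by eventually_elim (simp add: algebra_simps)
  qed
  also have "\<dots> = G i T * v T - G i 0 * v 0"
    using ac_on_diff[OF ac_on_mult[OF G_ac v(1)], of 0 T] T by simp
  finally show ?thesis by (simp add: G_T v(2))
qed

definition \<xi>v :: "real \<Rightarrow> real ^ 'n" where "\<xi>v t = (\<Sum>i\<in>UNIV. \<xi> i t *\<^sub>R axis i 1)"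

lemma xiv_nth: "\<xi>v t $ i = \<xi> i t"
  unfolding \<xi>v_def by (rule sum_axis_nth)

lemma xi_measurable: "\<xi> i \<in> borel_measurable (lebesgue_on {0<..<T})"
proof -
  have "xc i \<in> borel_measurable (lebesgue_on {0<..<T})"
    by (rule absolutely_integrable_interval_measurable[OF absolutely_integrable_continuous_real[OF xc_continuous]])
  then show ?thesis unfolding xi_eq[abs_def] using g_measurable[of i] by measurable
qed

lemma xi_bounded: "\<exists>C. AE t in lebesgue_on {0<..<T}. \<bar>\<xi> i t\<bar> \<le> C"
proof -
  obtain X where X: "\<And>t. t \<in> {0..T} \<Longrightarrow> \<bar>xc i t\<bar> \<le> X"
    using continuous_on_Icc_norm_bound[OF xc_continuous] by (metis real_norm_def)
  have "AE t in lebesgue_on {0<..<T}. 0 < t \<and> t < T" by (rule AE_intervalI) auto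
  with Cg[of i] have "AE t in lebesgue_on {0<..<T}. \<bar>\<xi> i t\<bar> \<le> X + \<alpha> * Cg i"
  proof eventually_elim
    case (elim t)
    have "\<bar>\<alpha> * g i t\<bar> \<le> \<alpha> * Cg i" unfolding abs_mult using elim(1) alpha by (simp add: mult_left_mono)
    then show ?case using X[of t] elim(2) unfolding xi_eq by auto
  qed
  then show ?thesis by blast
qed

lemma xiv_Linf: "\<xi>v \<in> Linf {0<..<T}"
proof -
  obtain C where C: "\<And>i. AE t in lebesgue_on {0<..<T}. \<bar>\<xi> i t\<bar> \<le> C i" using xi_bounded by metis
  have "AE t in lebesgue_on {0<..<T}. \<forall>i\<in>UNIV. \<bar>\<xi> i t\<bar> \<le> C i"
    by (intro AE_finite_allI C) simp
  then have "AE t in lebesgue_on {0<..<T}. norm (\<xi>v t) \<le> (\<Sum>i\<in>UNIV. C i)"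
  proof eventually_elim
    case (elim t)
    have "norm (\<xi>v t) \<le> (\<Sum>i\<in>UNIV. \<bar>\<xi>v t $ i\<bar>)" by (rule norm_le_l1_cart)
    also have "\<dots> \<le> (\<Sum>i\<in>UNIV. C i)" unfolding xiv_nth using elim by (intro sum_mono) simp
    finally show ?case .
  qed
  moreover have "\<xi>v \<in> borel_measurable (lebesgue_on {0<..<T})"
    unfolding \<xi>v_def[abs_def] using xi_measurable by measurable
  ultimately show ?thesis unfolding Linf_def by blast
qed

text \<open>Since \<open>\<kappa>'\<close> is continuously differentiable, its composition with the
  history is absolutely continuous; the product rule then provides the density needed to evaluate
  \<open>lam\<close>. Components are assembled with \<open>axis\<close> because the product rule is
  scalar.\<close>

lemma kappa_history_deriv_ac:
  assumes v: "continuous_on {0..T} v"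
  shows "ac_on 0 T (kappa_history_deriv \<kappa> y0 qb v)
    (\<lambda>t. \<Sum>i\<in>UNIV. (K2 i t * integral {0..t} v $ i + k1 (H i t) * v t $ i) *\<^sub>R axis i 1)"
proof -
  have V: "ac_on 0 T (\<lambda>t. integral {0..t} v) v" by (rule ac_on_integral[OF absolutely_integrable_continuous_real[OF v]])
  have k: "ac_on 0 T (\<lambda>t. k1 (H i t)) (K2 i)" for i
    unfolding K2_def[abs_def] by (rule ac_on_chain[OF H_ac, where X = UNIV]) (auto intro: k2 k2_continuous)
  have s: "ac_on 0 T (\<lambda>t. \<Sum>i\<in>S. f i t) (\<lambda>t. \<Sum>i\<in>S. f' i t)"
    if "finite S" "\<And>i. ac_on 0 T (f i) (f' i)" for S :: "'n set" and f f' :: "'n \<Rightarrow> real \<Rightarrow> real ^ 'n"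
    using that(1) by induction (auto intro: ac_on_const ac_on_add that(2))
  have "ac_on 0 T (\<lambda>t. \<Sum>i\<in>UNIV. (k1 (H i t) * integral {0..t} v $ i) *\<^sub>R axis i (1::real))
    (\<lambda>t. \<Sum>i\<in>UNIV. (K2 i t * integral {0..t} v $ i + k1 (H i t) * v t $ i) *\<^sub>R axis i 1)"
    by (intro s finite ac_on_axis ac_on_mult k ac_on_nth[OF V])
  then show ?thesis
  proof (rule ac_on_cong)
    fix t assume t: "t \<in> {0..T}"
    have "v absolutely_integrable_on {0..t}"
      by (intro absolutely_integrable_continuous_real continuous_on_subset[OF v]) (use t in auto)
    then have "(LINT s|lebesgue_on {0<..<t}. v s) = integral {0..t} v" by (rule LINT_interval_eq_integral)
    then show "kappa_history_deriv \<kappa> y0 qb v t = (\<Sum>i\<in>UNIV. (k1 (H i t) * integral {0..t} v $ i) *\<^sub>R axis i 1)"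
      by (simp add: kappa_history_deriv_def vec_eq_iff sum_axis_nth[simplified])
  qed simp
qed

text \<open>In every component this is \<open>adjoint_equation\<close>, with the three products with
  \<open>g\<close> redistributed over the two values of \<open>lam\<close>. Essential boundedness of
  \<open>g\<close> supplies integrability of \<open>g v'\<close> for all directions in
  \<open>W1p0 T 1\<close>.\<close>

lemma adjoint_system:
  assumes "v \<in> W1p0 T 1"
  shows "(LINT t|lebesgue_on {0<..<T}. \<xi>v t \<bullet> weak_deriv {0<..<T} v t) + \<alpha> * lam v
     + lam (kappa_history_deriv \<kappa> y0 qb v)
   = (LINT t|lebesgue_on {0<..<T}. j' qb t \<bullet> v t) + (qb T - qd) \<bullet> v T"
proof -
  let ?v' = "weak_deriv {0<..<T} v"
  let ?V = "\<lambda>t. integral {0..t} v"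
  note v = W11_D[OF assms]
  have cv: "continuous_on {0..T} v" by (rule ac_on_continuous[OF v(1)])
  have V: "ac_on 0 T ?V v" by (rule ac_on_integral[OF absolutely_integrable_continuous_real[OF cv]])
  have vi: "ac_on 0 T (\<lambda>t. v t $ i) (\<lambda>t. ?v' t $ i)" "v 0 $ i = 0" for i using ac_on_nth[OF v(1)] v(2) by auto
  have Vi: "ac_on 0 T (\<lambda>t. ?V t $ i) (\<lambda>t. v t $ i)" "?V 0 $ i = 0" for i using ac_on_nth[OF V] by auto
  have gv: "(\<lambda>t. g i t * ?v' t $ i) absolutely_integrable_on {0..T}" for i
    by (rule g_mult(1)[OF ac_on_absolutely_integrable[OF vi(1)]])
  have xi: "(\<lambda>t. \<xi> i t * ?v' t $ i) absolutely_integrable_on {0..T}" for i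
    unfolding \<xi>_def by (rule adjoint_equation(1)[OF T vi(1)[of i] vi(2)[of i] J_absolutely_integrable[of i] g_absolutely_integrable[of i]
          gv[of i] k1_H_continuous[of i] K2_continuous[of i] Vi(1)[of i] Vi(2)[of i]])
  have Jv: "(\<lambda>t. J i t * v t $ i) absolutely_integrable_on {0..T}" for i
    using absolutely_integrable_continuous_mult[OF ac_on_continuous[OF vi(1)] J_absolutely_integrable[of i]] by (simp add: mult.commute)
  have gk: "(\<lambda>t. g i t * (K2 i t * ?V t $ i + k1 (H i t) * v t $ i)) absolutely_integrable_on {0..T}" for i
    by (rule g_mult(1)) (intro absolutely_integrable_continuous_real continuous_intros K2_continuous
        ac_on_continuous[OF Vi(1)] k1_H_continuous ac_on_continuous[OF vi(1)])
  have comp: "integral {0..T} (\<lambda>t. \<xi> i t * ?v' t $ i) + \<alpha> * integral {0..T} (\<lambda>t. g i t * ?v' t $ i)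
      + integral {0..T} (\<lambda>t. g i t * (K2 i t * ?V t $ i + k1 (H i t) * v t $ i))
    = integral {0..T} (\<lambda>t. J i t * v t $ i) + (qb T - qd) $ i * v T $ i" for i
  proof -
    have "integral {0..T} (\<lambda>t. g i t * (\<alpha> * ?v' t $ i + K2 i t * ?V t $ i + k1 (H i t) * v t $ i))
      = integral {0..T} (\<lambda>t. \<alpha> * (g i t * ?v' t $ i) + g i t * (K2 i t * ?V t $ i + k1 (H i t) * v t $ i))"
      by (rule integral_cong) (simp add: algebra_simps)
    also have "\<dots> = \<alpha> * integral {0..T} (\<lambda>t. g i t * ?v' t $ i) + integral {0..T} (\<lambda>t. g i t * (K2 i t * ?V t $ i + k1 (H i t) * v t $ i))"
      by (subst integral_add_absolutely_integrable[OF set_integrable_mult_right[OF gv] gk]) simp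
    finally show ?thesis
      using adjoint_equation(2)[OF T vi(1)[of i] vi(2)[of i] J_absolutely_integrable[of i] g_absolutely_integrable[of i]
          gv[of i] k1_H_continuous[of i] K2_continuous[of i] Vi(1)[of i] Vi(2)[of i],
          where \<alpha> = \<alpha> and k = "(qb T - qd) $ i"] unfolding \<xi>_def by simp
  qed
  have "(LINT t|lebesgue_on {0<..<T}. \<xi>v t \<bullet> ?v' t) = (\<Sum>i\<in>UNIV. integral {0..T} (\<lambda>t. \<xi> i t * ?v' t $ i))"
    using integral_inner_vec[where f = \<xi>v and g = ?v' and S = "{0..T}"] xi by (simp add: xiv_nth LINT_interval_eq_integral)
  moreover have "(LINT t|lebesgue_on {0<..<T}. j' qb t \<bullet> v t) = (\<Sum>i\<in>UNIV. integral {0..T} (\<lambda>t. J i t * v t $ i))"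
    using integral_inner_vec[where f = "j' qb" and g = v and S = "{0..T}"] Jv by (simp add: J_def LINT_interval_eq_integral)
  moreover have "lam (kappa_history_deriv \<kappa> y0 qb v)
      = (\<Sum>i\<in>UNIV. integral {0..T} (\<lambda>t. g i t * (K2 i t * ?V t $ i + k1 (H i t) * v t $ i)))"
  proof -
    have "kappa_history_deriv \<kappa> y0 qb v 0 = 0" by (simp add: kappa_history_deriv_def vec_eq_iff)
    from lam_eq[OF kappa_history_deriv_ac[OF cv] this] show ?thesis unfolding sum_axis_nth .
  qed
  moreover have "(qb T - qd) \<bullet> v T = (\<Sum>i\<in>UNIV. (qb T - qd) $ i * v T $ i)" by (simp add: inner_vec_def)
  ultimately show ?thesis
    unfolding lam_eq[OF v] sum_distrib_left by (simp only: sum.distrib[symmetric] comp)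
qed

end

theorem theorem3p8:
  fixes T \<alpha> :: real
    and \<kappa> :: "real \<Rightarrow> real"
    and y0 qd :: "real ^ 'n"
    and j :: "(real \<Rightarrow> real ^ 'n) \<Rightarrow> real"
    and j' :: "(real \<Rightarrow> real ^ 'n) \<Rightarrow> (real \<Rightarrow> real ^ 'n)"
    and lb qb zb :: "real \<Rightarrow> real ^ 'n"
  assumes T: "T > 0" and alpha: "\<alpha> > 0"
    and kappa_nonneg: "\<And>x. \<kappa> x \<ge> 0"
    and kappa_Lipschitz: "\<exists>L. L-lipschitz_on UNIV \<kappa>"
    and kappa_diff: "\<kappa> differentiable_on UNIV"
    and kappa'_W12: "deriv \<kappa> \<in> W1p UNIV 2"
    and kappa_C2: "deriv \<kappa> C1_differentiable_on UNIV"
    and j_C1: "C1_functional_on_L2 T j j'"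
    and qd_nonneg: "\<And>i. qd $ i \<ge> 0"
    and unique_solvability: "\<And>l. l \<in> H10 T \<Longrightarrow> \<exists>!q. is_state T \<alpha> \<kappa> y0 l q"
    and opt: "locally_optimal T \<alpha> \<kappa> y0 j qd lb"
    and qb: "qb = sol_op T \<alpha> \<kappa> y0 lb"
    and zb: "zb = (\<lambda>t. - \<alpha> *\<^sub>R qb t + lb t - vec_map \<kappa> (history y0 qb t))"
  shows "\<exists>!lam. lam \<in> W11_dual T \<and> (\<exists>\<xi> \<in> Linf {0<..<T}.
     (\<forall>v \<in> W1p0 T 1.
        (LINT t|lebesgue_on {0<..<T}. \<xi> t \<bullet> weak_deriv {0<..<T} v t)
          + \<alpha> * lam v + lam (kappa_history_deriv \<kappa> y0 qb v)
        = (LINT t|lebesgue_on {0<..<T}. j' qb t \<bullet> v t) + (qb T - qd) \<bullet> v T) \<and>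
     (\<forall>i. AE t in lebesgue_on {0<..<T}. weak_deriv {0<..<T} qb t $ i * \<xi> t $ i = 0) \<and>
     (\<forall>i. \<forall>v \<in> W1p0 T 1. dual_component lam i (\<lambda>t. zb t $ i * v t) = 0) \<and>
     (\<forall>v \<in> H10 T. lam v + H1_inner T lb v = 0))"
proof -
  interpret control_problem T \<alpha> \<kappa> y0 qd j j' lb qb zb
    by unfold_locales (fact T alpha kappa_diff kappa_C2 j_C1 unique_solvability opt qb zb)+
  have compl: "AE t in lebesgue_on {0<..<T}. weak_deriv {0<..<T} qb t $ i * \<xi>v t $ i = 0" for i
    unfolding xiv_nth using xi_complementarity[of i] by (simp add: mult.commute)
  show ?thesis
  proof (rule ex1I[of _ lam])
    show "lam \<in> W11_dual T \<and> (\<exists>\<xi> \<in> Linf {0<..<T}.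
     (\<forall>v \<in> W1p0 T 1.
        (LINT t|lebesgue_on {0<..<T}. \<xi> t \<bullet> weak_deriv {0<..<T} v t)
          + \<alpha> * lam v + lam (kappa_history_deriv \<kappa> y0 qb v)
        = (LINT t|lebesgue_on {0<..<T}. j' qb t \<bullet> v t) + (qb T - qd) \<bullet> v T) \<and>
     (\<forall>i. AE t in lebesgue_on {0<..<T}. weak_deriv {0<..<T} qb t $ i * \<xi> t $ i = 0) \<and>
     (\<forall>i. \<forall>v \<in> W1p0 T 1. dual_component lam i (\<lambda>t. zb t $ i * v t) = 0) \<and>
     (\<forall>v \<in> H10 T. lam v + H1_inner T lb v = 0))"
      using lam_dual xiv_Linf adjoint_system compl lam_zb lam_H1 by blast
    fix F :: "(real \<Rightarrow> real ^ 'n) \<Rightarrow> real"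
    assume F: "F \<in> W11_dual T \<and> (\<exists>\<xi> \<in> Linf {0<..<T}.
     (\<forall>v \<in> W1p0 T 1.
        (LINT t|lebesgue_on {0<..<T}. \<xi> t \<bullet> weak_deriv {0<..<T} v t)
          + \<alpha> * F v + F (kappa_history_deriv \<kappa> y0 qb v)
        = (LINT t|lebesgue_on {0<..<T}. j' qb t \<bullet> v t) + (qb T - qd) \<bullet> v T) \<and>
     (\<forall>i. AE t in lebesgue_on {0<..<T}. weak_deriv {0<..<T} qb t $ i * \<xi> t $ i = 0) \<and>
     (\<forall>i. \<forall>v \<in> W1p0 T 1. dual_component F i (\<lambda>t. zb t $ i * v t) = 0) \<and>
     (\<forall>v \<in> H10 T. F v + H1_inner T lb v = 0))"
    show "F = lam"
    \<comment> \<open>The last equation of the system alone prescribes the multiplier on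
      \<open>H10 T\<close>, and density does the rest.\<close>
    proof (rule W11_dual_eqI[OF T _ lam_dual])
      show "F \<in> W11_dual T" using F by blast
      fix v :: "real \<Rightarrow> real ^ 'n" assume v: "v \<in> H10 T"
      then have "F v + H1_inner T lb v = 0" using F by blast
      then show "F v = lam v" using lam_H1[OF v] by linarith
    qed
  qed
qed

end
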